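(* Two elements $C,D\in\mathfrak{I}^U_K$ are incomparable if and only if $[C]=[D]+[C_E]$.
   Context: For a complex $C$ over $\mathbb{F}_2[U]$, $\widehat C=C/UC$, $\widehat f$ the induced map of a chain map, $\Phi$ the formal $U$-derivative of the differential. A horizontal almost $\iota_K$-complex is a pair $(C,\iota)$ of a bigraded complex $C$ of finitely generated free $\mathbb{F}_2[U]$-modules and a chain homotopy equivalence $\iota$ of $\widehat C$ with: $U$ of bigrading $(-1,-2)$; $U^{-1}C\simeq\mathbb{F}_2[U,U^{-1}]$; $\iota$ skew-graded; $\Phi\iota\Phi\iota\sim\iota\Phi\iota\Phi$; $\iota^2\sim1+\Phi\iota\Phi\iota$; some chain map $f\colon C\to C$ has $\widehat f\sim\iota\Phi\iota$. An almost $\iota_K$-local map $C\to D$ is a degree-preserving chain map $f$ with $U^{-1}f$ a homotopy equivalence and $\iota_D\widehat f\sim\widehat f\iota_C$; almost $\iota_K$-local equivalence means such maps exist both ways. $\mathfrak{I}^U_K$ is the abelian group of equivalence classes under $(C,\iota_C)\otimes(D,\iota_D)=(C\otimes D,\iota_C\otimes\iota_D+\Phi\iota_C\otimes\iota_D\Phi)$ (group operation written additively). Partial order: $C\le D$ iff there is an almost $\iota_K$-local map $C\to D$; $C,D$ are incomparable if neither $C\le D$ nor $D\le C$. $C_E$ is generated by $a,b,c,d,x$ with $a,x$ of bidegree $(0,0)$, $\partial a=Ub$, $\partial c=Ud$, $\partial b=\partial d=\partial x=0$, and involution $a\mapsto a+x$, $b\mapsto c$, $c\mapsto b$, $d\mapsto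 d$, $x\mapsto x+d$. *)

theory Defs
  imports "HOL-Library.Z2" "HOL-Computational_Algebra.Polynomial"
    "HOL-Computational_Algebra.Fraction_Field" "Jordan_Normal_Form.Matrix"
begin

text \<open>F2 is the type bit; F2[U] is bit poly; U is the polynomial [:0,1:].
  A finitely generated free bigraded complex over F2[U] is given by a homogeneous
  basis e_0,...,e_(n-1) (with bigradings gr i) and the matrix of the differential:
  entry (i,j) is the coefficient of e_i in the differential of e_j.
  U has bigrading (-1,-2); the differential has bigrading (-1,0).\<close>

record cx =
  rk  :: nat
  gr  :: "nat \<Rightarrow> int \<times> int"
  dif :: "bit poly mat"

definition Ushift :: "int \<Rightarrow> int \<times> int \<Rightarrow> int \<times> int" where
  "Ushift k v = (fst v - k, snd v - 2 * k)"   \<comment> \<open>grading of U^k times an element of grading v\<close>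

definition addgr :: "int \<times> int \<Rightarrow> int \<times> int \<Rightarrow> int \<times> int" where
  "addgr v w = (fst v + fst w, snd v + snd w)"

definition skew :: "int \<times> int \<Rightarrow> int \<times> int" where
  "skew v = (fst v, - snd v)"

definition hom_mat :: "(nat \<Rightarrow> int \<times> int) \<Rightarrow> (nat \<Rightarrow> int \<times> int) \<Rightarrow> int \<times> int \<Rightarrow> bit poly mat \<Rightarrow> bool" where
  "hom_mat grt grs \<delta> M \<longleftrightarrow>
     (\<forall>i < dim_row M. \<forall>j < dim_col M. M $$ (i,j) \<noteq> 0 \<longrightarrow>
        (\<exists>k::nat. M $$ (i,j) = monom 1 k \<and> Ushift (int k) (grt i) = addgr (grs j) \<delta>))"

definition is_complex :: "cx \<Rightarrow> bool" where
  "is_complex C \<longleftrightarrow> dif C \<in> carrier_mat (rk C) (rk C) \<and>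
     dif C * dif C = 0\<^sub>m (rk C) (rk C) \<and>
     hom_mat (gr C) (gr C) (-1, 0) (dif C)"

definition hatm :: "bit poly mat \<Rightarrow> bit mat" where
  "hatm M = map_mat (\<lambda>p. coeff p 0) M"

definition Phi :: "cx \<Rightarrow> bit poly mat" where
  "Phi C = map_mat pderiv (dif C)"

text \<open>ds, dt: differentials of source and target (square matrices).\<close>
definition chain_map :: "'a::comm_ring_1 mat \<Rightarrow> 'a mat \<Rightarrow> 'a mat \<Rightarrow> bool" where
  "chain_map ds dt f \<longleftrightarrow> f \<in> carrier_mat (dim_row dt) (dim_row ds) \<and> dt * f = f * ds"

definition homotopic :: "'a::comm_ring_1 mat \<Rightarrow> 'a mat \<Rightarrow> 'a mat \<Rightarrow> 'a mat \<Rightarrow> bool" where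
  "homotopic ds dt f g \<longleftrightarrow>
     (\<exists>H \<in> carrier_mat (dim_row dt) (dim_row ds). f - g = dt * H + H * ds)"

definition htpy_equiv :: "'a::comm_ring_1 mat \<Rightarrow> 'a mat \<Rightarrow> 'a mat \<Rightarrow> bool" where
  "htpy_equiv ds dt f \<longleftrightarrow> chain_map ds dt f \<and>
     (\<exists>g. chain_map dt ds g \<and> homotopic ds ds (g * f) (1\<^sub>m (dim_row ds))
          \<and> homotopic dt dt (f * g) (1\<^sub>m (dim_row dt)))"

definition tofr :: "bit poly \<Rightarrow> bit poly fract" where
  "tofr p = Fract p 1"

definition Uf :: "bit poly fract" where
  "Uf = tofr [:0, 1:]"

definition laurent :: "bit poly fract \<Rightarrow> bool" where
  "laurent x \<longleftrightarrow> (\<exists>p (n::nat). x = tofr p * Uf powi (- int n))"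

definition laurent_mat :: "bit poly fract mat \<Rightarrow> bool" where
  "laurent_mat M \<longleftrightarrow> (\<forall>i < dim_row M. \<forall>j < dim_col M. laurent (M $$ (i,j)))"

definition loc :: "bit poly mat \<Rightarrow> bit poly fract mat" where
  "loc M = map_mat tofr M"

definition lchain_map :: "bit poly fract mat \<Rightarrow> bit poly fract mat \<Rightarrow> bit poly fract mat \<Rightarrow> bool" where
  "lchain_map ds dt f \<longleftrightarrow> chain_map ds dt f \<and> laurent_mat f"

definition lhomotopic :: "bit poly fract mat \<Rightarrow> bit poly fract mat \<Rightarrow> bit poly fract mat \<Rightarrow> bit poly fract mat \<Rightarrow> bool" where
  "lhomotopic ds dt f g \<longleftrightarrow>
     (\<exists>H \<in> carrier_mat (dim_row dt) (dim_row ds). laurent_mat H \<and> f - g = dt * H + H * ds)"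

definition lhtpy_equiv :: "bit poly fract mat \<Rightarrow> bit poly fract mat \<Rightarrow> bit poly fract mat \<Rightarrow> bool" where
  "lhtpy_equiv ds dt f \<longleftrightarrow> lchain_map ds dt f \<and>
     (\<exists>g. lchain_map dt ds g \<and> lhomotopic ds ds (g * f) (1\<^sub>m (dim_row ds))
          \<and> lhomotopic dt dt (f * g) (1\<^sub>m (dim_row dt)))"

definition lhom_mat :: "(nat \<Rightarrow> int \<times> int) \<Rightarrow> (nat \<Rightarrow> int \<times> int) \<Rightarrow> int \<times> int \<Rightarrow> bit poly fract mat \<Rightarrow> bool" where
  "lhom_mat grt grs \<delta> M \<longleftrightarrow>
     (\<forall>i < dim_row M. \<forall>j < dim_col M. M $$ (i,j) \<noteq> 0 \<longrightarrow>
        (\<exists>k::int. M $$ (i,j) = Uf powi k \<and> Ushift k (grt i) = addgr (grs j) \<delta>))"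

text \<open>U^{-1} C is (graded) homotopy equivalent to F2[U,U^{-1}], the rank one complex with
  zero differential and generator in bigrading (0,0).\<close>
definition loc_tower :: "cx \<Rightarrow> bool" where
  "loc_tower C \<longleftrightarrow>
     (\<exists>F. lhom_mat (gr C) (\<lambda>_. (0,0)) (0,0) F \<and>
          lhtpy_equiv (0\<^sub>m 1 1) (loc (dif C)) F)"

definition hatd :: "cx \<Rightarrow> bit mat" where
  "hatd C = hatm (dif C)"

definition hPhi :: "cx \<Rightarrow> bit mat" where
  "hPhi C = hatm (Phi C)"

definition skew_graded :: "cx \<Rightarrow> bit mat \<Rightarrow> bool" where
  "skew_graded C \<iota> \<longleftrightarrow>
     (\<forall>i < rk C. \<forall>j < rk C. \<iota> $$ (i,j) \<noteq> 0 \<longrightarrow> gr C i = skew (gr C j))"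

definition almost_iotaK :: "cx \<Rightarrow> bit mat \<Rightarrow> bool" where
  "almost_iotaK C \<iota> \<longleftrightarrow>
     is_complex C \<and>
     \<iota> \<in> carrier_mat (rk C) (rk C) \<and>
     htpy_equiv (hatd C) (hatd C) \<iota> \<and>
     loc_tower C \<and>
     skew_graded C \<iota> \<and>
     homotopic (hatd C) (hatd C) (hPhi C * \<iota> * hPhi C * \<iota>) (\<iota> * hPhi C * \<iota> * hPhi C) \<and>
     homotopic (hatd C) (hatd C) (\<iota> * \<iota>) (1\<^sub>m (rk C) + hPhi C * \<iota> * hPhi C * \<iota>) \<and>
     (\<exists>f. chain_map (dif C) (dif C) f \<and>
          homotopic (hatd C) (hatd C) (hatm f) (\<iota> * hPhi C * \<iota>))"

definition local_map :: "cx \<times> bit mat \<Rightarrow> cx \<times> bit mat \<Rightarrow> bit poly mat \<Rightarrow> bool" where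
  "local_map Ci Di f \<longleftrightarrow>
     (let C = fst Ci; \<iota>C = snd Ci; D = fst Di; \<iota>D = snd Di in
       chain_map (dif C) (dif D) f \<and>
       hom_mat (gr D) (gr C) (0,0) f \<and>
       lhtpy_equiv (loc (dif C)) (loc (dif D)) (loc f) \<and>
       homotopic (hatd C) (hatd D) (\<iota>D * hatm f) (hatm f * \<iota>C))"

definition loc_le :: "cx \<times> bit mat \<Rightarrow> cx \<times> bit mat \<Rightarrow> bool" where
  "loc_le Ci Di \<longleftrightarrow> (\<exists>f. local_map Ci Di f)"

definition loc_equiv :: "cx \<times> bit mat \<Rightarrow> cx \<times> bit mat \<Rightarrow> bool" where
  "loc_equiv Ci Di \<longleftrightarrow> loc_le Ci Di \<and> loc_le Di Ci"

definition incomparable :: "cx \<times> bit mat \<Rightarrow> cx \<times> bit mat \<Rightarrow> bool" where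
  "incomparable Ci Di \<longleftrightarrow> \<not> loc_le Ci Di \<and> \<not> loc_le Di Ci"

text \<open>Kronecker product; basis e_i (x) e_j has index i * (rows of B) + j.\<close>
definition kron :: "'a::semiring_1 mat \<Rightarrow> 'a mat \<Rightarrow> 'a mat" where
  "kron A B = mat (dim_row A * dim_row B) (dim_col A * dim_col B)
     (\<lambda>(i,j). A $$ (i div dim_row B, j div dim_col B) * B $$ (i mod dim_row B, j mod dim_col B))"

definition tensor_cx :: "cx \<Rightarrow> cx \<Rightarrow> cx" where
  "tensor_cx C D = \<lparr> rk = rk C * rk D,
     gr = (\<lambda>k. addgr (gr C (k div rk D)) (gr D (k mod rk D))),
     dif = kron (dif C) (1\<^sub>m (rk D)) + kron (1\<^sub>m (rk C)) (dif D) \<rparr>"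

definition tensor :: "cx \<times> bit mat \<Rightarrow> cx \<times> bit mat \<Rightarrow> cx \<times> bit mat" where
  "tensor Ci Di =
     (let C = fst Ci; \<iota>C = snd Ci; D = fst Di; \<iota>D = snd Di in
       (tensor_cx C D, kron \<iota>C \<iota>D + kron (hPhi C * \<iota>C) (\<iota>D * hPhi D)))"

text \<open>Basis a, b, c, d, x = e_0, ..., e_4.\<close>
definition CE_cx :: cx where
  "CE_cx = \<lparr> rk = 5,
     gr = (\<lambda>k. if k = 1 then (0, 2) else if k = 2 then (0, -2) else (0, 0)),
     dif = mat 5 5 (\<lambda>(i,j). if (i,j) = (1,0) \<or> (i,j) = (3,2) then [:0, 1:] else 0) \<rparr>"

definition CE_iota :: "bit mat" where
  "CE_iota = mat 5 5 (\<lambda>(i,j). if (i,j) \<in> {(0,0),(4,0),(2,1),(1,2),(3,3),(4,4),(3,4)} then 1 else 0)"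

definition CE :: "cx \<times> bit mat" where
  "CE = (CE_cx, CE_iota)"

end

(*
  Setting U = 1 turns graded matrices over F2[U] into filtered matrices over F2, and reduction
  modulo U into taking the part of weight zero.  After this the conditions on a local map f from
  C to D form a finite system of linear equations over F2.  By the Fredholm alternative for the
  trace pairing Hom(C,D) x Hom(D,C) -> F2, the system has no solution if and only if some graded
  chain map D -> C that is an equivalence on towers reduces modulo U to iota h + h iota with
  h a chain map of the hat complexes.  From h one writes down local maps D -> C (x) C_E and
  D (x) C_E -> C explicitly.  Conversely, either of these excludes a local map f from C to D:
  composed with f, its component along the generator x has trace 1 (the Euler characteristic of
  the tower), but the compatibility with iota forces this trace to vanish.  So C and D are
  incomparable exactly when local maps between C and D (x) C_E exist in both directions.
*)
theory Submission
  imports Defs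
begin

text \<open>Each clause defining a local map has its own dual in the trace pairing: gradedness is
  dual to the forbidden matrix positions, the chain condition to commutators with the differential,
  compatibility with the involutions up to homotopy to expressions \<open>I * h + h * I'\<close>,
  and the equivalence after inverting U, which is the one inhomogeneous equation, to the rank-one
  matrix \<open>F * G'\<close>. The shape of C_E enters as follows. A chain map of the hat
  complexes, extended constantly in U, is in general no chain map, but its commutator with the
  differential is divisible by U, and the quotient reduces modulo U to the commutator with \<Phi>.
  The relations \<partial>a = Ub and \<partial>c = Ud of C_E accommodate exactly such pairs, while x
  carries the tower. The relations between \<Phi> and \<iota> hold only up to homotopy, which blocks
  direct calculation with words in \<Phi>, \<iota> and h; a compression turns them into equalities.
  What results is sharper than the theorem: C \<le> D + C_E holds exactly when D \<le> C fails, and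
  D + C_E \<le> C exactly when C \<le> D fails.\<close>

section \<open>Finitely supported matrices\<close>

text \<open>These simp rules turn ring operations on \<^typ>\<open>bit\<close> into bit operations, out of reach of
  ring normalisation.\<close>

declare bit_not_zero_iff [simp del] bit_not_one_iff [simp del]
  add_bit_eq_xor [simp del] mult_bit_eq_and [simp del]

lemma bit_add_self [simp]: "(a::bit) + a = 0"
  by (cases a) simp_all

text \<open>Matrices of all sizes live in one ring without unit, so identities between maps of
  different complexes are open to plain ring simplification. Sizes are tracked separately by
  \<open>dims\<close>, and \<open>idm n\<close> acts as a local unit.\<close>

typedef (overloaded) 'a fmat = "{f :: nat \<Rightarrow> nat \<Rightarrow> 'a::zero. \<exists>n. \<forall>i j. f i j \<noteq> 0 \<longrightarrow> i < n \<and> j < n}"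
  morphisms ent Abs_fmat
  by (rule exI[of _ "\<lambda>_ _. 0"]) auto

setup_lifting type_definition_fmat

lemma fmat_eqI: "(\<And>i j. ent A i j = ent B i j) \<Longrightarrow> A = B"
  by (metis ent_inject ext)

lemma ent_bound: obtains n where "\<And>i j. ent A i j \<noteq> 0 \<Longrightarrow> i < n \<and> j < n"
  using ent[of A] by auto

instantiation fmat :: (comm_ring_1) ring
begin

lift_definition zero_fmat :: "'a fmat" is "\<lambda>_ _. 0" by auto

lift_definition plus_fmat :: "'a fmat \<Rightarrow> 'a fmat \<Rightarrow> 'a fmat" is "\<lambda>f g i j. f i j + g i j"
proof -
  fix f g :: "nat \<Rightarrow> nat \<Rightarrow> 'a"
  assume "\<exists>n. \<forall>i j. f i j \<noteq> 0 \<longrightarrow> i < n \<and> j < n" "\<exists>n. \<forall>i j. g i j \<noteq> 0 \<longrightarrow> i < n \<and> j < n"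
  then obtain n m where "\<forall>i j. f i j \<noteq> 0 \<longrightarrow> i < n \<and> j < n" "\<forall>i j. g i j \<noteq> 0 \<longrightarrow> i < m \<and> j < m"
    by (elim exE)
  note * = this[rule_format]
  have "f i j + g i j \<noteq> 0 \<Longrightarrow> i < max n m \<and> j < max n m" for i j
    using *[of i j] by (cases "f i j = 0") (auto simp: less_max_iff_disj)
  then show "\<exists>n. \<forall>i j. f i j + g i j \<noteq> 0 \<longrightarrow> i < n \<and> j < n" by (intro exI allI impI)
qed

lift_definition uminus_fmat :: "'a fmat \<Rightarrow> 'a fmat" is "\<lambda>f i j. - f i j" by auto

definition minus_fmat :: "'a fmat \<Rightarrow> 'a fmat \<Rightarrow> 'a fmat" where "minus_fmat A B = A + - B"

lift_definition times_fmat :: "'a fmat \<Rightarrow> 'a fmat \<Rightarrow> 'a fmat"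
  is "\<lambda>f g i k. \<Sum>j | f i j \<noteq> 0. f i j * g j k"
proof -
  fix f g :: "nat \<Rightarrow> nat \<Rightarrow> 'a"
  assume "\<exists>n. \<forall>i j. f i j \<noteq> 0 \<longrightarrow> i < n \<and> j < n" "\<exists>n. \<forall>i j. g i j \<noteq> 0 \<longrightarrow> i < n \<and> j < n"
  then obtain n m where "\<forall>i j. f i j \<noteq> 0 \<longrightarrow> i < n \<and> j < n" "\<forall>i j. g i j \<noteq> 0 \<longrightarrow> i < m \<and> j < m"
    by (elim exE)
  note * = this[rule_format]
  have "i < max n m \<and> k < max n m" if nz: "(\<Sum>j | f i j \<noteq> 0. f i j * g j k) \<noteq> 0" for i k
  proof -
    obtain j where "f i j * g j k \<noteq> 0" by (rule sum.not_neutral_contains_not_neutral[OF nz])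
    then have "f i j \<noteq> 0" "g j k \<noteq> 0" by auto
    then show ?thesis using *(1)[of i j] *(2)[of j k] by (simp add: less_max_iff_disj)
  qed
  then show "\<exists>n. \<forall>i k. (\<Sum>j | f i j \<noteq> 0. f i j * g j k) \<noteq> 0 \<longrightarrow> i < n \<and> k < n" by (intro exI allI impI)
qed

lemma ent_mult_bound:
  assumes "\<And>i j. ent A i j \<noteq> 0 \<Longrightarrow> j < n"
  shows "ent (A * B) i k = (\<Sum>j<n. ent A i j * ent B j k)"
  unfolding times_fmat.rep_eq
  by (rule sum.mono_neutral_left) (use assms in auto)

lemma ent_mult_bound':
  assumes "\<And>i j. ent B i j \<noteq> 0 \<Longrightarrow> i < n"
  shows "ent (A * B) i k = (\<Sum>j<n. ent A i j * ent B j k)"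
proof -
  obtain m where m: "\<And>i j. ent A i j \<noteq> 0 \<Longrightarrow> i < m \<and> j < m" by (rule ent_bound[of "A"]) blast
  have "ent (A * B) i k = (\<Sum>j<max m n. ent A i j * ent B j k)"
    by (rule ent_mult_bound) (simp add: m less_max_iff_disj)
  also have "\<dots> = (\<Sum>j<n. ent A i j * ent B j k)"
  proof (rule sum.mono_neutral_right)
    have "ent B j k = 0" if "\<not> j < n" for j using assms that by blast
    then show "\<forall>j\<in>{..<max m n} - {..<n}. ent A i j * ent B j k = 0" by simp
  qed auto
  finally show ?thesis .
qed

instance
proof
  fix A B C :: "'a fmat"
  show "A + B + C = A + (B + C)" by (rule fmat_eqI) (simp only: plus_fmat.rep_eq add.assoc)
  show "A + B = B + A" by (rule fmat_eqI) (simp only: plus_fmat.rep_eq add.commute)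
  show "0 + A = A" by (rule fmat_eqI) (simp add: plus_fmat.rep_eq zero_fmat.rep_eq)
  show "- A + A = 0" by (rule fmat_eqI) (simp add: uminus_fmat.rep_eq plus_fmat.rep_eq zero_fmat.rep_eq)
  show "A - B = A + - B" unfolding minus_fmat_def ..
  obtain n where n: "\<And>i j. ent A i j \<noteq> 0 \<Longrightarrow> i < n \<and> j < n" by (rule ent_bound[of "A"]) blast
  obtain m where m: "\<And>i j. ent B i j \<noteq> 0 \<Longrightarrow> i < m \<and> j < m" by (rule ent_bound[of "B"]) blast
  have AX: "ent (A * X) i k = (\<Sum>j<n. ent A i j * ent X j k)" for X i k
    by (rule ent_mult_bound) (use n in auto)
  have BX: "ent (B * X) i k = (\<Sum>j<m. ent B i j * ent X j k)" for X i k
    by (rule ent_mult_bound) (use m in auto)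
  have ABX: "ent (A * B * X) i k = (\<Sum>j<m. ent (A * B) i j * ent X j k)" for X i k
  proof (rule ent_mult_bound)
    show "j < m" if nz: "ent (A * B) i j \<noteq> 0" for i j
    proof -
      obtain l where "ent A i l * ent B l j \<noteq> 0"
        by (rule sum.not_neutral_contains_not_neutral[OF nz[unfolded AX]])
      then have "ent B l j \<noteq> 0" by auto
      then show ?thesis using m by blast
    qed
  qed
  show "A * B * C = A * (B * C)"
  proof (rule fmat_eqI)
    fix i k
    show "ent (A * B * C) i k = ent (A * (B * C)) i k"
      unfolding ABX AX BX sum_distrib_left sum_distrib_right
      by (subst sum.swap) (simp add: mult.assoc)
  qed
  obtain n2 where n2: "\<And>i j. ent (A + B) i j \<noteq> 0 \<Longrightarrow> i < n2 \<and> j < n2" by (rule ent_bound[of "(A + B)"]) blast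
  define N where "N = max n2 (max n m)"
  have "ent ((A + B) * C) i k = (\<Sum>j<N. ent (A + B) i j * ent C j k)" for i k
    by (rule ent_mult_bound) (simp add: n2 N_def less_max_iff_disj)
  moreover have "ent (A * C) i k = (\<Sum>j<N. ent A i j * ent C j k)" for i k
    by (rule ent_mult_bound) (simp add: n N_def less_max_iff_disj)
  moreover have "ent (B * C) i k = (\<Sum>j<N. ent B i j * ent C j k)" for i k
    by (rule ent_mult_bound) (simp add: m N_def less_max_iff_disj)
  ultimately show "(A + B) * C = A * C + B * C"
    by (intro fmat_eqI) (simp add: plus_fmat.rep_eq algebra_simps sum.distrib)
  show "A * (B + C) = A * B + A * C"
    by (intro fmat_eqI) (simp add: plus_fmat.rep_eq AX algebra_simps sum.distrib)
qed

end

lemmas ent_simps = zero_fmat.rep_eq plus_fmat.rep_eq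

lemma fmat_add_self [simp]: "(A::bit fmat) + A = 0"
  by (rule fmat_eqI) (simp add: ent_simps)

lemma fmat_add_self_left [simp]: "(A::bit fmat) + (A + B) = B"
  by (simp add: add.assoc[symmetric])

lemma fmat_uminus [simp]: "- (A::bit fmat) = A"
  by (rule minus_unique) simp

lemma fmat_minus [simp]: "(A::bit fmat) - B = A + B"
  by (simp add: minus_fmat_def)

lemma fmat_add_eq_0_iff: "(A::bit fmat) + B = 0 \<longleftrightarrow> A = B"
  by (metis add.right_neutral fmat_add_self fmat_add_self_left)

lemma ent_mult_nonzero:
  assumes "ent (A * B) i k \<noteq> 0"
  obtains j where "ent A i j \<noteq> 0" "ent B j k \<noteq> 0"
  using assms sum.not_neutral_contains_not_neutral[of "\<lambda>j. ent A i j * ent B j k"]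
  unfolding times_fmat.rep_eq by force

text \<open>A relation between row and column indices expresses a size, a grading or a bound on
  weights alike, so that the single product rule \<open>supp_mult\<close> serves all three.\<close>

definition supp :: "(nat \<Rightarrow> nat \<Rightarrow> bool) \<Rightarrow> 'a::zero fmat \<Rightarrow> bool" where
  "supp R A \<longleftrightarrow> (\<forall>i j. ent A i j \<noteq> 0 \<longrightarrow> R i j)"

lemma suppD: "supp R A \<Longrightarrow> ent A i j \<noteq> 0 \<Longrightarrow> R i j"
  by (simp add: supp_def)

lemma supp_0 [simp]: "supp R 0" by (simp add: supp_def ent_simps)

lemma supp_add: "supp R A \<Longrightarrow> supp R B \<Longrightarrow> supp R (A + B)"
  unfolding supp_def ent_simps by (metis add_0)

lemma supp_mono: "supp R A \<Longrightarrow> (\<And>i j. R i j \<Longrightarrow> S i j) \<Longrightarrow> supp S A"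
  by (auto simp: supp_def)

lemma supp_mult:
  assumes "supp R A" "supp S B" "\<And>i j k. R i j \<Longrightarrow> S j k \<Longrightarrow> T i k"
  shows "supp T (A * B)"
  unfolding supp_def using assms by (metis ent_mult_nonzero suppD)

abbreviation dims :: "nat \<Rightarrow> nat \<Rightarrow> 'a::zero fmat \<Rightarrow> bool" where
  "dims m n \<equiv> supp (\<lambda>i j. i < m \<and> j < n)"

lemma dims_mult: "dims m n A \<Longrightarrow> dims n' k B \<Longrightarrow> dims m k (A * B)"
  by (erule (1) supp_mult) simp

lift_definition restr :: "(nat \<Rightarrow> nat \<Rightarrow> bool) \<Rightarrow> 'a::zero fmat \<Rightarrow> 'a fmat" is
  "\<lambda>R f i j. if R i j then f i j else 0"
  by auto

lemma restr_add: "restr R (A + B) = restr R A + restr R B"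
  by (rule fmat_eqI) (simp add: ent_simps restr.rep_eq)

lemma restr_0 [simp]: "restr R 0 = 0"
  by (rule fmat_eqI) (simp add: ent_simps restr.rep_eq)

lemma supp_restr: "supp S A \<Longrightarrow> supp (\<lambda>i j. R i j \<and> S i j) (restr R A)"
  by (auto simp: supp_def restr.rep_eq)

lemma restr_ident: "supp R A \<Longrightarrow> restr R A = A"
  by (rule fmat_eqI) (auto simp: supp_def restr.rep_eq)

lemma restr_zero: "supp S A \<Longrightarrow> (\<And>i j. S i j \<Longrightarrow> \<not> R i j) \<Longrightarrow> restr R A = 0"
  by (rule fmat_eqI) (auto simp: supp_def restr.rep_eq ent_simps)

text \<open>A homogeneous factor connects \<open>i\<close> and \<open>l\<close> only when their
  gradings match, so a graded piece of the product comes from the correspondingly shifted piece of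
  the other factor.\<close>

lemma restr_mult_left:
  assumes "supp S A" "\<And>i l j. S i l \<Longrightarrow> R' i j \<longleftrightarrow> R l j"
  shows "restr R' (A * B) = A * restr R B"
proof (rule fmat_eqI)
  fix i k
  have "ent A i l \<noteq> 0 \<Longrightarrow> R' i k \<longleftrightarrow> R l k" for l
    using assms by (blast dest: suppD)
  then show "ent (restr R' (A * B)) i k = ent (A * restr R B) i k"
    unfolding restr.rep_eq times_fmat.rep_eq by (auto intro!: sum.cong sum.neutral)
qed

lemma restr_mult_right:
  assumes "supp S B" "\<And>i l j. S l j \<Longrightarrow> R' i j \<longleftrightarrow> R i l"
  shows "restr R' (A * B) = restr R A * B"
proof (rule fmat_eqI)
  fix i k
  obtain n where n: "\<And>i j. ent B i j \<noteq> 0 \<Longrightarrow> i < n \<and> j < n" by (rule ent_bound[of "B"]) blast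
  have *: "ent (X * B) i k = (\<Sum>j<n. ent X i j * ent B j k)" for X
    by (rule ent_mult_bound') (use n in auto)
  have "ent B l k = 0 \<or> (R' i k \<longleftrightarrow> R i l)" for l
    using assms by (blast dest: suppD)
  then have "(if R' i k then ent A i l * ent B l k else 0) = (if R i l then ent A i l else 0) * ent B l k" for l
    by (metis mult_zero_left mult_zero_right)
  then have "(\<Sum>l<n. if R' i k then ent A i l * ent B l k else 0) =
      (\<Sum>l<n. (if R i l then ent A i l else 0) * ent B l k)"
    by (rule sum.cong[OF refl])
  then show "ent (restr R' (A * B)) i k = ent (restr R A * B) i k"
    unfolding restr.rep_eq * by (cases "R' i k") (simp_all only: if_True if_False sum.neutral_const)
qed

lift_definition idm :: "nat \<Rightarrow> 'a::zero_neq_one fmat" is "\<lambda>n i j. if i = j \<and> i < n then 1 else 0"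
  by (auto split: if_splits)

lemma dims_idm: "dims n n (idm n)"
  by (auto simp: supp_def idm.rep_eq split: if_splits)

lemma idm_mult: "dims m n A \<Longrightarrow> idm m * A = A"
proof (rule fmat_eqI)
  fix i j assume A: "dims m n A"
  have "ent (idm m * A) i j = (\<Sum>l<m. (if i = l then ent A l j else 0))"
    by (subst ent_mult_bound[where n = m]) (auto simp: idm.rep_eq if_distrib[of "\<lambda>x. x * _"] cong: if_cong split: if_splits)
  also have "\<dots> = ent A i j" using A by (auto simp: supp_def)
  finally show "ent (idm m * A) i j = ent A i j" .
qed

lemma idm_mult_left: "dims m n A \<Longrightarrow> idm m * (A * B) = A * B"
  by (simp add: idm_mult mult.assoc[symmetric])

lemmas dist = distrib_left distrib_right mult.assoc

lemma mult_idm: "dims m n A \<Longrightarrow> A * idm n = A"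
proof (rule fmat_eqI)
  fix i j assume A: "dims m n A"
  have "ent (A * idm n) i j = (\<Sum>l<n. (if l = j then ent A i l else 0))"
    by (subst ent_mult_bound[where n = n]) (use A in \<open>auto simp: idm.rep_eq supp_def if_distrib[of "\<lambda>x. _ * x"] cong: if_cong split: if_splits\<close>)
  also have "\<dots> = ent A i j" using A by (auto simp: supp_def)
  finally show "ent (A * idm n) i j = ent A i j" .
qed

lift_definition eunit :: "nat \<Rightarrow> nat \<Rightarrow> 'a::zero_neq_one fmat" is "\<lambda>a b i j. if i = a \<and> j = b then 1 else 0"
proof -
  fix a b :: nat
  show "\<exists>n. \<forall>i j. (if i = a \<and> j = b then 1 else 0 :: 'a) \<noteq> 0 \<longrightarrow> i < n \<and> j < n"
    by (rule exI[of _ "Suc (max a b)"]) auto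
qed

lemma supp_eunit: "supp R (eunit a b) \<longleftrightarrow> R a b"
  by (auto simp: supp_def eunit.rep_eq)

lift_definition tr :: "'a::comm_monoid_add fmat \<Rightarrow> 'a" is "\<lambda>f. \<Sum>i | f i i \<noteq> 0. f i i" .

lemma tr_bound: "(\<And>i. ent A i i \<noteq> 0 \<Longrightarrow> i < n) \<Longrightarrow> tr A = (\<Sum>i<n. ent A i i)"
  unfolding tr.rep_eq by (rule sum.mono_neutral_left) auto

lemma tr_0 [simp]: "tr 0 = 0" by (simp add: tr.rep_eq ent_simps)

lemma tr_add: "tr (A + B) = tr A + tr B"
proof -
  obtain n where n: "\<And>i j. ent A i j \<noteq> 0 \<Longrightarrow> i < n \<and> j < n" by (rule ent_bound[of "A"]) blast
  obtain m where m: "\<And>i j. ent B i j \<noteq> 0 \<Longrightarrow> i < m \<and> j < m" by (rule ent_bound[of "B"]) blast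
  obtain k where k: "\<And>i j. ent (A + B) i j \<noteq> 0 \<Longrightarrow> i < k \<and> j < k" by (rule ent_bound[of "(A + B)"]) blast
  define N where "N = max k (max n m)"
  have "tr A = (\<Sum>i<N. ent A i i)" "tr B = (\<Sum>i<N. ent B i i)" "tr (A + B) = (\<Sum>i<N. ent (A + B) i i)"
    by (rule tr_bound; simp add: n m k N_def less_max_iff_disj)+
  then show ?thesis by (simp add: ent_simps sum.distrib)
qed

lemma tr_mult:
  assumes "\<And>i j. ent A i j \<noteq> 0 \<Longrightarrow> i < m \<and> j < n"
  shows "tr (A * B) = (\<Sum>i<m. \<Sum>j<n. ent A i j * ent B j i)"
proof -
  have "tr (A * B) = (\<Sum>i<m. ent (A * B) i i)"
    by (rule tr_bound) (use assms in \<open>auto elim!: ent_mult_nonzero\<close>)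
  also have "\<dots> = (\<Sum>i<m. \<Sum>j<n. ent A i j * ent B j i)"
    by (intro sum.cong refl ent_mult_bound) (use assms in auto)
  finally show ?thesis .
qed

lemma tr_commute: "tr (A * B) = tr (B * A)"
proof -
  obtain n where n: "\<And>i j. ent A i j \<noteq> 0 \<Longrightarrow> i < n \<and> j < n" by (rule ent_bound[of "A"]) blast
  obtain m where m: "\<And>i j. ent B i j \<noteq> 0 \<Longrightarrow> i < m \<and> j < m" by (rule ent_bound[of "B"]) blast
  define N where "N = max n m"
  have "tr (A * B) = (\<Sum>i<N. \<Sum>j<N. ent A i j * ent B j i)"
       "tr (B * A) = (\<Sum>i<N. \<Sum>j<N. ent B i j * ent A j i)"
    by (rule tr_mult; simp add: n m N_def less_max_iff_disj)+
  then show ?thesis by (subst (asm) (2) sum.swap) (simp add: mult.commute)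
qed

lemma tr_eunit_mult: "tr (eunit a b * A) = ent A b a"
proof -
  have "tr (eunit a b * A) = (\<Sum>i<Suc a. \<Sum>j<Suc b. ent (eunit a b) i j * ent A j i)"
    by (rule tr_mult) (auto simp: eunit.rep_eq split: if_splits)
  also have "\<dots> = (\<Sum>i<Suc a. \<Sum>j<Suc b. if i = a then if j = b then ent A j i else 0 else 0)"
    by (intro sum.cong) (auto simp: eunit.rep_eq)
  also have "\<dots> = (\<Sum>i<Suc a. if i = a then ent A b i else 0)"
    by (intro sum.cong refl) (simp del: sum.lessThan_Suc)
  also have "\<dots> = ent A b a" by (simp del: sum.lessThan_Suc)
  finally show ?thesis .
qed

text \<open>The terms for (i,j) and (j,i) with i different from j are equal and cancel over the
  two-element field; on the diagonal every entry equals its own square.\<close>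

lemma tr_square: "tr (A * A) = tr (A :: bit fmat)"
proof -
  obtain n where n: "\<And>i j. ent A i j \<noteq> 0 \<Longrightarrow> i < n \<and> j < n" by (rule ent_bound[of "A"]) blast
  let ?S = "\<lambda>R. \<Sum>p\<in>{p\<in>{..<n}\<times>{..<n}. R (fst p) (snd p)}. ent A (fst p) (snd p) * ent A (snd p) (fst p)"
  have "tr (A * A) = (\<Sum>i<n. \<Sum>j<n. ent A i j * ent A j i)"
    by (rule tr_mult) (use n in auto)
  also have "\<dots> = (\<Sum>p\<in>{..<n}\<times>{..<n}. ent A (fst p) (snd p) * ent A (snd p) (fst p))"
    by (simp only: sum.cartesian_product case_prod_unfold)
  also have "{..<n}\<times>{..<n} = {p\<in>{..<n}\<times>{..<n}. fst p < snd p} \<union>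
      ({p\<in>{..<n}\<times>{..<n}. fst p > snd p} \<union> {p\<in>{..<n}\<times>{..<n}. fst p = snd p})"
    by auto
  also have "(\<Sum>p\<in>\<dots>. ent A (fst p) (snd p) * ent A (snd p) (fst p)) = ?S (<) + (?S (>) + ?S (=))"
    by (subst sum.union_disjoint; (subst sum.union_disjoint)?) auto
  also have "?S (>) = ?S (<)"
    by (rule sum.reindex_bij_witness[of _ prod.swap prod.swap]) (auto simp: mult.commute)
  also have "?S (=) = (\<Sum>i<n. ent A i i)"
    by (rule sum.reindex_bij_witness[of _ "\<lambda>i. (i,i)" fst]) (auto simp: bit_not_one_iff)
  also have "\<dots> = tr A" by (rule tr_bound[symmetric]) (use n in auto)
  also have "?S (<) + (?S (<) + tr A) = tr A"
    by (simp only: add.assoc[symmetric] bit_add_self add_0)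
  finally show ?thesis .
qed

section \<open>Linear algebra over the two-element field\<close>

definition subgrp :: "bit fmat set \<Rightarrow> bool" where
  "subgrp S \<longleftrightarrow> 0 \<in> S \<and> (\<forall>x\<in>S. \<forall>y\<in>S. x + y \<in> S)"

text \<open>A subgroup maximal among those that contain \<open>S\<close> and avoid \<open>x\<close>
  has index two, so the indicator function of its complement is additive.\<close>

lemma separating_functional:
  assumes S: "subgrp S" and x: "x \<notin> S"
  obtains \<phi> :: "bit fmat \<Rightarrow> bit"
  where "\<And>a b. \<phi> (a + b) = \<phi> a + \<phi> b" "\<And>s. s \<in> S \<Longrightarrow> \<phi> s = 0" "\<phi> x = 1"
proof -
  let ?P = "{M. subgrp M \<and> S \<subseteq> M \<and> x \<notin> M}"
  have "\<exists>M\<in>?P. \<forall>X\<in>?P. M \<subseteq> X \<longrightarrow> X = M"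
  proof (rule subset_Zorn_nonempty)
    show "?P \<noteq> {}" using S x by blast
  next
    fix c assume c: "c \<noteq> {}" "subset.chain ?P c"
    have sub: "subgrp M" "S \<subseteq> M" "x \<notin> M" if "M \<in> c" for M
      using c(2) that by (auto simp: subset.chain_def)
    have tot: "M \<subseteq> N \<or> N \<subseteq> M" if "M \<in> c" "N \<in> c" for M N
      using c(2) that by (auto simp: subset.chain_def)
    have "y + z \<in> \<Union>c" if "M \<in> c" "y \<in> M" "N \<in> c" "z \<in> N" for y z M N
      using tot[OF that(1,3)] sub(1)[OF that(1)] sub(1)[OF that(3)] that
      unfolding subgrp_def by (metis UnionI subsetD)
    moreover obtain M where "M \<in> c" using c(1) by blast
    ultimately have "subgrp (\<Union>c)" "x \<notin> \<Union>c"
      using sub by (auto simp: subgrp_def)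
    moreover have "S \<subseteq> \<Union>c" using sub(2)[OF \<open>M \<in> c\<close>] \<open>M \<in> c\<close> by blast
    ultimately
    show "\<Union>c \<in> ?P" by blast
  qed
  then obtain M where "M \<in> ?P" and M_max: "\<forall>X\<in>?P. M \<subseteq> X \<longrightarrow> X = M"
    by (rule bexE)
  then have M: "subgrp M" "S \<subseteq> M" "x \<notin> M" by simp_all
  have max: "X = M" if "subgrp X" "S \<subseteq> X" "x \<notin> X" "M \<subseteq> X" for X
    using M_max that by simp
  have cl: "a + b \<in> M" if "a \<in> M" "b \<in> M" for a b using M(1) that by (simp add: subgrp_def)
  have 0: "0 \<in> M" using M(1) by (simp add: subgrp_def)
  \<comment> \<open>By maximality, adjoining \<open>y\<close> to \<open>M\<close> must bring in
    \<open>x\<close>; hence every element outside \<open>M\<close> lies in the coset of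
    \<open>x\<close>.\<close>
  have co: "x + y \<in> M" if y: "y \<notin> M" for y
  proof (rule ccontr)
    assume no: "x + y \<notin> M"
    let ?X = "M \<union> (\<lambda>m. y + m) ` M"
    have "subgrp ?X"
      unfolding subgrp_def
    proof (intro conjI ballI)
      fix a b assume "a \<in> ?X" "b \<in> ?X"
      then obtain a' b' where ab: "a' \<in> M" "b' \<in> M" "a = a' \<or> a = y + a'" "b = b' \<or> b = y + b'"
        by blast
      have "a + b = a' + b' \<or> a + b = y + (a' + b')"
        using ab(3,4) by (auto simp: add.commute add.left_commute)
      then show "a + b \<in> ?X" using cl[OF ab(1,2)] by auto
    qed (use 0 in auto)
    moreover have "x \<notin> ?X"
    proof
      assume "x \<in> ?X"
      then obtain m where "m \<in> M" "x = y + m" using M(3) by auto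
      then show False using no by (simp add: add.commute add.left_commute)
    qed
    ultimately have "?X = M" using max[of ?X] M(2) by blast
    moreover have "y \<in> ?X" using 0 by (auto intro!: image_eqI[of _ _ 0])
    ultimately show False using y by simp
  qed
  define \<phi> :: "bit fmat \<Rightarrow> bit" where "\<phi> y = (if y \<in> M then 0 else 1)" for y
  have "\<phi> (a + b) = \<phi> a + \<phi> b" for a b
  proof -
    have one: "a + b \<notin> M" if "a \<in> M" "b \<notin> M" for a b
      using cl[of a "a + b"] that by auto
    have "a + b \<in> M" if "a \<notin> M" "b \<notin> M"
      using cl[OF co[OF that(1)] co[OF that(2)]] by (simp add: algebra_simps)
    then show ?thesis using cl[of a b] one[of a b] one[of b a]
      by (cases "a \<in> M"; cases "b \<in> M") (simp_all add: \<phi>_def add.commute)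
  qed
  then show ?thesis by (rule that) (use M in \<open>auto simp: \<phi>_def\<close>)
qed

lemma fmat_expand:
  fixes A :: "bit fmat"
  assumes "dims m n A"
  shows "A = (\<Sum>i<m. \<Sum>j<n. if ent A i j = 0 then 0 else eunit i j)"
proof (rule fmat_eqI)
  fix i j
  have ent_sum: "ent (sum f I) a b = (\<Sum>k\<in>I. ent (f k) a b)" if "finite I" for f :: "nat \<Rightarrow> bit fmat" and I a b
    using that by (induction rule: finite_induct) (auto simp: ent_simps)
  have "ent (\<Sum>i<m. \<Sum>j<n. if ent A i j = 0 then 0 else eunit i j) i j =
     (\<Sum>a<m. \<Sum>b<n. if a = i then if b = j then ent A i j else 0 else 0)"
    by (simp only: ent_sum[OF finite_lessThan], intro sum.cong refl)
      (auto simp: eunit.rep_eq ent_simps bit_not_zero_iff)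
  also have "\<dots> = (\<Sum>a<m. if a = i then (\<Sum>b<n. if b = j then ent A i j else 0) else 0)"
    by (intro sum.cong refl) auto
  also have "\<dots> = ent A i j" using assms by (auto simp: supp_def)
  finally show "ent A i j = ent (\<Sum>i<m. \<Sum>j<n. if ent A i j = 0 then 0 else eunit i j) i j" ..
qed

text \<open>The trace form is nondegenerate: the transpose of \<open>G\<close> lists the values of
  \<open>\<phi>\<close> on matrix units.\<close>

lemma functional_as_trace:
  fixes \<phi> :: "bit fmat \<Rightarrow> bit"
  assumes add: "\<And>a b. \<phi> (a + b) = \<phi> a + \<phi> b"
  obtains G where "dims n m G" "\<And>i j. i < m \<Longrightarrow> j < n \<Longrightarrow> ent G j i = \<phi> (eunit i j)"
    "\<And>A. dims m n A \<Longrightarrow> \<phi> A = tr (G * A)"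
proof -
  define g where "g j i = (if i < m \<and> j < n then \<phi> (eunit i j) else 0)" for i j
  define G where "G = Abs_fmat g"
  have "g \<in> {f. \<exists>n. \<forall>i j. f i j \<noteq> 0 \<longrightarrow> i < n \<and> j < n}"
    by (auto simp: g_def intro!: exI[of _ "max n m"] split: if_splits)
  then have G: "ent G = g" by (simp add: G_def Abs_fmat_inverse)
  have d: "dims n m G" by (auto simp: supp_def G g_def split: if_splits)
  have phi0: "\<phi> 0 = 0" using add[of 0 0] by simp
  have phisum: "\<phi> (sum f I) = (\<Sum>k\<in>I. \<phi> (f k))" if "finite I" for f :: "nat \<Rightarrow> bit fmat" and I
    using that by (induction rule: finite_induct) (auto simp: phi0 add)
  have "\<phi> A = tr (G * A)" if A: "dims m n A" for A
  proof -
    have "\<phi> A = (\<Sum>i<m. \<Sum>j<n. \<phi> (if ent A i j = 0 then 0 else eunit i j))"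
      by (subst fmat_expand[OF A]) (simp only: phisum finite_lessThan)
    also have "\<dots> = (\<Sum>i<m. \<Sum>j<n. ent G j i * ent A i j)"
      by (intro sum.cong refl) (auto simp: phi0 G g_def bit_not_zero_iff bit_not_one_iff)
    also have "\<dots> = (\<Sum>j<n. \<Sum>i<m. ent G j i * ent A i j)" by (rule sum.swap)
    also have "\<dots> = tr (G * A)" by (rule tr_mult[symmetric]) (use d in \<open>auto dest: suppD\<close>)
    finally show ?thesis .
  qed
  with d show ?thesis by (intro that[of G]) (auto simp: G g_def)
qed

text \<open>Over the two-element field a matrix and its square have the same trace.  Hence a
  functional \<open>tr (G * _)\<close> killing every \<open>A * K * A\<close> has \<open>(G * A)\<^sup>2 = 0\<close>, so it kills \<open>A\<close> as well.\<close>

lemma generalized_inverse: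
  fixes A :: "bit fmat"
  obtains K where "A * K * A = A"
proof -
  have "A \<in> range (\<lambda>K. A * K * A)"
  proof (rule ccontr)
    assume no: "A \<notin> range (\<lambda>K. A * K * A)"
    have "subgrp (range (\<lambda>K. A * K * A))"
      unfolding subgrp_def
    proof (intro conjI ballI)
      show "0 \<in> range (\<lambda>K. A * K * A)" by (rule image_eqI[of _ _ 0]) auto
      fix a b assume "a \<in> range (\<lambda>K. A * K * A)" "b \<in> range (\<lambda>K. A * K * A)"
      then obtain K L where "a = A * K * A" "b = A * L * A" by auto
      then show "a + b \<in> range (\<lambda>K. A * K * A)"
        by (intro image_eqI[of _ _ "K + L"]) (auto simp: algebra_simps)
    qed
    then obtain \<phi> :: "bit fmat \<Rightarrow> bit" where
      phi: "\<And>a b. \<phi> (a + b) = \<phi> a + \<phi> b" "\<And>K. \<phi> (A * K * A) = 0" "\<phi> A = 1"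
      using separating_functional[OF _ no] by (metis rangeI)
    obtain n where n: "\<And>i j. ent A i j \<noteq> 0 \<Longrightarrow> i < n \<and> j < n" by (rule ent_bound[of A]) blast
    have dA: "dims n n A" using n by (simp add: supp_def)
    obtain G where G: "\<And>X. dims n n X \<Longrightarrow> \<phi> X = tr (G * X)"
      by (rule functional_as_trace[of \<phi> n n, OF phi(1)]) blast
    have "tr (eunit a b * (A * G * A)) = 0" for a b
    proof -
      have "tr (eunit a b * (A * G * A)) = tr (G * (A * eunit a b * A))"
        using tr_commute[of "eunit a b * A" "G * A"] tr_commute[of "G * A" "eunit a b * A"]
        by (simp add: mult.assoc)
      also have "\<dots> = \<phi> (A * eunit a b * A)"
        by (rule G[symmetric], rule dims_mult[OF dims_mult[OF dA]])
          (use dA in \<open>auto simp: supp_eunit\<close>)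
      finally show ?thesis using phi(2) by simp
    qed
    then have "A * G * A = 0" by (intro fmat_eqI) (simp add: tr_eunit_mult ent_simps)
    then have "tr (G * A * (G * A)) = 0" by (simp add: mult.assoc)
    then show False using phi(3) G[OF dA] by (simp add: tr_square)
  qed
  then obtain K where "A = A * K * A" by (rule imageE)
  then show ?thesis using that[of K] by simp
qed

section \<open>Chain maps modulo null homotopies\<close>

text \<open>Over \<open>C\<^sub>E\<close> the maps \<open>I * h\<close>, \<open>\<gamma>\<close>, \<open>\<beta>\<close>, \<open>\<alpha>\<close>, \<open>\<xi>\<close> below are the components of a local map along
  \<open>d, c, b, a, x\<close> for maps into the tensor product (first five identities), and along
  \<open>a, b, c, d, x\<close> for maps out of it (the first two and the last three).\<close>

lemma twisted_family_identities:
  fixes P I E p i e h :: "bit fmat"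
  assumes L: "P * P = 0" "I * P * I * P = P * I * P * I" "I * I = E + P * I * P * I" "E * P = P" "P * E = P"
      and R: "p * p = 0" "i * p * i * p = p * i * p * i" "i * i = e + p * i * p * i" "e * p = p" "p * e = p"
      and h: "E * h = h" "h * e = h"
      and comm: "P * (I * h + h * i) = (I * h + h * i) * p"
  defines "\<beta> \<equiv> I * P * h + I * h * i * p * i"
  defines "\<gamma> \<equiv> P * (I * h) + (I * h) * p"
  defines "\<alpha> \<equiv> P * \<beta> + \<beta> * p"
  defines "\<xi> \<equiv> I * h + h * i + (P * (I * P * h) + (I * P * h) * p)"
  shows "I * \<alpha> + \<alpha> * i = 0" "I * \<gamma> + \<beta> * i = 0" "I * \<beta> + P * I * \<alpha> + \<gamma> * i = 0"
    "I * (I * h) + I * \<xi> + P * I * \<gamma> + I * h * i = 0" "I * \<alpha> + I * \<xi> + \<xi> * i = 0"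
    "I * (I * h) + I * h * i + \<xi> * i + \<beta> * p * i = 0" "I * \<beta> + \<gamma> * i + \<alpha> * p * i = 0"
    "I * \<xi> + \<xi> * i + \<alpha> * i = 0"
proof -
  \<comment> \<open>The hypothesis \<open>comm\<close> is oriented so as to eliminate
    \<open>P * (I * h)\<close>. Together with the relations on both sides, each also stated with a
    tail \<open>w\<close> so that it applies inside right-nested products, it brings every word to a
    normal form, after which the sums cancel in characteristic two.\<close>
  have r: "P * (I * h) = P * (h * i) + h * (i * p) + I * (h * p)"
  proof -
    have "P * (I * h) = (I * h + h * i) * p + P * (h * i)"
      by (simp only: comm[symmetric] distrib_left add.assoc fmat_add_self add_0_right)
    then show ?thesis by (simp only: distrib_right mult.assoc add_ac)
  qed
  have r': "P * (I * (h * w)) = P * (h * (i * w)) + h * (i * (p * w)) + I * (h * (p * w))" for w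
    using arg_cong[OF r, of "\<lambda>x. x * w"] by (simp add: distrib_right mult.assoc)
  have assoc: "X * (Y * w) = X * Y * w" for X Y w :: "bit fmat" by (simp add: mult.assoc)
  have l2: "P * (P * w) = 0" "I * (P * (I * (P * w))) = P * (I * (P * (I * w)))"
    "I * (I * w) = E * w + P * (I * (P * (I * w)))" "E * (P * w) = P * w" "E * (h * w) = h * w" for w
    using L h by (simp_all add: assoc distrib_right)
  have r2: "p * (p * w) = 0" "i * (p * (i * (p * w))) = p * (i * (p * (i * w)))"
    "i * (i * w) = e * w + p * (i * (p * (i * w)))" "e * (p * w) = p * w" for w
    using R by (simp_all add: assoc distrib_right)
  note rules = r r' l2 r2 L[unfolded mult.assoc] R[unfolded mult.assoc] h
    dist add_ac
  show "I * \<alpha> + \<alpha> * i = 0" by (simp add: \<alpha>_def \<beta>_def rules)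
  show "I * \<gamma> + \<beta> * i = 0" by (simp add: \<gamma>_def \<beta>_def rules)
  show "I * \<beta> + P * I * \<alpha> + \<gamma> * i = 0" by (simp add: \<alpha>_def \<gamma>_def \<beta>_def rules)
  show "I * (I * h) + I * \<xi> + P * I * \<gamma> + I * h * i = 0" by (simp add: \<xi>_def \<gamma>_def rules)
  show "I * \<alpha> + I * \<xi> + \<xi> * i = 0" by (simp add: \<xi>_def \<alpha>_def \<beta>_def rules)
  show "I * (I * h) + I * h * i + \<xi> * i + \<beta> * p * i = 0" by (simp add: \<xi>_def \<beta>_def rules)
  show "I * \<beta> + \<gamma> * i + \<alpha> * p * i = 0" by (simp add: \<gamma>_def \<alpha>_def \<beta>_def rules)
  show "I * \<xi> + \<xi> * i + \<alpha> * i = 0" by (simp add: \<xi>_def \<alpha>_def \<beta>_def rules)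
qed

definition ch :: "bit fmat \<Rightarrow> bit fmat \<Rightarrow> bit fmat \<Rightarrow> bool" where
  "ch t s f \<longleftrightarrow> t * f = f * s"

definition nul :: "bit fmat \<Rightarrow> bit fmat \<Rightarrow> bit fmat \<Rightarrow> bool" where
  "nul t s f \<longleftrightarrow> (\<exists>H. f = t * H + H * s)"

lemma ch_add [intro]: "ch t s f \<Longrightarrow> ch t s g \<Longrightarrow> ch t s (f + g)"
  by (simp add: ch_def algebra_simps)

lemma ch_mult [intro]: "ch t u f \<Longrightarrow> ch u s g \<Longrightarrow> ch t s (f * g)"
  unfolding ch_def by (metis mult.assoc)

lemma nul_add: "nul t s f \<Longrightarrow> nul t s g \<Longrightarrow> nul t s (f + g)"
  unfolding nul_def
proof (elim exE)
  fix H K assume "f = t * H + H * s" "g = t * K + K * s"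
  then show "\<exists>H. f + g = t * H + H * s" by (intro exI[of _ "H + K"]) (simp add: algebra_simps)
qed

lemma nul_mult_left: "ch t u f \<Longrightarrow> nul u s g \<Longrightarrow> nul t s (f * g)"
  unfolding nul_def ch_def
proof (elim exE)
  fix H assume "t * f = f * u" "g = u * H + H * s"
  then show "\<exists>H. f * g = t * H + H * s"
    by (intro exI[of _ "f * H"]) (simp add: distrib_left mult.assoc[symmetric])
qed

lemma nul_mult_right: "nul t u f \<Longrightarrow> ch u s g \<Longrightarrow> nul t s (f * g)"
  unfolding nul_def ch_def
proof (elim exE)
  fix H assume "u * g = g * s" "f = t * H + H * u"
  then show "\<exists>H. f * g = t * H + H * s"
    by (intro exI[of _ "H * g"]) (simp add: distrib_right mult.assoc)
qed

lemma nul_commutator: "nul t s (t * H + H * s)"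
  by (auto simp: nul_def)

lemma nul_0 [simp]: "nul t s 0"
  by (auto simp: nul_def intro: exI[of _ 0])

lemma ch_commutator: "t * t = 0 \<Longrightarrow> s * s = 0 \<Longrightarrow> ch t s (t * H + H * s)"
  unfolding ch_def by (simp add: algebra_simps) (simp add: mult.assoc[symmetric])

text \<open>Cyclic rotation and the chain condition on \<open>f\<close> give both summands the same
  trace. Chain maps and null homotopic maps in opposite directions are thus orthogonal.\<close>

lemma tr_commutator: "ch s t f \<Longrightarrow> tr (f * (t * H + H * s)) = 0"
proof -
  assume "ch s t f"
  then have "tr (f * (H * s)) = tr (f * (t * H))"
    using tr_commute[of "f * H" s] by (simp add: ch_def mult.assoc[symmetric])
  then show ?thesis by (simp only: distrib_left tr_add bit_add_self)
qed

lemma tr_nul: "ch s t f \<Longrightarrow> nul t s g \<Longrightarrow> tr (f * g) = 0"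
  unfolding nul_def using tr_commutator by blast

text \<open>Sandwiching with \<open>\<pi>\<close> turns congruence modulo null homotopies into equality:
  \<open>\<pi>\<close> kills the differential from both sides and is homotopic to the identity.\<close>

definition htpy_proj :: "nat \<Rightarrow> bit fmat \<Rightarrow> bit fmat \<Rightarrow> bool" where
  "htpy_proj n d \<pi> \<longleftrightarrow> d * \<pi> = 0 \<and> \<pi> * d = 0 \<and> nul d d (idm n + \<pi>)"

text \<open>A generalized inverse \<open>K\<close> of \<open>d\<close> serves as the homotopy: in
  \<open>d * (idm n + d * K + K * d)\<close> the middle term vanishes by \<open>d * d = 0\<close>
  and the outer two cancel by \<open>d * K * d = d\<close>; the other side is symmetric.\<close>

lemma htpy_proj_exists:
  assumes "dims n n d" "d * d = 0"
  obtains \<pi> where "htpy_proj n d \<pi>"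
proof -
  obtain K where K: "d * K * d = d" by (rule generalized_inverse)
  have K': "d * (K * d) = d" using K by (simp add: mult.assoc)
  have dd: "d * (d * x) = 0" for x using assms(2) by (simp add: mult.assoc[symmetric])
  have "htpy_proj n d (idm n + (d * K + K * d))"
    unfolding htpy_proj_def nul_def
    by (intro conjI exI[of _ K])
      (simp_all add: algebra_simps K' dd assms(2) mult_idm[OF assms(1)] idm_mult[OF assms(1)])
  then show ?thesis by (rule that)
qed

text \<open>Inserting \<open>\<pi>u\<close> in the middle is harmless: it differs from the identity
  by terms containing \<open>du\<close>, and since \<open>f\<close> and \<open>g\<close> are chain
  maps, that differential can be moved outwards until it meets \<open>\<pi>t\<close> or
  \<open>\<pi>s\<close>, which kill it.\<close>

lemma htpy_proj_mult:
  assumes t: "htpy_proj nt dt \<pi>t" and u: "htpy_proj nu du \<pi>u" and s: "htpy_proj ns ds \<pi>s"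
    and f: "ch dt du f" "f * idm nu = f" and g: "ch du ds g" "idm nu * g = g"
  shows "\<pi>t * (f * g) * \<pi>s = (\<pi>t * f * \<pi>u) * (\<pi>u * g * \<pi>s)"
proof -
  obtain H where H: "idm nu + \<pi>u = du * H + H * du" using u by (auto simp: htpy_proj_def nul_def)
  have pu: "\<pi>u = idm nu + (du * H + H * du)" by (simp add: H[symmetric])
  have k: "du * \<pi>u = 0" "\<pi>t * dt = 0" "ds * \<pi>s = 0" using t u s by (auto simp: htpy_proj_def)
  have k1: "\<pi>t * (f * (du * x)) = 0" for x
    using f(1) k(2) unfolding ch_def by (metis mult.assoc mult_zero_left)
  have k2: "du * (g * \<pi>s) = 0" using g(1) k(3) unfolding ch_def
    by (metis mult.assoc mult_zero_right)
  have "\<pi>t * f * \<pi>u = \<pi>t * f + \<pi>t * (f * (H * du))"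
    by (subst pu) (simp add: distrib_left mult.assoc k1 f(2))
  then have "(\<pi>t * f * \<pi>u) * (\<pi>u * g * \<pi>s) = \<pi>t * f * \<pi>u * (g * \<pi>s)"
  proof -
    have "(\<pi>t * f * \<pi>u) * (\<pi>u * g * \<pi>s) =
        \<pi>t * f * (\<pi>u * (g * \<pi>s)) + \<pi>t * (f * (H * (du * \<pi>u * (g * \<pi>s))))"
      by (subst \<open>\<pi>t * f * \<pi>u = _\<close>) (simp only: distrib_right mult.assoc)
    then show ?thesis by (simp add: k(1) mult.assoc)
  qed
  also have "\<dots> = \<pi>t * f * (g * \<pi>s) + \<pi>t * (f * (H * (du * (g * \<pi>s))))"
    using \<open>\<pi>t * f * \<pi>u = _\<close> by (simp add: distrib_right mult.assoc)
  finally show ?thesis by (simp add: k2 mult.assoc)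
qed

text \<open>A null homotopic map is killed because the outer factors kill the differentials.
  Conversely \<open>f\<close> splits as \<open>(idm nt + \<pi>t) * f\<close>, plus
  \<open>\<pi>t * f * (idm ns + \<pi>s)\<close>, plus the compression; the first two are always null
  homotopic.\<close>

lemma nul_iff_htpy_proj:
  assumes t: "htpy_proj nt dt \<pi>t" and s: "htpy_proj ns ds \<pi>s"
    and f: "ch dt ds f" "idm nt * f = f" "f * idm ns = f"
  shows "nul dt ds f \<longleftrightarrow> \<pi>t * f * \<pi>s = 0"
proof
  assume "nul dt ds f"
  then obtain H where "f = dt * H + H * ds" by (auto simp: nul_def)
  moreover have "\<pi>t * dt = 0" "ds * \<pi>s = 0" using t s by (auto simp: htpy_proj_def)
  ultimately show "\<pi>t * f * \<pi>s = 0"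
    by (simp add: dist) (simp add: mult.assoc[symmetric])
next
  assume 0: "\<pi>t * f * \<pi>s = 0"
  have k: "nul dt dt (idm nt + \<pi>t)" "nul ds ds (idm ns + \<pi>s)" using t s by (auto simp: htpy_proj_def)
  have c: "ch dt dt \<pi>t" using t by (simp add: htpy_proj_def ch_def)
  have "nul dt ds ((idm nt + \<pi>t) * f)" by (rule nul_mult_right[OF k(1) f(1)])
  moreover have "nul dt ds (\<pi>t * (f * (idm ns + \<pi>s)))"
    by (intro nul_mult_left[OF c] nul_mult_left[OF f(1)] k)
  ultimately have "nul dt ds ((idm nt + \<pi>t) * f + \<pi>t * (f * (idm ns + \<pi>s)))" by (rule nul_add)
  also have "(idm nt + \<pi>t) * f + \<pi>t * (f * (idm ns + \<pi>s)) = f"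
    using 0 by (simp add: dist f mult.assoc)
  finally show "nul dt ds f" .
qed

text \<open>\<open>P\<close> stands for \<Phi> modulo U. That its square is null homotopic is not an
  axiom of almost \<iota>_K-complexes but a consequence of the differential squaring to zero, see
  \<open>hat_relations\<close>.\<close>

definition hatcx :: "nat \<Rightarrow> bit fmat \<Rightarrow> bit fmat \<Rightarrow> bit fmat \<Rightarrow> bool" where
  "hatcx n d P I \<longleftrightarrow> dims n n d \<and> dims n n P \<and> dims n n I \<and> d * d = 0 \<and> ch d d P \<and> ch d d I \<and>
     nul d d (P * P) \<and> nul d d (P * I * P * I + I * P * I * P) \<and>
     nul d d (I * I + idm n + P * I * P * I)"

definition cmap :: "nat \<Rightarrow> bit fmat \<Rightarrow> nat \<Rightarrow> bit fmat \<Rightarrow> bit fmat \<Rightarrow> bool" where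
  "cmap nt dt ns ds f \<longleftrightarrow> ch dt ds f \<and> idm nt * f = f \<and> f * idm ns = f"

lemma cmapI: "dims nt ns f \<Longrightarrow> ch dt ds f \<Longrightarrow> cmap nt dt ns ds f"
  by (simp add: cmap_def idm_mult mult_idm)

lemma cmap_add: "cmap nt dt ns ds f \<Longrightarrow> cmap nt dt ns ds g \<Longrightarrow> cmap nt dt ns ds (f + g)"
  by (simp add: cmap_def ch_add dist)

lemma cmap_mult: "cmap nt dt nu du f \<Longrightarrow> cmap nu du ns ds g \<Longrightarrow> cmap nt dt ns ds (f * g)"
  unfolding cmap_def by (metis ch_mult mult.assoc)

lemma cmap_idm: "dims n n d \<Longrightarrow> cmap n d n d (idm n)"
  by (simp add: cmap_def ch_def idm_mult mult_idm idm_mult[OF dims_idm])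

text \<open>The compressed identity \<open>q (idm n)\<close> is no longer an identity matrix. This
  is why \<open>twisted_family_identities\<close> is stated with elements \<open>E\<close> and
  \<open>e\<close> in place of units.\<close>

lemma hatcx_sandwich:
  assumes X: "hatcx n d P I" and \<pi>: "htpy_proj n d \<pi>"
  defines "q \<equiv> \<lambda>f. \<pi> * f * \<pi>"
  shows "q P * q P = 0" "q I * q P * q I * q P = q P * q I * q P * q I"
    "q I * q I = q (idm n) + q P * q I * q P * q I" "q (idm n) * q P = q P" "q P * q (idm n) = q P"
proof -
  define c where "c = cmap n d n d"
  have c [simp]: "c P" "c I" "c (idm n)"
    using X by (auto simp: c_def hatcx_def intro: cmapI cmap_idm)
  have [simp]: "c f \<Longrightarrow> c g \<Longrightarrow> c (f * g)" "c f \<Longrightarrow> c g \<Longrightarrow> c (f + g)" for f g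
    unfolding c_def by (auto intro: cmap_mult cmap_add)
  have q_mult: "c f \<Longrightarrow> c g \<Longrightarrow> q (f * g) = q f * q g" for f g
    unfolding c_def q_def by (auto simp: cmap_def intro!: htpy_proj_mult[OF \<pi> \<pi> \<pi>])
  have q_add: "q (f + g) = q f + q g" for f g by (simp add: q_def dist)
  have n: "nul d d f \<Longrightarrow> c f \<Longrightarrow> q f = 0" for f
    using nul_iff_htpy_proj[OF \<pi> \<pi>] by (auto simp: c_def cmap_def q_def)
  have eqs: "q P * q P = 0" "q P * q I * q P * q I + q I * q P * q I * q P = 0"
    "q I * q I + q (idm n) + q P * q I * q P * q I = 0"
    using X n[of "P * P"] n[of "P * I * P * I + I * P * I * P"] n[of "I * I + idm n + P * I * P * I"]
    by (simp_all add: hatcx_def q_mult q_add)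
  show "q P * q P = 0" by (rule eqs)
  show "q I * q P * q I * q P = q P * q I * q P * q I"
    using eqs(2) unfolding fmat_add_eq_0_iff by (rule sym)
  show "q I * q I = q (idm n) + q P * q I * q P * q I"
    using eqs(3) unfolding add.assoc fmat_add_eq_0_iff .
  have "idm n * P = P" "P * idm n = P" using X idm_mult mult_idm unfolding hatcx_def by blast+
  then show "q (idm n) * q P = q P" "q P * q (idm n) = q P" by (simp_all add: q_mult[symmetric])
qed

text \<open>All maps involved are chain maps, so compression is multiplicative on them and detects
  null homotopy; the strict identities for the compressed data therefore give the claims.\<close>

lemma twisted_family_homotopies:
  assumes X: "hatcx n d P I" and Y: "hatcx m d' p i"
    and h: "dims n m h" "ch d d' h"
    and comm: "nul d d' (P * (I * h + h * i) + (I * h + h * i) * p)"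
  defines "\<beta> \<equiv> I * P * h + I * h * i * p * i"
  defines "\<gamma> \<equiv> P * (I * h) + (I * h) * p"
  defines "\<alpha> \<equiv> P * \<beta> + \<beta> * p"
  defines "\<xi> \<equiv> I * h + h * i + (P * (I * P * h) + (I * P * h) * p)"
  shows "nul d d' (I * \<alpha> + \<alpha> * i)" "nul d d' (I * \<gamma> + \<beta> * i)"
    "nul d d' (I * \<beta> + P * I * \<alpha> + \<gamma> * i)"
    "nul d d' (I * (I * h) + I * \<xi> + P * I * \<gamma> + I * h * i)"
    "nul d d' (I * \<alpha> + I * \<xi> + \<xi> * i)"
    "nul d d' (I * (I * h) + I * h * i + \<xi> * i + \<beta> * p * i)"
    "nul d d' (I * \<beta> + \<gamma> * i + \<alpha> * p * i)"
    "nul d d' (I * \<xi> + \<xi> * i + \<alpha> * i)"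
proof -
  obtain \<pi> where pX: "htpy_proj n d \<pi>" using X htpy_proj_exists unfolding hatcx_def by metis
  obtain \<rho> where pY: "htpy_proj m d' \<rho>" using Y htpy_proj_exists unfolding hatcx_def by metis
  define cX where "cX = cmap n d n d"
  define cY where "cY = cmap m d' m d'"
  define cXY where "cXY = cmap n d m d'"
  define qX where "qX f = \<pi> * f * \<pi>" for f
  define qY where "qY f = \<rho> * f * \<rho>" for f
  define q where "q f = \<pi> * f * \<rho>" for f
  have c [simp]: "cX P" "cX I" "cX (idm n)" "cY p" "cY i" "cY (idm m)" "cXY h"
    using X Y h by (auto simp: cX_def cY_def cXY_def hatcx_def intro: cmapI cmap_idm)
  have c_mult [simp]: "cX f \<Longrightarrow> cX g \<Longrightarrow> cX (f * g)" "cY f \<Longrightarrow> cY g \<Longrightarrow> cY (f * g)"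
    "cX f \<Longrightarrow> cXY g \<Longrightarrow> cXY (f * g)" "cXY f \<Longrightarrow> cY g \<Longrightarrow> cXY (f * g)" for f g
    unfolding cX_def cY_def cXY_def by (auto intro: cmap_mult)
  have c_add [simp]: "cX f \<Longrightarrow> cX g \<Longrightarrow> cX (f + g)" "cY f \<Longrightarrow> cY g \<Longrightarrow> cY (f + g)"
    "cXY f \<Longrightarrow> cXY g \<Longrightarrow> cXY (f + g)" for f g
    unfolding cX_def cY_def cXY_def by (auto intro: cmap_add)
  have q_mult: "cX f \<Longrightarrow> cX g \<Longrightarrow> qX (f * g) = qX f * qX g"
    "cY f \<Longrightarrow> cY g \<Longrightarrow> qY (f * g) = qY f * qY g"
    "cX f \<Longrightarrow> cXY g \<Longrightarrow> q (f * g) = qX f * q g"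
    "cXY f \<Longrightarrow> cY g \<Longrightarrow> q (f * g) = q f * qY g" for f g
    unfolding cX_def cY_def cXY_def qX_def qY_def q_def
    by (auto simp: cmap_def intro!: htpy_proj_mult[OF pX pX pX] htpy_proj_mult[OF pY pY pY]
        htpy_proj_mult[OF pX pX pY] htpy_proj_mult[OF pX pY pY])
  have q_add: "qX (f + g) = qX f + qX g" "qY (f + g) = qY f + qY g" "q (f + g) = q f + q g" for f g
    by (simp_all add: qX_def qY_def q_def dist)
  have nXY: "cXY f \<Longrightarrow> nul d d' f \<longleftrightarrow> q f = 0" for f
    using nul_iff_htpy_proj[OF pX pY] by (auto simp: cXY_def cmap_def q_def)
  note L = hatcx_sandwich[OF X pX, folded qX_def] and R = hatcx_sandwich[OF Y pY, folded qY_def]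
  have hh: "qX (idm n) * q h = q h" "q h * qY (idm m) = q h"
    using h idm_mult[of n m h] mult_idm[of n m h] by (simp_all add: q_mult(3,4)[symmetric])
  have "q (P * (I * h + h * i) + (I * h + h * i) * p) = 0"
    using comm by (subst nXY[symmetric]) simp_all
  then have C: "qX P * (qX I * q h + q h * qY i) = (qX I * q h + q h * qY i) * qY p"
    by (simp add: q_mult q_add fmat_add_eq_0_iff)
  note ids = twisted_family_identities[OF L R hh C]
  note nm = \<alpha>_def \<beta>_def \<gamma>_def \<xi>_def
  show "nul d d' (I * \<alpha> + \<alpha> * i)" "nul d d' (I * \<gamma> + \<beta> * i)"
    "nul d d' (I * \<beta> + P * I * \<alpha> + \<gamma> * i)"
    "nul d d' (I * (I * h) + I * \<xi> + P * I * \<gamma> + I * h * i)"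
    "nul d d' (I * \<alpha> + I * \<xi> + \<xi> * i)"
    "nul d d' (I * (I * h) + I * h * i + \<xi> * i + \<beta> * p * i)"
    "nul d d' (I * \<beta> + \<gamma> * i + \<alpha> * p * i)"
    "nul d d' (I * \<xi> + \<xi> * i + \<alpha> * i)"
    using ids by (simp_all only: nXY nm c c_mult c_add q_mult q_add)
qed

text \<open>Converse of the orthogonality \<open>tr_nul\<close>: a functional that kills all
  commutators \<open>t * H + H * s\<close> is the trace against some \<open>G\<close> with
  \<open>s * G + G * t = 0\<close>, that is, against a chain map in the opposite direction.\<close>

lemma nul_by_trace:
  assumes t: "dims m m t" and s: "dims n n s" and M: "dims m n M"
    and tr0: "\<And>h. dims n m h \<Longrightarrow> ch s t h \<Longrightarrow> tr (M * h) = 0"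
  shows "nul t s M"
proof (rule ccontr)
  assume "\<not> nul t s M"
  then have nin: "M \<notin> Collect (nul t s)" by simp
  have sub: "subgrp (Collect (nul t s))" by (auto simp: subgrp_def nul_add)
  obtain \<phi> :: "bit fmat \<Rightarrow> bit" where phi: "\<And>a b. \<phi> (a + b) = \<phi> a + \<phi> b"
    "\<And>x. x \<in> Collect (nul t s) \<Longrightarrow> \<phi> x = 0" "\<phi> M = 1"
    by (rule separating_functional[OF sub nin]) (rule that)
  obtain G where G: "dims n m G" "\<And>A. dims m n A \<Longrightarrow> \<phi> A = tr (G * A)"
    by (rule functional_as_trace[of \<phi> n m, OF phi(1)]) blast
  have "s * G + G * t = 0"
  proof (rule fmat_eqI)
    fix i j
    show "ent (s * G + G * t) i j = ent 0 i j"
    proof (cases "i < n \<and> j < m")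
      case True
      have e: "dims m n (eunit j i)" using True by (simp add: supp_eunit)
      have "ent (s * G + G * t) i j = tr (eunit j i * (s * G + G * t))" by (simp add: tr_eunit_mult)
      also have "\<dots> = tr (G * (t * eunit j i + eunit j i * s))"
        using tr_commute[of "eunit j i * s" G] tr_commute[of "eunit j i" "G * t"]
        by (simp add: distrib_left tr_add mult.assoc add.commute)
      also have "\<dots> = \<phi> (t * eunit j i + eunit j i * s)"
        by (intro G(2)[symmetric] supp_add dims_mult[OF t e] dims_mult[OF e s])
      also have "\<dots> = 0" by (rule phi(2)) (simp add: nul_commutator)
      finally show ?thesis by (simp add: ent_simps)
    next
      case False
      then show ?thesis
        using supp_add[OF dims_mult[OF s G(1)] dims_mult[OF G(1) t]]
        by (auto simp: supp_def ent_simps)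
    qed
  qed
  then have "ch s t G" by (simp add: ch_def fmat_add_eq_0_iff)
  then have "tr (M * G) = 0" using G(1) tr0 by blast
  then show False using G(2)[OF M] phi(3) by (simp add: tr_commute)
qed

lemma tr_restr:
  assumes "supp (\<lambda>i j. R j i) M"
  shows "tr (M * restr R A) = tr (M * A)"
proof -
  obtain n where n: "\<And>i j. ent M i j \<noteq> 0 \<Longrightarrow> i < n \<and> j < n" by (rule ent_bound[of M]) blast
  have "tr (M * B) = (\<Sum>i<n. \<Sum>j<n. ent M i j * ent B j i)" for B
    by (rule tr_mult) (use n in auto)
  moreover have "ent M i j * ent (restr R A) j i = ent M i j * ent A j i" for i j
    using assms by (cases "ent M i j = 0") (auto simp: restr.rep_eq supp_def)
  ultimately show ?thesis by simp
qed

section \<open>Graded complexes at \<open>U = 1\<close>\<close>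

text \<open>A graded matrix over \<open>\<bbbF>\<^sub>2[U]\<close> is determined by its value at \<open>U = 1\<close>: since \<open>U\<close> has
  bigrading \<open>(-1,-2)\<close>, the class \<open>cls v\<close> records the grading modulo \<open>U\<close>, and the first grading then
  determines the exponent of \<open>U\<close> in each entry.\<close>

definition cls :: "int \<times> int \<Rightarrow> int" where
  "cls v = 2 * fst v - snd v"

definition wp :: "(nat \<Rightarrow> int \<times> int) \<Rightarrow> (nat \<Rightarrow> int \<times> int) \<Rightarrow> int \<Rightarrow> 'a::zero fmat \<Rightarrow> 'a fmat" where
  "wp gt gs k A = restr (\<lambda>i j. fst (gt i) - fst (gs j) = k) A"

abbreviation wge :: "(nat \<Rightarrow> int \<times> int) \<Rightarrow> (nat \<Rightarrow> int \<times> int) \<Rightarrow> int \<Rightarrow> 'a::zero fmat \<Rightarrow> bool" where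
  "wge gt gs k \<equiv> supp (\<lambda>i j. fst (gt i) - fst (gs j) \<ge> k)"

lemma wp_add: "wp gt gs k (A + B) = wp gt gs k A + wp gt gs k B"
  by (simp add: wp_def restr_add)

lemma wp_supp: "supp S A \<Longrightarrow> supp (\<lambda>i j. fst (gt i) - fst (gs j) = k \<and> S i j) (wp gt gs k A)"
  unfolding wp_def by (rule supp_restr)

lemma wp_supp': "supp S A \<Longrightarrow> supp S (wp gt gs k A)"
  by (rule supp_mono[OF wp_supp]) auto

lemma wp_weight: "supp (\<lambda>i j. fst (gt i) - fst (gs j) = k) (wp gt gs k A)"
  by (rule supp_mono[OF wp_supp[of "\<lambda>_ _. True"]]) (auto simp: supp_def)

lemma wp_ident: "supp (\<lambda>i j. fst (gt i) - fst (gs j) = k) A \<Longrightarrow> wp gt gs k A = A"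
  unfolding wp_def by (rule restr_ident)

lemma wp_zero: "wge gt gs k A \<Longrightarrow> l < k \<Longrightarrow> wp gt gs l A = 0"
  unfolding wp_def by (erule restr_zero) auto

lemma wp_wp: "k \<noteq> l \<Longrightarrow> wp gt gs k (wp gt gs l A) = 0"
  unfolding wp_def[of _ _ k] by (rule restr_zero[OF wp_weight]) auto

lemma wp_mult_pure_left:
  "supp (\<lambda>i j. fst (gt i) - fst (gu j) = a) A \<Longrightarrow> wp gt gs (a + k) (A * B) = A * wp gu gs k B"
  unfolding wp_def by (erule restr_mult_left) auto

lemma wp_mult_pure_right:
  "supp (\<lambda>i j. fst (gu i) - fst (gs j) = b) B \<Longrightarrow> wp gt gs (k + b) (A * B) = wp gt gu k A * B"
  unfolding wp_def by (erule restr_mult_right) auto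

lemma weight_split:
  fixes A :: "'a::comm_ring_1 fmat"
  assumes "wge gt gs k A"
  obtains R where "A = wp gt gs k A + R" "wge gt gs (k + 1) R"
proof (rule that[of "restr (\<lambda>i j. fst (gt i) - fst (gs j) \<noteq> k) A"])
  show "A = wp gt gs k A + restr (\<lambda>i j. fst (gt i) - fst (gs j) \<noteq> k) A"
    by (rule fmat_eqI) (simp add: wp_def restr.rep_eq ent_simps)
  show "wge gt gs (k + 1) (restr (\<lambda>i j. fst (gt i) - fst (gs j) \<noteq> k) A)"
    by (rule supp_mono[OF supp_restr[OF assms]]) auto
qed

lemma wge_mult: "wge gt gu a A \<Longrightarrow> wge gu gs b B \<Longrightarrow> wge gt gs (a + b) (A * B)"
  by (erule (1) supp_mult) simp

lemma wp_mult0: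
  fixes A B :: "'a::comm_ring_1 fmat"
  assumes "wge gt gu a A" "wge gu gs b B"
  shows "wp gt gs (a + b) (A * B) = wp gt gu a A * wp gu gs b B"
proof -
  obtain R where R: "A = wp gt gu a A + R" "wge gt gu (a + 1) R" by (rule weight_split[OF assms(1)])
  have "wp gt gs (a + b) (R * B) = 0"
    by (rule wp_zero[OF wge_mult[OF R(2) assms(2)]]) simp
  then show ?thesis
    using wp_mult_pure_left[OF wp_weight, of gt gs a b gu A B]
    by (subst R(1)) (simp add: distrib_right wp_add)
qed

text \<open>One step above the minimal weight of a product, only two pairs of weights can
  contribute.\<close>

lemma wp_mult1:
  fixes A B :: "'a::comm_ring_1 fmat"
  assumes "wge gt gu a A" "wge gu gs b B"
  shows "wp gt gs (a + b + 1) (A * B) = wp gt gu a A * wp gu gs (b + 1) B + wp gt gu (a + 1) A * wp gu gs b B"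
proof -
  obtain R where R: "A = wp gt gu a A + R" "wge gt gu (a + 1) R" by (rule weight_split[OF assms(1)])
  have "wp gt gu (a + 1) A = wp gt gu (a + 1) R"
    using arg_cong[OF R(1), of "wp gt gu (a + 1)"] by (simp add: wp_add wp_wp)
  moreover have "wp gt gs (a + b + 1) (R * B) = wp gt gu (a + 1) R * wp gu gs b B"
    using wp_mult0[OF R(2) assms(2)] by (simp add: algebra_simps)
  moreover have "wp gt gs (a + b + 1) (wp gt gu a A * B) = wp gt gu a A * wp gu gs (b + 1) B"
    using wp_mult_pure_left[OF wp_weight, of gt gs a "b + 1" gu A B] by (simp add: algebra_simps)
  ultimately show ?thesis by (subst R(1)) (simp add: distrib_right wp_add)
qed

text \<open>The differential lowers the first grading by one and \<open>U\<close> lowers it by one, so the coefficient of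
  \<open>U\<^sup>k\<close> in the differential becomes its part of weight \<open>k - 1\<close>.  In particular \<open>dhat\<close> and \<open>Phat\<close>
  are the differential and \<open>\<Phi>\<close> modulo \<open>U\<close>.\<close>

definition gcx :: "nat \<Rightarrow> (nat \<Rightarrow> int \<times> int) \<Rightarrow> bit fmat \<Rightarrow> bool" where
  "gcx n g d \<longleftrightarrow> dims n n d \<and> d * d = 0 \<and>
     supp (\<lambda>i j. cls (g i) = cls (g j) - 2 \<and> fst (g i) \<ge> fst (g j) - 1) d"

abbreviation dhat :: "(nat \<Rightarrow> int \<times> int) \<Rightarrow> bit fmat \<Rightarrow> bit fmat" where "dhat g d \<equiv> wp g g (-1) d"
abbreviation Phat :: "(nat \<Rightarrow> int \<times> int) \<Rightarrow> bit fmat \<Rightarrow> bit fmat" where "Phat g d \<equiv> wp g g 0 d"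

lemma gcx_wge: "gcx n g d \<Longrightarrow> wge g g (-1) d"
  unfolding gcx_def by (elim conjE, erule supp_mono) auto

text \<open>The coefficients of weight -1 and 0 of the commutator are compared. The first vanishes,
  which is the chain condition modulo U; the second is the commutator of \<open>f\<close> modulo U
  with \<Phi>, plus a term in which the weight-one part of \<open>f\<close> acts as a null
  homotopy.\<close>

lemma commutator_low_weights:
  assumes X: "gcx n g d" and Y: "gcx m g' d'" and f: "wge g g' 0 f" and F: "wge g g' 0 (d * f + f * d')"
  shows "ch (dhat g d) (dhat g' d') (wp g g' 0 f)"
    "nul (dhat g d) (dhat g' d') (wp g g' 0 (d * f + f * d') + (Phat g d * wp g g' 0 f + wp g g' 0 f * Phat g' d'))"
proof -
  note w = gcx_wge[OF X] gcx_wge[OF Y]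
  have "wp g g' (-1) (d * f + f * d') = 0" by (rule wp_zero[OF F]) simp
  then have "dhat g d * wp g g' 0 f + wp g g' 0 f * dhat g' d' = 0"
    using wp_mult0[OF w(1) f] wp_mult0[OF f w(2)] by (simp add: wp_add)
  then show "ch (dhat g d) (dhat g' d') (wp g g' 0 f)" by (simp add: ch_def fmat_add_eq_0_iff)
  have "wp g g' 0 (d * f + f * d') =
    (dhat g d * wp g g' 1 f + Phat g d * wp g g' 0 f) + (wp g g' 0 f * Phat g' d' + wp g g' 1 f * dhat g' d')"
    using wp_mult1[OF w(1) f] wp_mult1[OF f w(2)] by (simp add: wp_add)
  then have "wp g g' 0 (d * f + f * d') + (Phat g d * wp g g' 0 f + wp g g' 0 f * Phat g' d')
     = dhat g d * wp g g' 1 f + wp g g' 1 f * dhat g' d'"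
    by (simp add: add_ac)
  then show "nul (dhat g d) (dhat g' d') (wp g g' 0 (d * f + f * d') + (Phat g d * wp g g' 0 f + wp g g' 0 f * Phat g' d'))"
    by (auto simp: nul_def)
qed

text \<open>These are the parts of \<open>d * d = 0\<close> of weight -2, -1 and 0. In weight 0 the
  square of \<Phi> appears next to the commutator of \<open>dhat g d\<close> with the weight-one
  part of \<open>d\<close>, which is the required homotopy.\<close>

lemma hat_relations:
  assumes X: "gcx n g d"
  shows "dhat g d * dhat g d = 0" "ch (dhat g d) (dhat g d) (Phat g d)" "nul (dhat g d) (dhat g d) (Phat g d * Phat g d)"
    "dims n n (dhat g d)" "dims n n (Phat g d)"
proof -
  note w = gcx_wge[OF X]
  have dd: "d * d = 0" and dm: "dims n n d" using X by (auto simp: gcx_def)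
  have z: "wp g g k (0 :: bit fmat) = 0" for k by (simp add: wp_def)
  show "dhat g d * dhat g d = 0" using wp_mult0[OF w w] by (simp add: dd z)
  have "dhat g d * Phat g d + Phat g d * dhat g d = 0" using wp_mult1[OF w w] by (simp add: dd z)
  then show "ch (dhat g d) (dhat g d) (Phat g d)" by (simp add: ch_def fmat_add_eq_0_iff)
  show "dims n n (dhat g d)" "dims n n (Phat g d)" using dm by (auto intro: wp_supp')
  obtain R where R: "d = wp g g (-1) d + R" "wge g g 0 R"
    using weight_split[OF w] by auto
  have R0: "wp g g 0 d = wp g g 0 R"
    using arg_cong[OF R(1), of "wp g g 0"] by (simp add: wp_add wp_wp)
  have "R * d = R * wp g g (-1) d + R * R"
    using arg_cong[OF R(1), of "\<lambda>x. R * x"] by (simp add: distrib_left)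
  moreover have "d * d = wp g g (-1) d * d + R * d"
    using arg_cong[OF R(1), of "\<lambda>x. x * d"] by (simp add: distrib_right)
  ultimately have "wp g g 0 (d * d) = wp g g 0 (wp g g (-1) d * d) + wp g g 0 (R * wp g g (-1) d) + wp g g 0 (R * R)"
    by (simp only: wp_add add.assoc)
  also have "wp g g 0 (wp g g (-1) d * d) = dhat g d * wp g g 1 d"
    using wp_mult_pure_left[OF wp_weight, of g g "-1" 1 g d d] by simp
  also have "wp g g 0 (R * wp g g (-1) d) = wp g g 1 R * dhat g d"
    using wp_mult_pure_right[OF wp_weight, of g g 1 "-1" R g d] by simp
  also have "wp g g 0 (R * R) = Phat g d * Phat g d"
    using wp_mult0[OF R(2) R(2)] by (simp add: R0)
  also have "wp g g 1 R = wp g g 1 d"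
    using arg_cong[OF R(1), of "wp g g 1"] by (simp add: wp_add wp_wp)
  finally have "Phat g d * Phat g d = dhat g d * wp g g 1 d + wp g g 1 d * dhat g d"
    by (simp add: dd z fmat_add_eq_0_iff)
  then show "nul (dhat g d) (dhat g d) (Phat g d * Phat g d)" by (auto simp: nul_def)
qed

section \<open>Towers\<close>

text \<open>The rank-one complex has zero differential, so maps into and out of it that are
  homotopic in one factor become strict: \<open>F\<close> is a cycle, \<open>G\<close> a cocycle,
  and \<open>G * F\<close> is the identity on the nose. Only the other composite needs a
  homotopy.\<close>

definition tower :: "nat \<Rightarrow> bit fmat \<Rightarrow> bit fmat \<Rightarrow> bit fmat \<Rightarrow> bool" where
  "tower n d F G \<longleftrightarrow> dims n 1 F \<and> dims 1 n G \<and> d * F = 0 \<and> G * d = 0 \<and> G * F = idm 1 \<and>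
     nul d d (idm n + F * G)"

definition hequiv :: "nat \<Rightarrow> bit fmat \<Rightarrow> nat \<Rightarrow> bit fmat \<Rightarrow> bit fmat \<Rightarrow> bool" where
  "hequiv m d' n d f \<longleftrightarrow> ch d' d f \<and> (\<exists>k. dims n m k \<and> ch d d' k \<and>
     nul d d (k * f + idm n) \<and> nul d' d' (f * k + idm m))"

lemma dims_1_1: "dims 1 1 A \<Longrightarrow> A = 0 \<or> A = idm (1 :: nat)" for A :: "bit fmat"
proof -
  assume A: "dims 1 1 A"
  have off: "ent A i j = 0" if "i \<noteq> 0 \<or> j \<noteq> 0" for i j
    using A that by (auto simp: supp_def)
  show ?thesis
  proof (cases "ent A 0 0")
    case zero
    then have "A = 0" using off by (intro fmat_eqI) (metis zero_fmat.rep_eq)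
    then show ?thesis ..
  next
    case one
    then have "ent A i j = ent (idm 1) i j" for i j
      using off[of i j] by (cases "i = 0 \<and> j = 0") (auto simp: idm.rep_eq)
    then have "A = idm 1" by (intro fmat_eqI)
    then show ?thesis ..
  qed
qed

lemma tr_idm_1: "tr (idm 1 :: bit fmat) = 1"
  by (subst tr_bound[where n = 1]) (auto simp: idm.rep_eq split: if_splits)

text \<open>Compressing \<open>f\<close> by the two homotopies between the identity and
  \<open>F * G\<close>, respectively \<open>F' * G'\<close>, leaves
  \<open>F' * (G' * f * F) * G\<close>, whose middle factor is the identity by assumption.\<close>

lemma tower_factor:
  assumes X: "tower n d F G" and Y: "tower m d' F' G'"
    and f: "dims m n f" "ch d' d f" and s: "G' * f * F = idm 1"
  shows "nul d' d (f + F' * G)"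
proof -
  have "nul d' d ((idm m + F' * G') * f)"
    by (rule nul_mult_right[OF _ f(2)]) (use Y in \<open>simp add: tower_def\<close>)
  moreover have "nul d' d ((F' * G') * (f * (idm n + F * G)))"
    by (intro nul_mult_left[OF _ nul_mult_left[OF f(2)]])
      (use X Y in \<open>auto simp: tower_def ch_def mult.assoc mult.assoc[symmetric, of d']\<close>)
  ultimately have "nul d' d ((idm m + F' * G') * f + (F' * G') * (f * (idm n + F * G)))" by (rule nul_add)
  also have "(idm m + F' * G') * f + (F' * G') * (f * (idm n + F * G)) = f + F' * (G' * f * F) * G"
    by (simp add: dist idm_mult[OF f(1)] mult_idm[OF f(1)] mult.assoc)
  also have "F' * (G' * f * F) * G = F' * G"
    using Y mult_idm[of m 1 F'] by (simp add: s tower_def)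
  finally show ?thesis .
qed

text \<open>Both complexes have one-dimensional homology, and \<open>G' * f * F\<close> is the
  scalar by which \<open>f\<close> acts on it. Being an equivalence thereby becomes a single affine
  linear equation, as the linear alternative demands. The inverse is \<open>F * G'\<close>.\<close>

lemma hequiv_tower:
  assumes X: "tower n d F G" and Y: "tower m d' F' G'" and f: "dims m n f"
  shows "hequiv m d' n d f \<longleftrightarrow> ch d' d f \<and> G' * f * F = idm 1"
proof (intro iffI conjI)
  assume "hequiv m d' n d f"
  then obtain k where c: "ch d' d f" and k: "dims n m k" "ch d d' k" "nul d d (k * f + idm n)"
    by (auto simp: hequiv_def)
  have "dims 1 1 (G' * f * F)"
    by (rule dims_mult[OF dims_mult[OF _ f]]) (use X Y in \<open>auto simp: tower_def\<close>)
  moreover have "G' * f * F \<noteq> 0"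
  proof
    assume 0: "G' * f * F = 0"
    have GdF: "G * (d * x) = 0" "d * F = 0" for x
      using X by (auto simp: tower_def mult.assoc[symmetric])
    obtain H where H: "k * f + idm n = d * H + H * d" using k(3) by (auto simp: nul_def)
    have "G * (k * f + idm n) * F = 0" unfolding H
      by (simp add: dist GdF)
    then have 1: "G * k * f * F = idm 1"
      using X idm_mult[of n 1 F] by (simp add: tower_def dist fmat_add_eq_0_iff)
    obtain H' where H': "idm m + F' * G' = d' * H' + H' * d'" using Y by (auto simp: tower_def nul_def)
    have "G * k * (idm m + F' * G') * (f * F) = G * (k * d') * H' * f * F + G * k * H' * (d' * f) * F"
      unfolding H' by (simp add: dist)
    also have "k * d' = d * k" using k by (simp add: ch_def)
    also have "d' * f = f * d" using c by (simp add: ch_def)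
    finally have "G * k * (idm m + F' * G') * (f * F) = 0" by (simp add: mult.assoc GdF)
    then have "G * k * f * F + G * k * F' * (G' * f * F) = 0"
      using mult_idm[OF k(1)] by (simp add: dist)
    then have "G * k * f * F = 0" by (simp add: 0)
    with 1 show False using tr_idm_1 by simp
  qed
  ultimately show "G' * f * F = idm 1" using dims_1_1 by blast
  show "ch d' d f" by (rule c)
next
  assume A: "ch d' d f \<and> G' * f * F = idm 1"
  have GF: "dims 1 m G'" "dims n 1 F" "dims 1 n G" "dims m 1 F'" "G * F = idm 1" "G' * F' = idm 1"
    "nul d d (idm n + F * G)" "nul d' d' (idm m + F' * G')" "G' * d' = 0" "d * F = 0"
    using X Y by (auto simp: tower_def)
  have fF: "nul d' d (f + F' * G)" using tower_factor[OF X Y f] A by blast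
  have FG': "ch d d' (F * G')"
    by (simp add: ch_def mult.assoc GF) (simp add: mult.assoc[symmetric] GF)
  have "nul d d (F * G' * (f + F' * G))" by (rule nul_mult_left[OF FG' fF])
  also have "F * G' * (f + F' * G) = F * G' * f + F * (G' * F') * G"
    by (simp add: distrib_left mult.assoc)
  also have "F * (G' * F') * G = F * G" using mult_idm[OF GF(2)] by (simp add: GF)
  finally have "nul d d (F * G' * f + F * G + (idm n + F * G))" using GF(7) by (rule nul_add)
  then have 1: "nul d d (F * G' * f + idm n)" by (simp add: add_ac)
  have "nul d' d' ((f + F' * G) * (F * G'))" by (rule nul_mult_right[OF fF FG'])
  also have "(f + F' * G) * (F * G') = f * (F * G') + F' * (G * F) * G'"
    by (simp add: distrib_right mult.assoc)
  also have "F' * (G * F) * G' = F' * G'" using mult_idm[OF GF(4)] by (simp add: GF)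
  finally have "nul d' d' (f * (F * G') + F' * G' + (idm m + F' * G'))" using GF(8) by (rule nul_add)
  then have 2: "nul d' d' (f * (F * G') + idm m)" by (simp add: add_ac)
  show "hequiv m d' n d f"
    unfolding hequiv_def using A 1 2 FG' dims_mult[OF GF(2,1)] by blast
qed

section \<open>Local maps\<close>

text \<open>The inequality says that the exponent of U is nonnegative, so that an entry is a
  polynomial and not merely a Laurent polynomial.\<close>

definition graded :: "(nat \<Rightarrow> int \<times> int) \<Rightarrow> (nat \<Rightarrow> int \<times> int) \<Rightarrow> bit fmat \<Rightarrow> bool" where
  "graded gt gs \<equiv> supp (\<lambda>i j. cls (gt i) = cls (gs j) \<and> fst (gt i) \<ge> fst (gs j))"

definition local_at :: "nat \<Rightarrow> (nat \<Rightarrow> int \<times> int) \<Rightarrow> bit fmat \<Rightarrow> bit fmat \<Rightarrow>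
    nat \<Rightarrow> (nat \<Rightarrow> int \<times> int) \<Rightarrow> bit fmat \<Rightarrow> bit fmat \<Rightarrow> bit fmat \<Rightarrow> bool" where
  "local_at m g' d' I' n g d I f \<longleftrightarrow> dims m n f \<and> graded g' g f \<and> hequiv m d' n d f \<and>
     nul (dhat g' d') (dhat g d) (I' * wp g' g 0 f + wp g' g 0 f * I)"

text \<open>The supports of \<open>F\<close> and \<open>G\<close> record that the generator of the
  tower has bigrading (0,0); they make the products \<open>F * G'\<close> across two complexes
  homogeneous.\<close>

definition iotacx :: "nat \<Rightarrow> (nat \<Rightarrow> int \<times> int) \<Rightarrow> bit fmat \<Rightarrow> bit fmat \<Rightarrow> bit fmat \<Rightarrow> bit fmat \<Rightarrow> bool" where
  "iotacx n g d I F G \<longleftrightarrow> gcx n g d \<and> tower n d F G \<and> supp (\<lambda>i j. cls (g i) = 0) F \<and>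
     supp (\<lambda>i j. cls (g j) = 0) G \<and> supp (\<lambda>i j. g i = skew (g j)) I \<and> hatcx n (dhat g d) (Phat g d) I"

lemma skew_skew [simp]: "skew (skew v) = v"
  by (simp add: skew_def)

lemma cls_eq_iff: "fst v = fst w \<Longrightarrow> cls v = cls w \<longleftrightarrow> v = w"
  by (auto simp: cls_def prod_eq_iff)

lemma graded_wge: "graded gt gs f \<Longrightarrow> wge gt gs 0 f"
  unfolding graded_def by (erule supp_mono) auto

lemma graded_hat: "graded gt gs f \<Longrightarrow> supp (\<lambda>i j. gt i = gs j) (wp gt gs 0 f)"
  unfolding graded_def by (drule wp_supp, erule supp_mono) (auto simp: cls_eq_iff)

lemma dhat_supp: "gcx n g d \<Longrightarrow> supp (\<lambda>i j. g i = addgr (g j) (-1, 0)) (dhat g d)"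
  unfolding gcx_def
  by (elim conjE, rule supp_mono, erule wp_supp) (auto simp: cls_def addgr_def prod_eq_iff)

text \<open>Dividing a map of bidegree (-1,0) by U, of bidegree (-1,-2), leaves bidegree
  (0,2).\<close>

lemma Phat_supp: "gcx n g d \<Longrightarrow> supp (\<lambda>i j. g i = addgr (g j) (0, 2)) (Phat g d)"
  unfolding gcx_def
  by (elim conjE, rule supp_mono, erule wp_supp) (auto simp: cls_def addgr_def prod_eq_iff)

text \<open>Solvability of the linear system that defines local maps from \<open>X\<close> to \<open>Y\<close>, by the Fredholm
  alternative for the trace pairing between maps \<open>X \<rightarrow> Y\<close> and maps \<open>Y \<rightarrow> X\<close>.\<close>

lemma local_alternative:
  assumes X: "iotacx n g d I F G" and Y: "iotacx m g' d' I' F' G'"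
    and none: "\<nexists>f. local_at m g' d' I' n g d I f"
  obtains f h where "dims n m f" "graded g g' f" "ch d d' f" "G * f * F' = idm 1"
    "wp g g' 0 f = I * h + h * I'" "dims n m h" "ch (dhat g d) (dhat g' d') h"
    "supp (\<lambda>i j. g i = skew (g' j)) h"
proof -
  let ?eq = "\<lambda>i j. cls (g i) = cls (g' j)"
  let ?sk = "\<lambda>i j. g i = skew (g' j)"
  let ?sk' = "\<lambda>j i. g i = skew (g' j)"
  let ?up = "\<lambda>i j. cls (g i) = cls (g' j) + 2"
  let ?low = "\<lambda>j i. cls (g' j) = cls (g i) - 2"
  let ?sh = "\<lambda>i j. g i = addgr (skew (g' j)) (-1, 0)"
  let ?same = "\<lambda>i j. g i = g' j"
  note gX = X[unfolded iotacx_def gcx_def tower_def hatcx_def]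
  note gY = Y[unfolded iotacx_def gcx_def tower_def hatcx_def]
  have cX: "gcx n g d" and cY: "gcx m g' d'" using X Y by (auto simp: iotacx_def)
  have tX: "tower n d F G" and tY: "tower m d' F' G'" using X Y by (auto simp: iotacx_def)
  \<comment> \<open>Positions (i,j) for which a graded map from the first complex to the second may
    have a nonzero entry at (j,i); the pairing transposes.\<close>
  define Q where "Q = (\<lambda>i j. cls (g i) = cls (g' j) \<and> fst (g i) \<le> fst (g' j))"
  define S1 where "S1 = {A :: bit fmat. dims n m A \<and> supp (\<lambda>i j. \<not> Q i j) A}"
  define S2 where "S2 = {N :: bit fmat. dims n m N \<and> supp ?up N}"
  define S3 where "S3 = {h. dims n m h \<and> ch (dhat g d) (dhat g' d') h \<and> supp ?sk h}"
  \<comment> \<open>The annihilator of the homogeneous conditions on a local map: \<open>A\<close>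
    accounts for gradedness, \<open>N\<close> for the chain condition, \<open>h\<close> for the
    involutions. The shift by two in \<open>S2\<close> offsets the drop of \<open>cls\<close> under
    the differential.\<close>
  define S where "S = {A + (d * N + N * d') + (I * h + h * I') |A N h. A \<in> S1 \<and> N \<in> S2 \<and> h \<in> S3}"
  have z: "0 \<in> S1" "0 \<in> S2" "0 \<in> S3" by (auto simp: S1_def S2_def S3_def ch_def)
  have add: "A \<in> S1 \<Longrightarrow> A' \<in> S1 \<Longrightarrow> A + A' \<in> S1" "N \<in> S2 \<Longrightarrow> N' \<in> S2 \<Longrightarrow> N + N' \<in> S2"
    "h \<in> S3 \<Longrightarrow> h' \<in> S3 \<Longrightarrow> h + h' \<in> S3" for A A' N N' h h'
    by (auto simp: S1_def S2_def S3_def intro: supp_add)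
  have sub: "subgrp S"
    unfolding subgrp_def
  proof (intro conjI ballI)
    show "0 \<in> S" unfolding S_def using z by force
    fix a b assume "a \<in> S" "b \<in> S"
    then obtain A N h A' N' h' where "A \<in> S1" "N \<in> S2" "h \<in> S3" "A' \<in> S1" "N' \<in> S2" "h' \<in> S3"
      "a = A + (d * N + N * d') + (I * h + h * I')" "b = A' + (d * N' + N' * d') + (I * h' + h' * I')"
      unfolding S_def by blast
    then show "a + b \<in> S" unfolding S_def mem_Collect_eq
      by (intro exI[of _ "A + A'"] exI[of _ "N + N'"] exI[of _ "h + h'"])
        (simp add: add dist add_ac)
  qed
  \<comment> \<open>Pairing a map \<open>f\<close> with \<open>x\<close> yields the trace of
    \<open>G' * f * F\<close>, the scalar on the tower. Hence a functional vanishing on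
    \<open>S\<close> with value 1 at \<open>x\<close> would be a local map.\<close>
  define x where "x = F * G'"
  have dx: "dims n m x" unfolding x_def by (rule dims_mult) (use gX gY in blast)+
  have x_cls: "supp ?eq x" unfolding x_def
    by (rule supp_mult[of "\<lambda>i j. cls (g i) = 0" _ "\<lambda>i j. cls (g' j) = 0"]) (use gX gY in auto)
  have hsupp: "supp ?same (I * h + h * I')" if "h \<in> S3" for h
  proof (rule supp_add)
    show "supp ?same (I * h)"
      by (rule supp_mult[of "\<lambda>i j. g i = skew (g j)" _ "?sk"])
        (use gX that in \<open>auto simp: S3_def\<close>)
    show "supp ?same (h * I')"
      by (rule supp_mult[of "?sk" _ "\<lambda>i j. g' i = skew (g' j)"])
        (use gY that in \<open>auto simp: S3_def\<close>)
  qed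
  have Nsupp: "supp ?eq (d * N + N * d')" if "N \<in> S2" for N
  proof (rule supp_add)
    show "supp ?eq (d * N)"
      by (rule supp_mult[of "\<lambda>i j. cls (g i) = cls (g j) - 2" _ "?up"])
        (use gX that in \<open>auto simp: S2_def elim: supp_mono\<close>)
    show "supp ?eq (N * d')"
      by (rule supp_mult[of "?up" _ "\<lambda>i j. cls (g' i) = cls (g' j) - 2"])
        (use gY that in \<open>auto simp: S2_def elim: supp_mono\<close>)
  qed
  have "x \<in> S"
  proof (rule ccontr)
    assume "x \<notin> S"
    obtain \<phi> :: "bit fmat \<Rightarrow> bit" where phi: "\<And>a b. \<phi> (a + b) = \<phi> a + \<phi> b"
      "\<And>s. s \<in> S \<Longrightarrow> \<phi> s = 0" "\<phi> x = 1"
      by (rule separating_functional[OF sub \<open>x \<notin> S\<close>]) (rule that)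
    have phi1: "\<phi> A = 0" if "A \<in> S1" for A
      by (rule phi(2)) (use that z in \<open>force simp: S_def\<close>)
    have phi2: "\<phi> (d * N + N * d') = 0" if "N \<in> S2" for N
      by (rule phi(2)) (use that z in \<open>force simp: S_def\<close>)
    have phi3: "\<phi> (I * h + h * I') = 0" if "h \<in> S3" for h
      by (rule phi(2)) (use that z in \<open>force simp: S_def\<close>)
    obtain f where f: "dims m n f" "\<And>i j. i < n \<Longrightarrow> j < m \<Longrightarrow> ent f j i = \<phi> (eunit i j)"
      "\<And>A. dims n m A \<Longrightarrow> \<phi> A = tr (f * A)"
      by (rule functional_as_trace[of \<phi> m n, OF phi(1)]) (rule that)
    have gr: "graded g' g f"
      unfolding graded_def supp_def
    proof (intro allI impI)
      fix j i assume nz: "ent f j i \<noteq> 0"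
      then have ij: "j < m" "i < n" using f(1) by (auto dest: suppD)
      then have "\<phi> (eunit i j) \<noteq> 0" using nz f(2) by simp
      then have "eunit i j \<notin> S1" using phi1 by blast
      then have "Q i j" using ij by (simp add: S1_def supp_eunit)
      then show "cls (g' j) = cls (g i) \<and> fst (g i) \<le> fst (g' j)" by (simp add: Q_def)
    qed
    have "d' * f + f * d = 0"
    proof (rule fmat_eqI)
      fix j i
      have "dims m n (d' * f + f * d)"
        by (intro supp_add dims_mult[OF _ f(1)] dims_mult[OF f(1)]) (use gX gY in blast)+
      moreover have "supp ?low (d' * f + f * d)"
      proof (rule supp_add)
        show "supp ?low (d' * f)"
          by (rule supp_mult[OF _ gr[unfolded graded_def],
              of "\<lambda>i j. cls (g' i) = cls (g' j) - 2 \<and> fst (g' i) \<ge> fst (g' j) - 1"])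
            (use gY in auto)
        show "supp ?low (f * d)"
          by (rule supp_mult[OF gr[unfolded graded_def],
              of "\<lambda>i j. cls (g i) = cls (g j) - 2 \<and> fst (g i) \<ge> fst (g j) - 1"])
            (use gX in auto)
      qed
      moreover have "ent (d' * f + f * d) j i = 0"
        if ij: "j < m" "i < n" "cls (g' j) = cls (g i) - 2"
      proof -
        have e: "dims n m (eunit i j)" "eunit i j \<in> S2" using ij by (simp_all add: supp_eunit S2_def)
        have "ent (d' * f + f * d) j i = tr (eunit i j * (d' * f + f * d))" by (simp add: tr_eunit_mult)
        also have "\<dots> = tr (f * (d * eunit i j + eunit i j * d'))"
          using tr_commute[of "eunit i j * d'" f] tr_commute[of "eunit i j" "f * d"]
          by (simp add: distrib_left tr_add mult.assoc add.commute)
        also have "\<dots> = \<phi> (d * eunit i j + eunit i j * d')"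
          by (intro f(3)[symmetric] supp_add dims_mult[OF _ e(1)] dims_mult[OF e(1)]) (use gX gY in blast)+
        finally show ?thesis using phi2[OF e(2)] by simp
      qed
      ultimately show "ent (d' * f + f * d) j i = ent 0 j i"
        unfolding supp_def ent_simps(1) by blast
    qed
    then have fch: "ch d' d f" by (simp add: ch_def fmat_add_eq_0_iff)
    have "G' * f * F = idm 1"
    proof -
      have "dims 1 1 (G' * f * F)" by (rule dims_mult[OF dims_mult[OF _ f(1)]]) (use gX gY in blast)+
      moreover have "tr (G' * f * F) = 1"
        using phi(3) f(3)[OF dx] tr_commute[of "f * F" G'] by (simp add: x_def mult.assoc)
      ultimately show ?thesis using dims_1_1[of "G' * f * F"] by auto
    qed
    then have he: "hequiv m d' n d f" using hequiv_tower[OF tX tY f(1)] fch by simp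
    let ?f = "wp g' g 0 f" and ?M = "I' * wp g' g 0 f + wp g' g 0 f * I"
    have wpf: "?f = restr (\<lambda>i j. g' i = g j) f"
      by (rule fmat_eqI)
        (use gr in \<open>auto simp: wp_def restr.rep_eq graded_def supp_def\<close>, metis cls_eq_iff)
    have fdim: "dims m n ?f" by (rule wp_supp'[OF f(1)])
    have Mdim: "dims m n ?M"
      by (intro supp_add dims_mult[OF _ fdim] dims_mult[OF fdim]) (use gX gY in blast)+
    have Msupp: "supp ?sk' ?M"
    proof (rule supp_add)
      show "supp ?sk' (I' * ?f)"
        by (rule supp_mult[OF _ graded_hat[OF gr], of "\<lambda>i j. g' i = skew (g' j)"]) (use gY in auto)
      show "supp ?sk' (?f * I)"
        by (rule supp_mult[OF graded_hat[OF gr], of "\<lambda>i j. g i = skew (g j)"]) (use gX in auto)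
    qed
    have "nul (dhat g' d') (dhat g d) ?M"
    proof (rule nul_by_trace[of m _ n])
      show "dims m m (dhat g' d')" "dims n n (dhat g d)" "dims m n ?M"
        using hat_relations[OF cX] hat_relations[OF cY] Mdim by auto
      fix e assume e: "dims n m e" "ch (dhat g d) (dhat g' d') e"
      \<comment> \<open>Only the skew-graded part of \<open>e\<close> can pair nontrivially with
        \<open>?M\<close>, and as both differentials are homogeneous this part is again a chain
        map.\<close>
      define h where "h = restr ?sk e"
      have h_supp: "supp (\<lambda>i j. g i = skew (g' j) \<and> i < n \<and> j < m) h"
        unfolding h_def by (rule supp_restr[OF e(1)])
      have "dhat g d * h = restr ?sh (dhat g d * e)"
        unfolding h_def by (rule restr_mult_left[OF dhat_supp[OF cX], symmetric])
          (auto simp: addgr_def prod_eq_iff)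
      also have "\<dots> = restr ?sh (e * dhat g' d')"
        using e(2) by (simp add: ch_def)
      also have "\<dots> = h * dhat g' d'"
        unfolding h_def by (rule restr_mult_right[OF dhat_supp[OF cY]])
          (auto simp: addgr_def prod_eq_iff skew_def)
      finally have "h \<in> S3" using h_supp by (auto simp: S3_def ch_def elim: supp_mono)
      have "tr (?M * e) = tr (?M * h)" unfolding h_def by (rule tr_restr[OF Msupp, symmetric])
      also have "\<dots> = tr (?f * (I * h + h * I'))"
        using tr_commute[of I' "?f * h"] by (simp add: dist tr_add mult.assoc add.commute)
      also have "\<dots> = tr ((I * h + h * I') * ?f)" by (rule tr_commute)
      also have "tr ((I * h + h * I') * ?f) = tr ((I * h + h * I') * f)"
        unfolding wpf
        by (rule tr_restr, rule supp_mono[OF hsupp[OF \<open>h \<in> S3\<close>]]) simp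
      also have "\<dots> = \<phi> (I * h + h * I')"
      proof (subst tr_commute, rule f(3)[symmetric], intro supp_add)
        have "dims n m h" using \<open>h \<in> S3\<close> by (simp add: S3_def)
        then show "dims n m (I * h)" "dims n m (h * I')" using gX gY by (auto intro: dims_mult)
      qed
      also have "\<dots> = 0" by (rule phi3[OF \<open>h \<in> S3\<close>])
      finally show "tr (?M * e) = 0" .
    qed
    then have "local_at m g' d' I' n g d I f"
      using f(1) gr he by (simp add: local_at_def)
    then show False using none by blast
  qed
  then obtain A N h where ANh: "A \<in> S1" "N \<in> S2" "h \<in> S3" "x = A + (d * N + N * d') + (I * h + h * I')"
    unfolding S_def by blast
  \<comment> \<open>Read in one way, \<open>f\<close> differs from \<open>x\<close> by a commutator,
    so it is a chain map with the same scalar on the tower. Read in the other way, as in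
    \<open>fA\<close>, it differs from \<open>I * h + h * I'\<close> by \<open>A\<close>, which has
    positive weight and so vanishes modulo U.\<close>
  define f where "f = x + (d * N + N * d')"
  have fA: "f = A + (I * h + h * I')" unfolding f_def ANh(4) by (simp add: add_ac)
  have f_cls: "supp ?eq f"
    unfolding f_def by (intro supp_add x_cls Nsupp ANh)
  have A_supp: "supp (\<lambda>i j. cls (g i) = cls (g' j) \<and> fst (g i) > fst (g' j)) A"
  proof -
    have "A = f + (I * h + h * I')" by (simp add: fA add_ac)
    moreover have "supp ?eq (f + (I * h + h * I'))"
      by (rule supp_add[OF f_cls supp_mono[OF hsupp[OF ANh(3)]]]) simp
    ultimately have "supp ?eq A" by simp
    then show ?thesis using ANh(1) by (auto simp: S1_def Q_def supp_def not_le)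
  qed
  have df: "dims n m f"
    unfolding f_def using ANh(2) dx gX gY by (auto simp: S2_def intro!: supp_add dims_mult)
  have gr: "graded g g' f"
    unfolding graded_def fA
    by (intro supp_add supp_mono[OF A_supp] supp_mono[OF hsupp[OF ANh(3)]]) auto
  have "wp g g' 0 A = 0" unfolding wp_def by (rule restr_zero[OF A_supp]) auto
  moreover have "wp g g' 0 (I * h + h * I') = I * h + h * I'"
    by (rule wp_ident, rule supp_mono[OF hsupp[OF ANh(3)]]) simp
  ultimately have hat: "wp g g' 0 f = I * h + h * I'" by (simp add: fA wp_add)
  have "ch d d' x" using gX gY by (simp add: x_def ch_def mult.assoc) (simp add: mult.assoc[symmetric])
  then have fch: "ch d d' f" unfolding f_def using gX gY by (intro ch_add ch_commutator) auto
  have "G * f * F' = G * F * (G' * F') + (G * d) * N * F' + G * N * (d' * F')"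
    by (simp add: f_def x_def dist add.assoc)
  also have "\<dots> = idm 1 * idm 1" using gX gY by simp
  also have "\<dots> = (idm 1 :: bit fmat)" by (rule idm_mult[OF dims_idm])
  finally have "G * f * F' = idm 1" .
  then show ?thesis
    using that df gr fch hat ANh(3) by (auto simp: S3_def)
qed

section \<open>The tensor product with the figure-eight complex\<close>

text \<open>Inclusion and projection of the summand spanned by the \<open>e\<close>-th generator of \<open>C\<^sub>E\<close>, in the ordering
  of the basis used by \<open>kron\<close>.\<close>

lift_definition inj5 :: "nat \<Rightarrow> nat \<Rightarrow> bit fmat" is "\<lambda>n e i j. if j < n \<and> i = j * 5 + e then 1 else 0"
proof -
  fix n e :: nat
  show "\<exists>N. \<forall>i j. (if j < n \<and> i = j * 5 + e then 1 else 0 :: bit) \<noteq> 0 \<longrightarrow> i < N \<and> j < N"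
    by (rule exI[of _ "n * 5 + e + 1"]) auto
qed

lift_definition prj5 :: "nat \<Rightarrow> nat \<Rightarrow> bit fmat" is "\<lambda>n e j i. if j < n \<and> i = j * 5 + e then 1 else 0"
proof -
  fix n e :: nat
  show "\<exists>N. \<forall>j i. (if j < n \<and> i = j * 5 + e then 1 else 0 :: bit) \<noteq> 0 \<longrightarrow> j < N \<and> i < N"
    by (rule exI[of _ "n * 5 + e + 1"]) auto
qed

lemma supp_inj5: "supp (\<lambda>i j. j < n \<and> i = j * 5 + e) (inj5 n e)"
  by (auto simp: supp_def inj5.rep_eq split: if_splits)

lemma supp_prj5: "supp (\<lambda>j i. j < n \<and> i = j * 5 + e) (prj5 n e)"
  by (auto simp: supp_def prj5.rep_eq split: if_splits)

lemma ent_prj5_mult: "ent (prj5 n e * A) j k = (if j < n then ent A (j * 5 + e) k else 0)"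
proof -
  have "ent (prj5 n e * A) j k = (\<Sum>i<n * 5 + e + 1. ent (prj5 n e) j i * ent A i k)"
    by (rule ent_mult_bound) (auto simp: prj5.rep_eq split: if_splits)
  also have "\<dots> = (\<Sum>i<n * 5 + e + 1. if i = j * 5 + e then (if j < n then ent A (j * 5 + e) k else 0) else 0)"
    by (rule sum.cong[OF refl]) (auto simp: prj5.rep_eq)
  also have "\<dots> = (if j < n then ent A (j * 5 + e) k else 0)"
    by (subst sum.delta) auto
  finally show ?thesis .
qed

lemma ent_mult_inj5: "ent (A * inj5 n e) k j = (if j < n then ent A k (j * 5 + e) else 0)"
proof -
  have "ent (A * inj5 n e) k j = (\<Sum>i<n * 5 + e + 1. ent A k i * ent (inj5 n e) i j)"
    by (rule ent_mult_bound') (auto simp: inj5.rep_eq split: if_splits)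
  also have "\<dots> = (\<Sum>i<n * 5 + e + 1. if i = j * 5 + e then (if j < n then ent A k (j * 5 + e) else 0) else 0)"
    by (rule sum.cong[OF refl]) (auto simp: inj5.rep_eq)
  also have "\<dots> = (if j < n then ent A k (j * 5 + e) else 0)"
    by (subst sum.delta) auto
  finally show ?thesis .
qed

lemma prj5_inj5:
  assumes "e < 5" "e' < 5"
  shows "prj5 n e * inj5 n e' = (if e = e' then idm n else 0)"
proof (rule fmat_eqI)
  fix i j
  have "i * 5 + e = j * 5 + e' \<longleftrightarrow> i = j \<and> e = e'" using assms by presburger
  then show "ent (prj5 n e * inj5 n e') i j = ent (if e = e' then idm n else 0) i j"
    by (auto simp: ent_prj5_mult inj5.rep_eq idm.rep_eq ent_simps)
qed

lemma dims_prj5_mult: "dims m k A \<Longrightarrow> dims n k (prj5 n e * A)"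
  by (auto simp: supp_def ent_prj5_mult split: if_splits)

lemma dims_mult_inj5: "dims k m A \<Longrightarrow> dims k n (A * inj5 n e)"
  by (auto simp: supp_def ent_mult_inj5 split: if_splits)

lemma dims_inj5: "e < 5 \<Longrightarrow> dims (n * 5) n (inj5 n e)"
  by (rule supp_mono[OF supp_inj5]) auto

lemma dims_prj5: "e < 5 \<Longrightarrow> dims n (n * 5) (prj5 n e)"
  by (rule supp_mono[OF supp_prj5]) auto

lemma sum5_inj5_prj5:
  "inj5 n 0 * prj5 n 0 + inj5 n 1 * prj5 n 1 + inj5 n 2 * prj5 n 2 + inj5 n 3 * prj5 n 3
    + inj5 n 4 * prj5 n 4 = idm (n * 5)"
proof (rule fmat_eqI)
  have jp: "ent (inj5 n e * prj5 n e) i k = (if i = k \<and> i mod 5 = e \<and> i < n * 5 then 1 else 0)"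
    if "e < 5" for e i k
  proof (cases "ent (inj5 n e * prj5 n e) i k = 0")
    case True
    have "\<not> (i = k \<and> i mod 5 = e \<and> i < n * 5)"
    proof
      assume a: "i = k \<and> i mod 5 = e \<and> i < n * 5"
      then have i: "i = (i div 5) * 5 + e" "i div 5 < n" by auto
      have "ent (prj5 n e * (inj5 n e * prj5 n e)) (i div 5) k = ent (inj5 n e * prj5 n e) i k"
        using i by (simp add: ent_prj5_mult)
      moreover have "prj5 n e * (inj5 n e * prj5 n e) = prj5 n e"
        using that by (simp add: mult.assoc[symmetric] prj5_inj5 idm_mult[OF dims_prj5])
      moreover have "ent (prj5 n e) (i div 5) k = 1" using a i by (simp add: prj5.rep_eq)
      ultimately show False using True by simp
    qed
    then show ?thesis using True by simp
  next
    case False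
    then obtain j where "ent (inj5 n e) i j \<noteq> 0" "ent (prj5 n e) j k \<noteq> 0" by (rule ent_mult_nonzero)
    then have "i = j * 5 + e" "k = j * 5 + e" "j < n" by (auto simp: inj5.rep_eq prj5.rep_eq split: if_splits)
    then show ?thesis using that False by (auto simp: bit_not_zero_iff)
  qed
  fix i k :: nat
  have "i mod 5 = 0 \<or> i mod 5 = 1 \<or> i mod 5 = 2 \<or> i mod 5 = 3 \<or> i mod 5 = 4" by linarith
  then show "ent (inj5 n 0 * prj5 n 0 + inj5 n 1 * prj5 n 1 + inj5 n 2 * prj5 n 2 + inj5 n 3 * prj5 n 3
    + inj5 n 4 * prj5 n 4) i k = ent (idm (n * 5)) i k"
    by (elim disjE) (simp_all add: ent_simps jp idm.rep_eq)
qed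

definition T_gr :: "(nat \<Rightarrow> int \<times> int) \<Rightarrow> nat \<Rightarrow> int \<times> int" where
  "T_gr g = (\<lambda>k. addgr (g (k div 5)) (gr CE_cx (k mod 5)))"

definition T_d :: "nat \<Rightarrow> bit fmat \<Rightarrow> bit fmat" where
  "T_d n d = inj5 n 0 * d * prj5 n 0 + inj5 n 1 * d * prj5 n 1 + inj5 n 2 * d * prj5 n 2
     + inj5 n 3 * d * prj5 n 3 + inj5 n 4 * d * prj5 n 4
     + inj5 n 1 * prj5 n 0 + inj5 n 3 * prj5 n 2"

text \<open>The first seven terms follow the involution of C_E. The two terms with
  \<open>P * I\<close> come from the summand of the tensor involution that contains \<iota>\<Phi> of
  C_E, which sends a to c and c to d.\<close>

definition T_I :: "nat \<Rightarrow> bit fmat \<Rightarrow> bit fmat \<Rightarrow> bit fmat" where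
  "T_I n P I = inj5 n 0 * I * prj5 n 0 + inj5 n 4 * I * prj5 n 0 + inj5 n 2 * I * prj5 n 1
     + inj5 n 1 * I * prj5 n 2 + inj5 n 3 * I * prj5 n 3 + inj5 n 4 * I * prj5 n 4 + inj5 n 3 * I * prj5 n 4
     + inj5 n 2 * (P * I) * prj5 n 0 + inj5 n 3 * (P * I) * prj5 n 2"

lemma T_gr_eq: "e < 5 \<Longrightarrow> T_gr g (i * 5 + e) = addgr (g i) (gr CE_cx e)"
  by (simp add: T_gr_def)

lemma fst_gr_CE [simp]: "fst (gr CE_cx e) = 0"
  by (simp add: CE_cx_def)

lemma fst_T_gr: "e < 5 \<Longrightarrow> fst (T_gr g (i * 5 + e)) = fst (g i)"
  by (simp add: T_gr_eq addgr_def)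

lemma wp_inj5_mult: "e < 5 \<Longrightarrow> wp (T_gr g) gs k (inj5 n e * A) = inj5 n e * wp g gs k A"
  using wp_mult_pure_left[of "T_gr g" g 0 "inj5 n e" gs k A]
  by (simp add: supp_mono[OF supp_inj5] fst_T_gr)

lemma wp_prj5_mult: "e < 5 \<Longrightarrow> wp g gs k (prj5 n e * A) = prj5 n e * wp (T_gr g) gs k A"
  using wp_mult_pure_left[of g "T_gr g" 0 "prj5 n e" gs k A]
  by (simp add: supp_mono[OF supp_prj5] fst_T_gr)

lemma wp_mult_inj5: "e < 5 \<Longrightarrow> wp gt g k (A * inj5 n e) = wp gt (T_gr g) k A * inj5 n e"
  using wp_mult_pure_right[of "T_gr g" g 0 "inj5 n e" gt k A]
  by (simp add: supp_mono[OF supp_inj5] fst_T_gr)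

lemma wp_mult_prj5: "e < 5 \<Longrightarrow> wp gt (T_gr g) k (A * prj5 n e) = wp gt g k A * prj5 n e"
  using wp_mult_pure_right[of g "T_gr g" 0 "prj5 n e" gt k A]
  by (simp add: supp_mono[OF supp_prj5] fst_T_gr)

lemma wp_inj5: "e < 5 \<Longrightarrow> k \<noteq> 0 \<Longrightarrow> wp (T_gr g) g k (inj5 n e) = 0"
  unfolding wp_def by (rule restr_zero[OF supp_inj5]) (auto simp: fst_T_gr)

text \<open>All generators of C_E have first grading 0, so the terms from \<partial>a = Ub and
  \<partial>c = Ud have weight 0 and vanish modulo U.\<close>

lemma dhat_T: "dhat (T_gr g) (T_d n d) = inj5 n 0 * dhat g d * prj5 n 0 + inj5 n 1 * dhat g d * prj5 n 1
    + inj5 n 2 * dhat g d * prj5 n 2 + inj5 n 3 * dhat g d * prj5 n 3 + inj5 n 4 * dhat g d * prj5 n 4"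
  by (simp add: T_d_def wp_add wp_mult_prj5 wp_inj5_mult wp_inj5)

lemma inj5_prj5_simps:
  "e < 5 \<Longrightarrow> e' < 5 \<Longrightarrow> prj5 n e * (inj5 n e' * x) = (if e = e' then idm n * x else 0)"
  "e < 5 \<Longrightarrow> idm n * prj5 n e = prj5 n e" "e < 5 \<Longrightarrow> idm n * (prj5 n e * x) = prj5 n e * x"
  "e < 5 \<Longrightarrow> inj5 n e * idm n = inj5 n e" "e < 5 \<Longrightarrow> inj5 n e * (idm n * x) = inj5 n e * x"
  by (simp_all add: mult.assoc[symmetric] prj5_inj5 idm_mult[OF dims_prj5] mult_idm[OF dims_inj5])

lemma prj5_T_d:
  assumes "dims n n d"
  shows "prj5 n 0 * T_d n d = d * prj5 n 0" "prj5 n 1 * T_d n d = d * prj5 n 1 + prj5 n 0"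
    "prj5 n 2 * T_d n d = d * prj5 n 2" "prj5 n 3 * T_d n d = d * prj5 n 3 + prj5 n 2"
    "prj5 n 4 * T_d n d = d * prj5 n 4"
  by (simp_all add: T_d_def distrib_left mult.assoc inj5_prj5_simps idm_mult_left[OF assms])

lemma T_d_inj5:
  assumes "dims n n d"
  shows "T_d n d * inj5 n 0 = inj5 n 0 * d + inj5 n 1" "T_d n d * inj5 n 1 = inj5 n 1 * d"
    "T_d n d * inj5 n 2 = inj5 n 2 * d + inj5 n 3" "T_d n d * inj5 n 3 = inj5 n 3 * d"
    "T_d n d * inj5 n 4 = inj5 n 4 * d"
  by (simp_all add: T_d_def distrib_right mult.assoc inj5_prj5_simps prj5_inj5 mult_idm[OF assms])

lemma prj5_dhat_T:
  assumes "dims n n d" "e < 5"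
  shows "prj5 n e * dhat (T_gr g) (T_d n d) = dhat g d * prj5 n e"
proof -
  have "e = 0 \<or> e = 1 \<or> e = 2 \<or> e = 3 \<or> e = 4" using assms(2) by linarith
  then show ?thesis
    by (elim disjE) (simp_all add: dhat_T distrib_left mult.assoc inj5_prj5_simps
        idm_mult_left[OF wp_supp'[OF assms(1)]])
qed

lemma dhat_T_inj5:
  assumes "dims n n d" "e < 5"
  shows "dhat (T_gr g) (T_d n d) * inj5 n e = inj5 n e * dhat g d"
proof -
  have "e = 0 \<or> e = 1 \<or> e = 2 \<or> e = 3 \<or> e = 4" using assms(2) by linarith
  then show ?thesis
    by (elim disjE) (simp_all add: dhat_T distrib_right mult.assoc inj5_prj5_simps prj5_inj5
        mult_idm[OF wp_supp'[OF assms(1)]])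
qed

lemma prj5_T_I:
  assumes "dims n n I" "dims n n P"
  shows "prj5 n 0 * T_I n P I = I * prj5 n 0" "prj5 n 1 * T_I n P I = I * prj5 n 2"
    "prj5 n 2 * T_I n P I = I * prj5 n 1 + P * I * prj5 n 0"
    "prj5 n 3 * T_I n P I = I * prj5 n 3 + I * prj5 n 4 + P * I * prj5 n 2"
    "prj5 n 4 * T_I n P I = I * prj5 n 0 + I * prj5 n 4"
  by (simp_all add: T_I_def distrib_left mult.assoc inj5_prj5_simps
      idm_mult_left[OF assms(1)] idm_mult_left[OF assms(2)])

lemma T_I_inj5:
  assumes "dims n n I"
  shows "T_I n P I * inj5 n 0 = inj5 n 0 * I + inj5 n 4 * I + inj5 n 2 * P * I"
    "T_I n P I * inj5 n 1 = inj5 n 2 * I" "T_I n P I * inj5 n 2 = inj5 n 1 * I + inj5 n 3 * P * I"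
    "T_I n P I * inj5 n 3 = inj5 n 3 * I" "T_I n P I * inj5 n 4 = inj5 n 4 * I + inj5 n 3 * I"
  by (simp_all add: T_I_def distrib_right mult.assoc inj5_prj5_simps prj5_inj5 mult_idm[OF assms])

lemma tower_T:
  assumes d: "dims n n d" and X: "tower n d F G"
  shows "tower (n * 5) (T_d n d) (inj5 n 4 * F) (G * prj5 n 4)"
proof -
  note gX = X[unfolded tower_def]
  obtain K where K: "idm n + F * G = d * K + K * d" using gX by (auto simp: nul_def)
  have FG: "idm n * F = F" using gX idm_mult by blast
  \<comment> \<open>At U = 1 the pairs a, b and c, d are acyclic, contracted by sending b to a and d
    to c; on the summand of x the given homotopy \<open>K\<close> is used.\<close>
  define H where "H = inj5 n 4 * K * prj5 n 4 + inj5 n 0 * prj5 n 1 + inj5 n 2 * prj5 n 3"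
  have TJ: "T_d n d * (inj5 n 4 * x) = inj5 n 4 * (d * x)"
    "T_d n d * (inj5 n 0 * x) = inj5 n 0 * (d * x) + inj5 n 1 * x"
    "T_d n d * (inj5 n 2 * x) = inj5 n 2 * (d * x) + inj5 n 3 * x" for x
    using T_d_inj5[OF d] by (simp_all add: mult.assoc[symmetric] distrib_right)
  have "T_d n d * H + H * T_d n d = inj5 n 0 * prj5 n 0 + inj5 n 1 * prj5 n 1 + inj5 n 2 * prj5 n 2
      + inj5 n 3 * prj5 n 3 + inj5 n 4 * (d * K + K * d) * prj5 n 4"
    unfolding H_def by (simp add: dist TJ prj5_T_d[OF d, simplified] add_ac)
  also have "\<dots> = idm (n * 5) + inj5 n 4 * F * (G * prj5 n 4)"
    unfolding K[symmetric] sum5_inj5_prj5[symmetric]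
    by (simp add: dist inj5_prj5_simps add_ac)
  finally have nl: "nul (T_d n d) (T_d n d) (idm (n * 5) + inj5 n 4 * F * (G * prj5 n 4))"
    by (metis nul_commutator)
  have d4: "dims (n * 5) n (inj5 n 4)" "dims n (n * 5) (prj5 n 4)"
    by (simp_all add: dims_inj5 dims_prj5)
  show ?thesis
    unfolding tower_def
  proof (intro conjI nl)
    show "dims (n * 5) 1 (inj5 n 4 * F)" "dims 1 (n * 5) (G * prj5 n 4)"
      using gX d4 dims_mult by blast+
    show "T_d n d * (inj5 n 4 * F) = 0" using gX by (simp add: TJ)
    show "G * prj5 n 4 * T_d n d = 0"
      using gX by (simp add: mult.assoc prj5_T_d[OF d]) (simp add: mult.assoc[symmetric])
    show "G * prj5 n 4 * (inj5 n 4 * F) = idm 1" using gX FG by (simp add: mult.assoc inj5_prj5_simps)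
  qed
qed

lemma nul_into_T:
  assumes d: "dims n n d" and f: "f = inj5 n 0 * f0 + inj5 n 1 * f1 + inj5 n 2 * f2 + inj5 n 3 * f3 + inj5 n 4 * f4"
    and "nul (dhat g d) s f0" "nul (dhat g d) s f1" "nul (dhat g d) s f2" "nul (dhat g d) s f3" "nul (dhat g d) s f4"
  shows "nul (dhat (T_gr g) (T_d n d)) s f"
proof -
  have "nul (dhat (T_gr g) (T_d n d)) s (inj5 n e * x)" if "e < 5" "nul (dhat g d) s x" for e x
    by (rule nul_mult_left[OF _ that(2)]) (simp add: ch_def dhat_T_inj5[OF d that(1)])
  then show ?thesis unfolding f using assms(3-) by (intro nul_add) auto
qed

lemma nul_from_T:
  assumes d: "dims n n d" and f: "f = f0 * prj5 n 0 + f1 * prj5 n 1 + f2 * prj5 n 2 + f3 * prj5 n 3 + f4 * prj5 n 4"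
    and "nul t (dhat g d) f0" "nul t (dhat g d) f1" "nul t (dhat g d) f2" "nul t (dhat g d) f3" "nul t (dhat g d) f4"
  shows "nul t (dhat (T_gr g) (T_d n d)) f"
proof -
  have "nul t (dhat (T_gr g) (T_d n d)) (x * prj5 n e)" if "e < 5" "nul t (dhat g d) x" for e x
    by (rule nul_mult_right[OF that(2)]) (simp add: ch_def prj5_dhat_T[OF d that(1)])
  then show ?thesis unfolding f using assms(3-) by (intro nul_add) auto
qed

lemma nul_prj5:
  assumes "dims n n d" "e < 5" "nul (dhat (T_gr g) (T_d n d)) s f"
  shows "nul (dhat g d) s (prj5 n e * f)"
  by (rule nul_mult_left[OF _ assms(3)]) (simp add: ch_def prj5_dhat_T[OF assms(1,2)])

lemma nul_inj5:
  assumes "dims n n d" "e < 5" "nul t (dhat (T_gr g) (T_d n d)) f"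
  shows "nul t (dhat g d) (f * inj5 n e)"
  by (rule nul_mult_right[OF assms(3)]) (simp add: ch_def dhat_T_inj5[OF assms(1,2)])

section \<open>Traces as an obstruction to local maps\<close>

lemma tr_wp: "tr (wp g g 0 A) = tr A"
  by (simp add: tr.rep_eq wp_def restr.rep_eq)

text \<open>Diagonal entries of a product have weight 0, so with nonnegative weights in both factors
  only their weight-zero parts contribute: the trace at U = 1 can be computed modulo U.\<close>

lemma tr_weight0:
  assumes "wge g' g 0 A" "wge g g' 0 B"
  shows "tr (wp g' g 0 A * wp g g' 0 B) = tr (A * B :: bit fmat)"
  using wp_mult0[OF assms] tr_wp[of g' "A * B"] by simp

text \<open>By orthogonality of chain maps and null homotopic maps, \<open>f\<close> may be replaced
  by \<open>F' * G\<close> and \<open>k\<close> by \<open>F * G'\<close>. What remains is the trace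
  of the identity on a one-dimensional space.\<close>

lemma tr_tower:
  assumes X: "tower n d F G" and Y: "tower m d' F' G'"
    and k: "dims n m k" "ch d d' k" "G * k * F' = idm 1" and f: "dims m n f" "ch d' d f" "G' * f * F = idm 1"
  shows "tr (k * f) = 1"
proof -
  have 1: "nul d' d (f + F' * G)" by (rule tower_factor[OF X Y f])
  have 2: "nul d d' (k + F * G')" by (rule tower_factor[OF Y X k])
  have "ch d' d (F' * G)" using X Y unfolding tower_def ch_def
    by (simp add: mult.assoc) (simp add: mult.assoc[symmetric])
  have "tr (k * (f + F' * G)) = 0" by (rule tr_nul[OF k(2) 1])
  moreover have "tr (F' * G * (k + F * G')) = 0" by (rule tr_nul[OF \<open>ch d' d (F' * G)\<close> 2])
  moreover have "tr (F' * G * k) = tr (k * (F' * G))" by (rule tr_commute)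
  ultimately have "tr (k * f) = tr (F' * G * (F * G'))"
    unfolding distrib_left tr_add by (metis add.assoc add_0 add_0_right bit_add_self)
  also have "F' * G * (F * G') = F' * (idm 1 * G')" using X by (simp add: tower_def mult.assoc) (simp add: mult.assoc[symmetric])
  also have "idm 1 * G' = G'" by (rule idm_mult[of 1 m]) (use Y in \<open>simp add: tower_def\<close>)
  also have "tr (F' * G') = tr (G' * F')" by (rule tr_commute)
  also have "\<dots> = 1" using Y tr_idm_1 by (simp add: tower_def)
  finally show ?thesis .
qed

lemma hat_chain_map:
  assumes X: "gcx n g d" and Y: "gcx m g' d'" and f: "wge g g' 0 f" "ch d d' f"
  shows "ch (dhat g d) (dhat g' d') (wp g g' 0 f)"
    "nul (dhat g d) (dhat g' d') (Phat g d * wp g g' 0 f + wp g g' 0 f * Phat g' d')"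
proof -
  have "d * f + f * d' = 0" using f(2) by (simp add: ch_def fmat_add_eq_0_iff)
  moreover have "wp g g' 0 (0 :: bit fmat) = 0" by (simp add: wp_def)
  ultimately show "ch (dhat g d) (dhat g' d') (wp g g' 0 f)"
    "nul (dhat g d) (dhat g' d') (Phat g d * wp g g' 0 f + wp g g' 0 f * Phat g' d')"
    using commutator_low_weights[OF X Y f(1)] by simp_all
qed

text \<open>Here \<open>z\<close> is a hat chain map extended constantly in U. Its commutator with
  the differential has no constant coefficient in U, and dividing by U leaves the commutator with
  \<Phi> modulo U.\<close>

lemma pure_commutator:
  assumes X: "gcx n g d" and Y: "gcx m g' d'" and z: "supp (\<lambda>i j. fst (g i) - fst (g' j) = 0) z"
    and c: "ch (dhat g d) (dhat g' d') z"
  shows "wge g g' 0 (d * z + z * d')" "wp g g' 0 (d * z + z * d') = Phat g d * z + z * Phat g' d'"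
proof -
  have z0: "wge g g' 0 z" by (rule supp_mono[OF z]) simp
  have w: "wge g g' (-1) (d * z + z * d')"
    using wge_mult[OF gcx_wge[OF X] z0] wge_mult[OF z0 gcx_wge[OF Y]] by (simp add: supp_add)
  have wpk: "wp g g' k (d * z + z * d') = wp g g k d * z + z * wp g' g' k d'" for k
    using wp_mult_pure_right[OF z, of g k d] wp_mult_pure_left[OF z, of g' k d'] by (simp add: wp_add)
  then show "wp g g' 0 (d * z + z * d') = Phat g d * z + z * Phat g' d'" .
  obtain R where R: "d * z + z * d' = wp g g' (-1) (d * z + z * d') + R" "wge g g' 0 R"
    using weight_split[OF w] by auto
  have "wp g g' (-1) (d * z + z * d') = 0" using c by (simp add: wpk ch_def)
  then show "wge g g' 0 (d * z + z * d')" using R by simp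
qed

text \<open>The relation for \<open>I * I\<close> says precisely that \<open>j\<close> is a left
  inverse; that it is also a right inverse needs the commutation of \<open>P * I * P * I\<close> up
  to homotopy. Next to \<open>P\<close> the correction term contains \<open>P * P\<close> and drops
  out.\<close>

lemma hat_iota_inverse:
  assumes "hatcx n d P I"
  defines "j \<equiv> I + P * I * P"
  shows "ch d d j" "nul d d (j * I + idm n)" "nul d d (I * j + idm n)"
    "nul d d (j * P + I * P)" "nul d d (P * j + P * I)"
proof -
  note h = assms(1)[unfolded hatcx_def]
  show "ch d d j" unfolding j_def using h by (intro ch_add ch_mult) auto
  show "nul d d (j * I + idm n)" using h by (simp add: j_def distrib_right mult.assoc add_ac)
  have "nul d d (I * I + idm n + P * I * P * I + (P * I * P * I + I * P * I * P))"
    by (rule nul_add) (use h in auto)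
  then show "nul d d (I * j + idm n)" by (simp add: j_def distrib_left mult.assoc add_ac)
  have "nul d d (P * I * (P * P))" by (rule nul_mult_left) (use h in auto)
  then show "nul d d (j * P + I * P)" by (simp add: j_def distrib_right mult.assoc add_ac)
  have "nul d d (P * P * (I * P))" by (rule nul_mult_right) (use h in auto)
  then show "nul d d (P * j + P * I)" by (simp add: j_def distrib_left mult.assoc add_ac)
qed

lemma tr_nul_self: "nul d d z \<Longrightarrow> tr z = 0"
  unfolding nul_def by (metis tr_add tr_commute bit_add_self)

text \<open>Writing \<open>j\<close> for the homotopy inverse of \<open>I\<close>, both lemmas express the component of a local map
  along the tower generator of \<open>C\<^sub>E\<close> through the others and evaluate the trace of its composite with
  the local map in the other direction: the terms cancel in pairs under cyclic rotation.\<close>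

lemma trace_into:
  assumes X: "hatcx n d P I" and Y: "hatcx m d' p i"
    and k: "ch d d' k" "nul d d' (I * k + k * i)" "nul d d' (P * k + k * p)"
    and f: "dims m n f3" "dims m n f4" "ch d' d f2" "ch d' d f3" "ch d' d f4"
    and f2: "nul d' d (f2 + (p * f3 + f3 * P))"
    and eq: "nul d' d (i * f3 + i * f4 + p * i * f2 + f3 * I)"
  shows "tr (k * f4) = 0"
proof -
  note tz = tr_nul_self[of d]
  define j where "j = i + p * i * p"
  note jn = hat_iota_inverse[OF Y, folded j_def]
  note hX = X[unfolded hatcx_def] and hY = Y[unfolded hatcx_def]
  note ch' = k(1) f(3-5) jn(1)
  have chs: "ch d' d' i" "ch d' d' p" using hY by auto
  \<comment> \<open>Multiplied by \<open>j\<close>, the relation \<open>eq\<close> solves for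
    \<open>f4\<close> as \<open>f3 + j * f3 * I + j * p * i * f2\<close>. Against \<open>k\<close>
    the first two terms cancel since \<open>k\<close> intertwines the involutions; the third cancels
    in itself once \<open>f2\<close> is replaced by a commutator of \<open>f3\<close>, as
    \<open>k\<close> intertwines \<open>P\<close> with \<open>p\<close> and
    \<open>p * i * p * i\<close> is homotopic to its reversed word.\<close>
  have z1: "tr (k * j * (i * f3 + i * f4 + p * i * f2 + f3 * I)) = 0"
    by (rule tz, rule nul_mult_left[OF ch_mult[OF k(1) jn(1)] eq])
  have z2: "tr (k * ((j * i + idm m) * (f3 + f4))) = 0"
    by (rule tz, intro nul_mult_left[OF k(1)] nul_mult_right[OF jn(2)] ch_add ch')
  have z3: "tr ((I * k + k * i) * (j * f3)) = 0"
    by (rule tz, intro nul_mult_right[OF k(2)] ch_mult[of _ d'] ch')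
  have z4: "tr (k * ((i * j + idm m) * f3)) = 0"
    by (rule tz, intro nul_mult_left[OF k(1)] nul_mult_right[OF jn(3)] ch')
  have z5: "tr (k * ((j * p + i * p) * (i * f2))) = 0"
    by (rule tz, intro nul_mult_left[OF k(1)] nul_mult_right[OF jn(4)] ch_mult[of _ d'] chs ch')
  have z6: "tr (k * (i * (p * (i * (f2 + (p * f3 + f3 * P)))))) = 0"
    by (rule tz, intro nul_mult_left[OF k(1)] nul_mult_left[OF chs(1)] nul_mult_left[OF chs(2)] f2)
  have z7: "tr ((P * k + k * p) * (i * (p * (i * f3)))) = 0"
    by (rule tz, intro nul_mult_right[OF k(3)] ch_mult[of _ d'] chs ch')
  have z8: "tr (k * ((p * i * p * i + i * p * i * p) * f3)) = 0"
    by (rule tz, intro nul_mult_left[OF k(1)] nul_mult_right[OF _ ch'(3)])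
      (use hY in blast)
  have c1: "tr (k * j * f3 * I) = tr (I * k * j * f3)"
    using tr_commute[of "k * j * f3" I] by (simp add: mult.assoc)
  have c2: "tr (k * i * p * i * f3 * P) = tr (P * k * i * p * i * f3)"
    using tr_commute[of "k * i * p * i * f3" P] by (simp add: mult.assoc)
  have "k * f4 + (k * j * f3 * I + I * k * j * f3) + (k * i * p * i * f3 * P + P * k * i * p * i * f3) =
    k * j * (i * f3 + i * f4 + p * i * f2 + f3 * I) + k * ((j * i + idm m) * (f3 + f4)) +
    (I * k + k * i) * (j * f3) + k * ((i * j + idm m) * f3) + k * ((j * p + i * p) * (i * f2)) +
    k * (i * (p * (i * (f2 + (p * f3 + f3 * P))))) + (P * k + k * p) * (i * (p * (i * f3))) +
    k * ((p * i * p * i + i * p * i * p) * f3)"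
    using idm_mult[OF f(1)] idm_mult[OF f(2)]
    by (simp add: dist add_ac)
  then have "tr (k * f4 + (k * j * f3 * I + I * k * j * f3) + (k * i * p * i * f3 * P + P * k * i * p * i * f3)) = 0"
    by (simp only: tr_add z1 z2 z3 z4 z5 z6 z7 z8 add_0_right)
  then show ?thesis by (simp only: tr_add c1 c2 bit_add_self add_0_right)
qed

lemma trace_out_of:
  assumes X: "hatcx n d P I" and Y: "hatcx m d' p i"
    and k: "ch d' d k" "nul d' d (i * k + k * I)" "nul d' d (p * k + k * P)"
    and f: "dims n m f0" "dims n m f4" "ch d d' f0" "ch d d' f1" "ch d d' f2" "ch d d' f4"
    and f1: "nul d d' (f1 + (P * f0 + f0 * p))"
    and eqa: "nul d d' (I * f0 + f0 * i + f4 * i + f2 * p * i)"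
    and eqb: "nul d d' (I * f1 + f2 * i)"
  shows "tr (k * f4) = 0"
proof -
  note tz = tr_nul_self[of d']
  define j where "j = i + p * i * p"
  note jn = hat_iota_inverse[OF Y, folded j_def]
  note hX = X[unfolded hatcx_def] and hY = Y[unfolded hatcx_def]
  have chs: "ch d' d' i" "ch d' d' p" "ch d d I" "ch d d P" using hX hY by auto
  note ch' = k(1) f(3-6) jn(1) chs
  have dp: "dims m m p" using hY by auto
  \<comment> \<open>Here \<open>eqa\<close> reduces the trace of \<open>k * f4\<close> to that of
    \<open>k * f2 * p\<close>. Then \<open>eqb\<close> replaces \<open>f2\<close> by
    \<open>I * f1 * j\<close>, and expanding \<open>f1\<close> as a commutator of \<open>f0\<close>
    leaves two words with equal trace.\<close>
  have z1: "tr (k * ((I * f0 + f0 * i + f4 * i + f2 * p * i) * j)) = 0"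
    by (rule tz, intro nul_mult_left[OF k(1)] nul_mult_right[OF eqa] ch')
  have z2: "tr (k * ((f0 + f4) * (i * j + idm m))) = 0"
    by (rule tz, intro nul_mult_left[OF k(1)] nul_mult_left[OF _ jn(3)] ch_add ch')
  have z3: "tr ((i * k + k * I) * (f0 * j)) = 0"
    by (rule tz, intro nul_mult_right[OF k(2)] ch_mult[of _ d'] ch')
  have z4: "tr (k * (f0 * (j * i + idm m))) = 0"
    by (rule tz, intro nul_mult_left[OF k(1)] nul_mult_left[OF _ jn(2)] ch')
  have z5: "tr (k * (f2 * (p * (i * j + idm m)))) = 0"
    by (rule tz, intro nul_mult_left[OF k(1)] nul_mult_left[OF f(5)] nul_mult_left[OF chs(2)] jn(3))
  have z6: "tr (k * ((I * f1 + f2 * i) * (j * p))) = 0"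
    by (rule tz, intro nul_mult_left[OF k(1)] nul_mult_right[OF eqb] ch_mult[of _ d'] ch')
  have z6': "tr (k * (f2 * ((i * j + idm m) * p))) = 0"
    by (rule tz, intro nul_mult_left[OF k(1)] nul_mult_left[OF f(5)] nul_mult_right[OF jn(3)] chs)
  have z7: "tr ((i * k + k * I) * (f1 * (j * p))) = 0"
    by (rule tz, intro nul_mult_right[OF k(2)] ch_mult[of _ d'] ch')
  have z8: "tr (k * (f1 * ((j * p + i * p) * i))) = 0"
    by (rule tz, intro nul_mult_left[OF k(1)] nul_mult_left[OF f(4)] nul_mult_right[OF jn(4)] chs)
  have z9: "tr (k * ((f1 + (P * f0 + f0 * p)) * (i * (p * i)))) = 0"
    by (rule tz, intro nul_mult_left[OF k(1)] nul_mult_right[OF f1] ch_mult[of _ d'] ch')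
  have z10: "tr ((p * k + k * P) * (f0 * (i * (p * i)))) = 0"
    by (rule tz, intro nul_mult_right[OF k(3)] ch_mult[of _ d'] ch')
  have z11: "tr (k * (f0 * (p * i * p * i + i * p * i * p))) = 0"
    by (rule tz, intro nul_mult_left[OF k(1)] nul_mult_left[OF f(3)])
      (use hY in blast)
  have c1: "tr (i * k * f0 * j) = tr (k * f0 * j * i)"
    using tr_commute[of i "k * f0 * j"] by (simp add: mult.assoc)
  have c2: "tr (i * k * f1 * j * p) = tr (k * f1 * j * p * i)"
    using tr_commute[of i "k * f1 * j * p"] by (simp add: mult.assoc)
  have c3: "tr (p * k * f0 * i * p * i) = tr (k * f0 * i * p * i * p)"
    using tr_commute[of p "k * f0 * i * p * i"] by (simp add: mult.assoc)
  have "k * f4 + (i * k * f0 * j + k * f0 * j * i) + (i * k * f1 * j * p + k * f1 * j * p * i)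
      + (p * k * f0 * i * p * i + k * f0 * i * p * i * p) =
    k * ((I * f0 + f0 * i + f4 * i + f2 * p * i) * j) + k * ((f0 + f4) * (i * j + idm m)) +
    (i * k + k * I) * (f0 * j) + k * (f0 * (j * i + idm m)) + k * (f2 * (p * (i * j + idm m))) +
    k * ((I * f1 + f2 * i) * (j * p)) + k * (f2 * ((i * j + idm m) * p)) + (i * k + k * I) * (f1 * (j * p)) +
    k * (f1 * ((j * p + i * p) * i)) + k * ((f1 + (P * f0 + f0 * p)) * (i * (p * i))) +
    (p * k + k * P) * (f0 * (i * (p * i))) + k * (f0 * (p * i * p * i + i * p * i * p))"
    using mult_idm[OF f(1)] mult_idm[OF f(2)] mult_idm[OF dp] idm_mult[OF dp]
    by (simp add: dist add_ac)
  then have "tr (k * f4 + (i * k * f0 * j + k * f0 * j * i) + (i * k * f1 * j * p + k * f1 * j * p * i)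
      + (p * k * f0 * i * p * i + k * f0 * i * p * i * p)) = 0"
    by (simp only: tr_add z1 z2 z3 z4 z5 z6 z6' z7 z8 z9 z10 z11 add_0_right)
  then show ?thesis by (simp only: tr_add c1 c2 c3 bit_add_self add_0_right)
qed

lemma wge_prj5_mult: "e < 5 \<Longrightarrow> wge (T_gr g) gs k f \<Longrightarrow> wge g gs k (prj5 n e * f)"
  by (erule supp_mult[OF supp_prj5]) (auto simp: fst_T_gr)

lemma wge_mult_inj5: "e < 5 \<Longrightarrow> wge gt (T_gr g) k f \<Longrightarrow> wge gt g k (f * inj5 n e)"
  by (erule supp_mult[OF _ supp_inj5]) (auto simp: fst_T_gr)

text \<open>The trace of \<open>k\<close> composed with the x-component of \<open>f\<close> is 1 on
  the tower. The d-component of the compatibility with the involutions, and the fact that the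
  c-component is the commutator of the d-component with the differential, force it to be 0.\<close>

lemma local_into_T_excludes:
  assumes X: "iotacx n g d I F G" and Y: "iotacx m g' d' i F' G'"
    and k: "local_at n g d I m g' d' i k"
    and f: "local_at (m * 5) (T_gr g') (T_d m d') (T_I m (Phat g' d') i) n g d I f"
  shows False
proof -
  let ?J = "T_I m (Phat g' d') i" and ?T = "dhat (T_gr g') (T_d m d')"
  let ?t = "wp g' g 0" and ?u = "wp g g' 0" and ?d = "dhat g d" and ?e = "dhat g' d'"
  have cX: "gcx n g d" and cY: "gcx m g' d'" and tX: "tower n d F G" and tY: "tower m d' F' G'"
    and hX: "hatcx n ?d (Phat g d) I" and hY: "hatcx m ?e (Phat g' d') i"
    using X Y by (auto simp: iotacx_def)
  have dY: "dims m m d'" using cY by (simp add: gcx_def)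
  have dI: "dims m m i" "dims m m (Phat g' d')" using hY by (auto simp: hatcx_def)
  have k': "dims n m k" "graded g g' k" "ch d d' k" "G * k * F' = idm 1"
    "nul ?d ?e (I * ?u k + ?u k * i)"
    using k hequiv_tower[OF tY tX] by (auto simp: local_at_def)
  have f': "dims (m * 5) n f" "graded (T_gr g') g f" "ch (T_d m d') d f" "G' * prj5 m 4 * f * F = idm 1"
    "nul (?T) ?d
       (?J * wp (T_gr g') g 0 f + wp (T_gr g') g 0 f * I)"
    using f hequiv_tower[OF tX tower_T[OF dY tY]] by (auto simp: local_at_def)
  define c where "c e = prj5 m e * f" for e
  have cw: "wge g' g 0 (c e)" if "e < 5" for e
    unfolding c_def by (rule wge_prj5_mult[OF that graded_wge[OF f'(2)]])
  have cd: "dims m n (c e)" for e unfolding c_def by (rule dims_prj5_mult[OF f'(1)])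
  have cc: "c 2 * d = d' * c 2" "c 3 * d = d' * c 3 + c 2" "c 4 * d = d' * c 4"
  proof -
    have *: "c e * d = prj5 m e * T_d m d' * f" for e
      using f'(3) by (simp add: c_def ch_def mult.assoc)
    show "c 2 * d = d' * c 2" "c 3 * d = d' * c 3 + c 2" "c 4 * d = d' * c 4"
      unfolding * prj5_T_d[OF dY] by (simp_all add: c_def distrib_right mult.assoc)
  qed
  have c2: "d' * c 3 + c 3 * d = c 2" by (simp add: cc)
  have ch2: "ch d' d (c 2)" "ch d' d (c 4)" by (simp_all add: ch_def cc)
  have wc: "?t (c e) = prj5 m e * wp (T_gr g') g 0 f" if "e < 5" for e
    unfolding c_def by (rule wp_prj5_mult[OF that])
  have "nul ?e ?d (prj5 m 3 *
      (?J * wp (T_gr g') g 0 f + wp (T_gr g') g 0 f * I))"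
    by (rule nul_prj5[OF dY _ f'(5)]) simp
  also have "prj5 m 3 * (?J * wp (T_gr g') g 0 f + wp (T_gr g') g 0 f * I) =
      i * ?t (c 3) + i * ?t (c 4) + Phat g' d' * i * ?t (c 2) + ?t (c 3) * I"
    unfolding distrib_left mult.assoc[symmetric] prj5_T_I[OF dI]
    by (simp add: wc distrib_right mult.assoc)
  finally have eq: "nul ?e ?d (i * ?t (c 3) + i * ?t (c 4)
    + Phat g' d' * i * ?t (c 2) + ?t (c 3) * I)" .
  have "tr (?u k * ?t (c 4)) = 0"
  proof (rule trace_into[OF hX hY _ k'(5) _ _ _ _ _ _ _ eq])
    show "ch ?d ?e (?u k)"
      "nul ?d ?e (Phat g d * ?u k + ?u k * Phat g' d')"
      by (rule hat_chain_map[OF cX cY graded_wge[OF k'(2)] k'(3)])+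
    show "dims m n (?t (c 3))" "dims m n (?t (c 4))"
      by (rule wp_supp'[OF cd])+
    show "ch ?e ?d (?t (c 2))" "ch ?e ?d (?t (c 4))"
      by (rule hat_chain_map[OF cY cX cw]; simp add: ch2)+
    have w23: "wge g' g 0 (c 3)" "wge g' g 0 (d' * c 3 + c 3 * d)" using cw[of 3] cw[of 2] by (simp_all add: c2)
    show "ch ?e ?d (?t (c 3))" by (rule commutator_low_weights[OF cY cX w23])
    show "nul ?e ?d
      (?t (c 2) + (Phat g' d' * ?t (c 3) + ?t (c 3) * Phat g d))"
      using commutator_low_weights(2)[OF cY cX w23] by (simp only: c2)
  qed
  moreover have "tr (?u k * ?t (c 4)) = tr (k * c 4)"
    by (rule tr_weight0[OF graded_wge[OF k'(2)] cw]) simp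
  moreover have "tr (k * c 4) = 1"
    by (rule tr_tower[OF tX tY k'(1,3,4) cd ch2(2)]) (use f'(4) in \<open>simp add: c_def mult.assoc\<close>)
  ultimately show False by simp
qed

text \<open>Same contradiction, with the restrictions of \<open>f\<close> to the generators a and b:
  the restriction to b is the commutator of the one to a with the differential. The restriction to d
  is used only to see that the one to c is a chain map modulo U.\<close>

lemma local_out_of_T_excludes:
  assumes X: "iotacx n g d I F G" and Y: "iotacx m g' d' i F' G'"
    and k: "local_at m g' d' i n g d I k"
    and f: "local_at n g d I (m * 5) (T_gr g') (T_d m d') (T_I m (Phat g' d') i) f"
  shows False
proof -
  let ?J = "T_I m (Phat g' d') i" and ?T = "dhat (T_gr g') (T_d m d')"
  let ?t = "wp g' g 0" and ?u = "wp g g' 0" and ?d = "dhat g d" and ?e = "dhat g' d'"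
  have cX: "gcx n g d" and cY: "gcx m g' d'" and tX: "tower n d F G" and tY: "tower m d' F' G'"
    and hX: "hatcx n ?d (Phat g d) I" and hY: "hatcx m ?e (Phat g' d') i"
    using X Y by (auto simp: iotacx_def)
  have dY: "dims m m d'" using cY by (simp add: gcx_def)
  have dI: "dims m m i" using hY by (auto simp: hatcx_def)
  have k': "dims m n k" "graded g' g k" "ch d' d k" "G' * k * F = idm 1"
    "nul ?e ?d (i * ?t k + ?t k * I)"
    using k hequiv_tower[OF tX tY] by (auto simp: local_at_def)
  have f': "dims n (m * 5) f" "graded g (T_gr g') f" "ch d (T_d m d') f" "G * f * (inj5 m 4 * F') = idm 1"
    "nul ?d (?T)
       (I * wp g (T_gr g') 0 f + wp g (T_gr g') 0 f * ?J)"
    using f hequiv_tower[OF tower_T[OF dY tY] tX] by (auto simp: local_at_def)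
  define c where "c e = f * inj5 m e" for e
  have cw: "wge g g' 0 (c e)" if "e < 5" for e
    unfolding c_def by (rule wge_mult_inj5[OF that graded_wge[OF f'(2)]])
  have cd: "dims n m (c e)" for e unfolding c_def by (rule dims_mult_inj5[OF f'(1)])
  have cc: "d * c 0 = c 0 * d' + c 1" "d * c 1 = c 1 * d'" "d * c 2 = c 2 * d' + c 3" "d * c 4 = c 4 * d'"
  proof -
    have *: "d * c e = f * (T_d m d' * inj5 m e)" for e
      using f'(3) by (simp add: c_def ch_def mult.assoc[symmetric])
    show "d * c 0 = c 0 * d' + c 1" "d * c 1 = c 1 * d'" "d * c 2 = c 2 * d' + c 3" "d * c 4 = c 4 * d'"
      unfolding * T_d_inj5[OF dY] by (simp_all add: c_def distrib_left mult.assoc)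
  qed
  have c1: "d * c 0 + c 0 * d' = c 1" and c3: "d * c 2 + c 2 * d' = c 3" by (simp_all add: cc add_ac)
  have ch2: "ch d d' (c 1)" "ch d d' (c 4)" using cc by (simp_all add: ch_def)
  have wc: "?u (c e) = wp g (T_gr g') 0 f * inj5 m e" if "e < 5" for e
    unfolding c_def by (rule wp_mult_inj5[OF that])
  let ?M = "I * wp g (T_gr g') 0 f + wp g (T_gr g') 0 f * ?J"
  have "nul ?d ?e (?M * inj5 m 0)" by (rule nul_inj5[OF dY _ f'(5)]) simp
  also have "?M * inj5 m 0 = I * ?u (c 0) + ?u (c 0) * i + ?u (c 4) * i
      + ?u (c 2) * Phat g' d' * i"
    unfolding distrib_right mult.assoc T_I_inj5[OF dI]
    by (simp add: wc distrib_left mult.assoc add.assoc)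
  finally have eqa: "nul ?d ?e (I * ?u (c 0) + ?u (c 0) * i
      + ?u (c 4) * i + ?u (c 2) * Phat g' d' * i)" .
  have "nul ?d ?e (?M * inj5 m 1)" by (rule nul_inj5[OF dY _ f'(5)]) simp
  also have "?M * inj5 m 1 = I * ?u (c 1) + ?u (c 2) * i"
    unfolding distrib_right mult.assoc T_I_inj5[OF dI] by (simp add: wc mult.assoc)
  finally have eqb: "nul ?d ?e (I * ?u (c 1) + ?u (c 2) * i)" .
  have "tr (?t k * ?u (c 4)) = 0"
  proof (rule trace_out_of[OF hX hY _ k'(5) _ _ _ _ _ _ _ _ eqa eqb])
    show "ch ?e ?d (?t k)"
      "nul ?e ?d (Phat g' d' * ?t k + ?t k * Phat g d)"
      by (rule hat_chain_map[OF cY cX graded_wge[OF k'(2)] k'(3)])+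
    show "dims n m (?u (c 0))" "dims n m (?u (c 4))"
      by (rule wp_supp'[OF cd])+
    show "ch ?d ?e (?u (c 1))" "ch ?d ?e (?u (c 4))"
      by (rule hat_chain_map[OF cX cY cw]; use ch2 in simp)+
    have w: "wge g g' 0 (c 0)" "wge g g' 0 (d * c 0 + c 0 * d')" using cw[of 0] cw[of 1] by (simp_all add: c1)
    have w': "wge g g' 0 (c 2)" "wge g g' 0 (d * c 2 + c 2 * d')" using cw[of 2] cw[of 3] by (simp_all add: c3)
    show "ch ?d ?e (?u (c 0))" by (rule commutator_low_weights[OF cX cY w])
    show "ch ?d ?e (?u (c 2))" by (rule commutator_low_weights[OF cX cY w'])
    show "nul ?d ?e
      (?u (c 1) + (Phat g d * ?u (c 0) + ?u (c 0) * Phat g' d'))"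
      using commutator_low_weights(2)[OF cX cY w] by (simp only: c1)
  qed
  moreover have "tr (?t k * ?u (c 4)) = tr (k * c 4)"
    by (rule tr_weight0[OF graded_wge[OF k'(2)] cw]) simp
  moreover have "tr (k * c 4) = 1"
    by (rule tr_tower[OF tY tX k'(1,3,4) cd ch2(2)]) (use f'(4) in \<open>simp add: c_def mult.assoc\<close>)
  ultimately show False by simp
qed

section \<open>Explicit local maps built from the solution \<open>h\<close> of the dual
  system\<close>

lemma twisted_family:
  assumes X: "iotacx n g d I F G" and Y: "iotacx m g' d' i F' G'"
    and f: "dims n m f" "graded g g' f" "ch d d' f" "G * f * F' = idm 1" "wp g g' 0 f = I * h + h * i"
    and h: "dims n m h" "ch (dhat g d) (dhat g' d') h" "supp (\<lambda>i j. g i = skew (g' j)) h"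
  defines "t \<equiv> wp g g' 0" and "N \<equiv> nul (dhat g d) (dhat g' d')"
  obtains a b c e x where
    "dims n m a" "dims n m b" "dims n m c" "dims n m e" "dims n m x"
    "graded g g' a" "graded g g' e" "graded g g' x"
    "supp (\<lambda>i j. cls (g i) = cls (g' j) + 2 \<and> fst (g i) \<ge> fst (g' j)) b"
    "supp (\<lambda>i j. cls (g i) = cls (g' j) - 2 \<and> fst (g i) \<ge> fst (g' j)) c"
    "d * e + e * d' = c" "d * b + b * d' = a" "ch d d' a" "ch d d' c" "ch d d' x" "G * x * F' = idm 1"
    "N (I * t a + t a * i)"
    "N (I * t c + t b * i)"
    "N (I * t b + Phat g d * I * t a + t c * i)"
    "N (I * t e + I * t x + Phat g d * I * t c + t e * i)"
    "N (I * t a + I * t x + t x * i)"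
    "N (I * t e + t e * i + t x * i + t b * Phat g' d' * i)"
    "N (I * t b + t c * i + t a * Phat g' d' * i)"
    "N (I * t x + t x * i + t a * i)"
proof -
  let ?sh = "\<lambda>i j. g i = addgr (g' j) (0, -2)"
  let ?w = "\<lambda>i j. fst (g i) - fst (g' j) = 0"
  let ?up = "\<lambda>i j. cls (g i) = cls (g' j) + 2"
  have cX: "gcx n g d" and cY: "gcx m g' d'" and tX: "tower n d F G" and tY: "tower m d' F' G'"
    and hX: "hatcx n (dhat g d) (Phat g d) I" and hY: "hatcx m (dhat g' d') (Phat g' d') i"
    and sI: "supp (\<lambda>i j. g i = skew (g j)) I" and si: "supp (\<lambda>i j. g' i = skew (g' j)) i"
    using X Y by (auto simp: iotacx_def)
  note gX = cX[unfolded gcx_def] and gY = cY[unfolded gcx_def]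
  note kX = hX[unfolded hatcx_def] and kY = hY[unfolded hatcx_def]
  let ?P = "Phat g d" and ?p = "Phat g' d'"
  define e where "e = I * h"
  \<comment> \<open>Modulo U, \<open>b\<close> is the solution of the required relation between
    \<open>I * c\<close> and \<open>b * i\<close>: the commutation hypothesis rewrites
    \<open>c\<close> as \<open>?P * h * i + h * i * ?p\<close>, and multiplying \<open>I * c\<close>
    on the right by the homotopy inverse of \<open>i\<close> gives this formula. Its bidegree (0,-2)
    offsets that of the generator b.\<close>
  define b where "b = I * ?P * h + I * h * i * ?p * i"
  define z where "z = I * ?P * h"
  note sP = Phat_supp[OF cX] and sp = Phat_supp[OF cY]
  have sPh: "supp (\<lambda>i j. g i = skew (addgr (g' j) (0, -2))) (?P * h)"
    by (rule supp_mult[OF sP h(3)]) (auto simp: skew_def addgr_def prod_eq_iff)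
  have se: "supp (\<lambda>i j. g i = g' j) e" unfolding e_def
    by (rule supp_mult[OF sI h(3)]) simp
  have sz: "supp ?sh z" unfolding z_def mult.assoc
    by (rule supp_mult[OF sI sPh]) simp
  have s1: "supp (\<lambda>i j. g i = skew (g' j)) (e * i)" by (rule supp_mult[OF se si]) simp
  have s2: "supp (\<lambda>i j. g i = skew (addgr (g' j) (0, 2))) (e * i * ?p)" by (rule supp_mult[OF s1 sp]) simp
  have s3: "supp ?sh (e * i * ?p * i)"
    by (rule supp_mult[OF s2 si]) (auto simp: skew_def addgr_def prod_eq_iff)
  have sb: "supp ?sh b"
    unfolding b_def using supp_add[OF sz s3] by (simp add: z_def e_def)
  have kk: "ch (dhat g d) (dhat g d) I" "ch (dhat g d) (dhat g d) ?P" "ch (dhat g' d') (dhat g' d') i"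
    "ch (dhat g' d') (dhat g' d') ?p" "dims n n I" "dims n n ?P" "dims m m i" "dims m m ?p"
    using kX kY by auto
  have e1: "ch (dhat g d) (dhat g' d') e" "dims n m e"
    unfolding e_def by (rule ch_mult[OF kk(1) h(2)] dims_mult[OF kk(5) h(1)])+
  have z1: "ch (dhat g d) (dhat g' d') z" "dims n m z"
    unfolding z_def by (rule ch_mult[OF ch_mult[OF kk(1,2)] h(2)] dims_mult[OF dims_mult[OF kk(5,6)] h(1)])+
  have b1: "ch (dhat g d) (dhat g' d') b" "dims n m b"
    unfolding b_def z_def[symmetric] e_def[symmetric]
    by (rule ch_add[OF z1(1) ch_mult[OF ch_mult[OF ch_mult[OF e1(1) kk(3)] kk(4)] kk(3)]]
        supp_add[OF z1(2) dims_mult[OF dims_mult[OF dims_mult[OF e1(2) kk(7)] kk(8)] kk(7)]])+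
  note chs = e1(1) z1(1) b1(1) and dm = e1(2) z1(2) b1(2)
  define c where "c = d * e + e * d'"
  define a where "a = d * b + b * d'"
  \<comment> \<open>With \<open>f\<close> alone, the involutions would leave
    \<open>?P * I * ?P * I * h + h * ?p * i * ?p * i\<close> modulo U up to homotopy, whereas the
    equation along the tower generator asks for \<open>I * a\<close>. The commutator with
    \<open>z\<close> makes up the difference and, as a boundary, leaves the chain condition and the
    scalar on the tower unchanged.\<close>
  define x where "x = f + (d * z + z * d')"
  have w0: "supp ?w e" "supp ?w z"
    "supp ?w b"
    by (rule supp_mono[OF se] supp_mono[OF sz] supp_mono[OF sb]; simp add: addgr_def)+
  note pc = pure_commutator[OF cX cY w0(1) chs(1)] pure_commutator[OF cX cY w0(2) chs(2)]
    pure_commutator[OF cX cY w0(3) chs(3)]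
  have t: "t e = I * h" "t b = I * ?P * h + I * h * i * ?p * i" "t c = ?P * (I * h) + (I * h) * ?p"
    "t a = ?P * (I * ?P * h + I * h * i * ?p * i) + (I * ?P * h + I * h * i * ?p * i) * ?p"
    "t x = I * h + h * i + (?P * (I * ?P * h) + (I * ?P * h) * ?p)"
    unfolding t_def c_def a_def x_def wp_add f(5)
    using wp_ident[OF w0(1)] wp_ident[OF w0(3)] pc(2,4,6)
    by (simp_all add: e_def b_def z_def wp_add)
  have cls_comm: "supp (\<lambda>i j. cls (g i) = cls (g' j) + k - 2) (d * y + y * d')"
    if "supp (\<lambda>i j. cls (g i) = cls (g' j) + k) y" for y k
  proof (rule supp_add)
    show "supp (\<lambda>i j. cls (g i) = cls (g' j) + k - 2) (d * y)"
      by (rule supp_mult[of "\<lambda>i j. cls (g i) = cls (g j) - 2" _ "\<lambda>i j. cls (g i) = cls (g' j) + k"])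
        (use gX that in \<open>auto elim: supp_mono\<close>)
    show "supp (\<lambda>i j. cls (g i) = cls (g' j) + k - 2) (y * d')"
      by (rule supp_mult[of "\<lambda>i j. cls (g i) = cls (g' j) + k" _ "\<lambda>i j. cls (g' i) = cls (g' j) - 2"])
        (use gY that in \<open>auto elim: supp_mono\<close>)
  qed
  have both: "supp (\<lambda>i j. R i j \<and> fst (g i) \<ge> fst (g' j)) y" if "supp R y" "wge g g' 0 y" for R and y :: "bit fmat"
    using that by (auto simp: supp_def)
  have ce: "supp (\<lambda>i j. cls (g i) = cls (g' j) + 0) e" by (rule supp_mono[OF se]) simp
  have cz: "supp ?up z" by (rule supp_mono[OF sz]) (simp add: cls_def addgr_def)
  have cb: "supp ?up b" by (rule supp_mono[OF sb]) (simp add: cls_def addgr_def)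
  have gr: "graded g g' a" "graded g g' e" "graded g g' x"
    "supp (\<lambda>i j. cls (g i) = cls (g' j) + 2 \<and> fst (g i) \<ge> fst (g' j)) b"
    "supp (\<lambda>i j. cls (g i) = cls (g' j) - 2 \<and> fst (g i) \<ge> fst (g' j)) c"
  proof -
    show "graded g g' a" using both[OF cls_comm[OF cb]] pc(5) by (simp add: graded_def a_def)
    show "graded g g' e" unfolding graded_def by (rule supp_mono[OF se]) simp
    show "graded g g' x" using both[OF cls_comm[OF cz]] pc(3) f(2)
      unfolding graded_def x_def by - (rule supp_add, simp_all)
    show "supp (\<lambda>i j. cls (g i) = cls (g' j) + 2 \<and> fst (g i) \<ge> fst (g' j)) b"
      by (rule both[OF cb], rule supp_mono[OF w0(3)]) simp
    show "supp (\<lambda>i j. cls (g i) = cls (g' j) - 2 \<and> fst (g i) \<ge> fst (g' j)) c"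
      using both[OF cls_comm[OF ce]] pc(1) by (simp add: c_def)
  qed
  have chc: "ch d d' a" "ch d d' c" "ch d d' x"
    unfolding a_def c_def x_def using gX gY f(3) by (auto intro!: ch_add ch_commutator)
  have dm': "dims n m a" "dims n m c" "dims n m x"
    unfolding a_def c_def x_def using gX gY dm f(1) by (auto intro!: supp_add intro: dims_mult)
  have "G * x * F' = idm 1 + ((G * d) * z * F' + G * z * (d' * F'))"
    unfolding x_def by (simp only: dist f(4)[unfolded mult.assoc])
  then have gx: "G * x * F' = idm 1" using tX tY by (simp add: tower_def)
  have comm: "nul (dhat g d) (dhat g' d') (?P * (I * h + h * i) + (I * h + h * i) * ?p)"
    using hat_chain_map(2)[OF cX cY graded_wge[OF f(2)] f(3)] by (simp only: f(5))
  note H = twisted_family_homotopies[OF hX hY h(1,2) comm, folded t N_def]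
  show ?thesis
    by (rule that[of a b c e x])
      (use dm dm' gr chc gx H in \<open>simp_all only: a_def[symmetric] c_def[symmetric]\<close>)
qed

text \<open>The alternative for maps from the second complex to the first supplies \<open>h\<close>;
  the members of the twisted family become the components along the five generators.\<close>

lemma local_into_T_exists:
  assumes X: "iotacx n g d I F G" and Y: "iotacx m g' d' i F' G'"
    and none: "\<nexists>f. local_at n g d I m g' d' i f"
  shows "\<exists>f. local_at (m * 5) (T_gr g') (T_d m d') (T_I m (Phat g' d') i) n g d I f"
proof -
  let ?J = "T_I m (Phat g' d') i" and ?T = "dhat (T_gr g') (T_d m d')"
  let ?N = "nul (dhat g' d') (dhat g d)" and ?t = "wp g' g 0"
  have cX: "gcx n g d" and cY: "gcx m g' d'" and tX: "tower n d F G" and tY: "tower m d' F' G'"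
    and hY: "hatcx m (dhat g' d') (Phat g' d') i"
    using X Y by (auto simp: iotacx_def)
  have dY: "dims m m d'" using cY by (simp add: gcx_def)
  have dI: "dims m m i" using hY by (auto simp: hatcx_def)
  obtain f0 h where fh: "dims m n f0" "graded g' g f0" "ch d' d f0" "G' * f0 * F = idm 1"
    "?t f0 = i * h + h * I" "dims m n h" "ch (dhat g' d') (dhat g d) h"
    "supp (\<lambda>i j. g' i = skew (g j)) h"
    by (rule local_alternative[OF Y X none])
  obtain a b c e x where q: "dims m n a" "dims m n b" "dims m n c" "dims m n e" "dims m n x"
    "graded g' g a" "graded g' g e" "graded g' g x"
    "supp (\<lambda>i j. cls (g' i) = cls (g j) + 2 \<and> fst (g' i) \<ge> fst (g j)) b"
    "supp (\<lambda>i j. cls (g' i) = cls (g j) - 2 \<and> fst (g' i) \<ge> fst (g j)) c"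
    "d' * e + e * d = c" "d' * b + b * d = a" "ch d' d a" "ch d' d c" "ch d' d x" "G' * x * F = idm 1"
    and N: "?N (i * ?t a + ?t a * I)"
    "?N (i * ?t c + ?t b * I)"
    "?N (i * ?t b + Phat g' d' * i * ?t a + ?t c * I)"
    "?N (i * ?t e + i * ?t x + Phat g' d' * i * ?t c + ?t e * I)"
    "?N (i * ?t a + i * ?t x + ?t x * I)"
    by (rule twisted_family[OF Y X fh])
  \<comment> \<open>At U = 1 the chain condition requires the a-component to be the commutator of
    the b-component, and the c-component that of the d-component.\<close>
  define f where "f = inj5 m 0 * a + inj5 m 1 * b + inj5 m 2 * c + inj5 m 3 * e + inj5 m 4 * x"
  have df: "dims (m * 5) n f" unfolding f_def
    by (intro supp_add dims_mult[OF dims_inj5 q(1)] dims_mult[OF dims_inj5 q(2)] dims_mult[OF dims_inj5 q(3)]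
        dims_mult[OF dims_inj5 q(4)] dims_mult[OF dims_inj5 q(5)]) simp_all
  have g5: "graded (T_gr g') g (inj5 m k * y)"
    if "k < 5" "supp (\<lambda>i j. cls (g' i) + cls (gr CE_cx k) = cls (g j) \<and> fst (g' i) \<ge> fst (g j)) y" for k y
    unfolding graded_def by (rule supp_mult[OF supp_inj5 that(2)])
      (use that(1) in \<open>auto simp: T_gr_eq addgr_def cls_def\<close>)
  have grf: "graded (T_gr g') g f"
  proof -
    have "graded (T_gr g') g (inj5 m 0 * a)" by (rule g5) (use q(6) in \<open>simp_all add: graded_def CE_cx_def cls_def\<close>)
    moreover have "graded (T_gr g') g (inj5 m 1 * b)"
      by (rule g5, simp, rule supp_mono[OF q(9)]) (auto simp: CE_cx_def cls_def)
    moreover have "graded (T_gr g') g (inj5 m 2 * c)"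
      by (rule g5, simp, rule supp_mono[OF q(10)]) (auto simp: CE_cx_def cls_def)
    moreover have "graded (T_gr g') g (inj5 m 3 * e)" by (rule g5) (use q(7) in \<open>simp_all add: graded_def CE_cx_def cls_def\<close>)
    moreover have "graded (T_gr g') g (inj5 m 4 * x)" by (rule g5) (use q(8) in \<open>simp_all add: graded_def CE_cx_def cls_def\<close>)
    ultimately show ?thesis unfolding f_def graded_def by (intro supp_add)
  qed
  have ac: "a * d = d' * a" "c * d = d' * c" "x * d = d' * x" using q(13-15) by (simp_all add: ch_def)
  have be: "b * d = d' * b + a" "e * d = d' * e + c" by (simp_all add: q(11,12)[symmetric])
  have chf: "ch (T_d m d') d f"
    unfolding ch_def f_def dist
    by (simp add: mult.assoc[symmetric] T_d_inj5[OF dY, simplified])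
      (simp add: dist ac be add_ac)
  have "G' * prj5 m 4 * f * F = G' * (idm m * x) * F"
    unfolding f_def by (simp add: dist inj5_prj5_simps)
  then have "G' * prj5 m 4 * f * F = idm 1" using idm_mult[OF q(5)] q(16) by simp
  then have he: "hequiv (m * 5) (T_d m d') n d f"
    using hequiv_tower[OF tX tower_T[OF dY tY] df] chf by simp
  let ?w = "wp (T_gr g') g 0 f"
  have w: "?w = inj5 m 0 * ?t a + inj5 m 1 * ?t b + inj5 m 2 * ?t c
      + inj5 m 3 * ?t e + inj5 m 4 * ?t x"
    unfolding f_def wp_add by (simp add: wp_inj5_mult)
  have "nul (?T) (dhat g d) (?J * ?w + ?w * I)"
  proof (rule nul_into_T[OF dY _ N])
    show "?J * ?w + ?w * I =
      inj5 m 0 * (i * ?t a + ?t a * I) + inj5 m 1 * (i * ?t c + ?t b * I) +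
      inj5 m 2 * (i * ?t b + Phat g' d' * i * ?t a + ?t c * I) +
      inj5 m 3 * (i * ?t e + i * ?t x + Phat g' d' * i * ?t c + ?t e * I) +
      inj5 m 4 * (i * ?t a + i * ?t x + ?t x * I)"
      unfolding w dist
      by (simp add: mult.assoc[symmetric] T_I_inj5[OF dI, simplified])
        (simp add: dist add_ac)
  qed
  then show ?thesis using df grf he by (auto simp: local_at_def)
qed

lemma local_out_of_T_exists:
  assumes X: "iotacx n g d I F G" and Y: "iotacx m g' d' i F' G'"
    and none: "\<nexists>f. local_at m g' d' i n g d I f"
  shows "\<exists>f. local_at n g d I (m * 5) (T_gr g') (T_d m d') (T_I m (Phat g' d') i) f"
proof -
  let ?J = "T_I m (Phat g' d') i" and ?T = "dhat (T_gr g') (T_d m d')"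
  let ?N = "nul (dhat g d) (dhat g' d')" and ?t = "wp g g' 0"
  have cX: "gcx n g d" and cY: "gcx m g' d'" and tX: "tower n d F G" and tY: "tower m d' F' G'"
    and hY: "hatcx m (dhat g' d') (Phat g' d') i"
    using X Y by (auto simp: iotacx_def)
  have dY: "dims m m d'" using cY by (simp add: gcx_def)
  have dI: "dims m m i" "dims m m (Phat g' d')" using hY by (auto simp: hatcx_def)
  obtain f0 h where fh: "dims n m f0" "graded g g' f0" "ch d d' f0" "G * f0 * F' = idm 1"
    "?t f0 = I * h + h * i" "dims n m h" "ch (dhat g d) (dhat g' d') h"
    "supp (\<lambda>i j. g i = skew (g' j)) h"
    by (rule local_alternative[OF X Y none])
  obtain a b c e x where q: "dims n m a" "dims n m b" "dims n m c" "dims n m e" "dims n m x"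
    "graded g g' a" "graded g g' e" "graded g g' x"
    "supp (\<lambda>i j. cls (g i) = cls (g' j) + 2 \<and> fst (g i) \<ge> fst (g' j)) b"
    "supp (\<lambda>i j. cls (g i) = cls (g' j) - 2 \<and> fst (g i) \<ge> fst (g' j)) c"
    "d * e + e * d' = c" "d * b + b * d' = a" "ch d d' a" "ch d d' c" "ch d d' x" "G * x * F' = idm 1"
    and N0: "?N (I * ?t a + ?t a * i)"
    "?N (I * ?t c + ?t b * i)"
    "?N (I * ?t e + ?t e * i + ?t x * i + ?t b * Phat g' d' * i)"
    "?N (I * ?t b + ?t c * i + ?t a * Phat g' d' * i)"
    "?N (I * ?t x + ?t x * i + ?t a * i)"
    by (rule twisted_family[OF X Y fh])
  note N = N0(3,2,4,1,5)
  \<comment> \<open>Reverse order compared with maps into the tensor product: C_E is its own dual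
    under exchanging a with d and b with c.\<close>
  define f where "f = e * prj5 m 0 + c * prj5 m 1 + b * prj5 m 2 + a * prj5 m 3 + x * prj5 m 4"
  have df: "dims n (m * 5) f" unfolding f_def
    by (intro supp_add dims_mult[OF q(1) dims_prj5] dims_mult[OF q(2) dims_prj5] dims_mult[OF q(3) dims_prj5]
        dims_mult[OF q(4) dims_prj5] dims_mult[OF q(5) dims_prj5]) simp_all
  have g5: "graded g (T_gr g') (y * prj5 m k)"
    if "k < 5" "supp (\<lambda>i j. cls (g i) = cls (g' j) + cls (gr CE_cx k) \<and> fst (g i) \<ge> fst (g' j)) y" for k y
    unfolding graded_def by (rule supp_mult[OF that(2) supp_prj5])
      (use that(1) in \<open>auto simp: T_gr_eq addgr_def cls_def\<close>)
  have grf: "graded g (T_gr g') f"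
  proof -
    have "graded g (T_gr g') (e * prj5 m 0)" by (rule g5) (use q(7) in \<open>simp_all add: graded_def CE_cx_def cls_def\<close>)
    moreover have "graded g (T_gr g') (c * prj5 m 1)"
      by (rule g5, simp, rule supp_mono[OF q(10)]) (auto simp: CE_cx_def cls_def)
    moreover have "graded g (T_gr g') (b * prj5 m 2)"
      by (rule g5, simp, rule supp_mono[OF q(9)]) (auto simp: CE_cx_def cls_def)
    moreover have "graded g (T_gr g') (a * prj5 m 3)" by (rule g5) (use q(6) in \<open>simp_all add: graded_def CE_cx_def cls_def\<close>)
    moreover have "graded g (T_gr g') (x * prj5 m 4)" by (rule g5) (use q(8) in \<open>simp_all add: graded_def CE_cx_def cls_def\<close>)
    ultimately show ?thesis unfolding f_def graded_def by (intro supp_add)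
  qed
  have ac: "d * (a * y) = a * (d' * y)" "d * (c * y) = c * (d' * y)" "d * (x * y) = x * (d' * y)" for y
    using q(13-15) by (simp_all add: ch_def mult.assoc[symmetric])
  have be: "d * (b * y) = b * (d' * y) + a * y" "d * (e * y) = e * (d' * y) + c * y" for y
    by (simp_all add: q(11,12)[symmetric] distrib_right mult.assoc add_ac)
  have chf: "ch d (T_d m d') f"
    unfolding ch_def f_def dist prj5_T_d[OF dY]
    by (simp add: distrib_left ac be add_ac)
  have "G * f * (inj5 m 4 * F') = G * x * (idm m * F')"
    unfolding f_def by (simp add: dist inj5_prj5_simps)
  then have "G * f * (inj5 m 4 * F') = idm 1"
    using idm_mult[of m 1 F'] tY q(16) by (simp add: tower_def)
  then have he: "hequiv n d (m * 5) (T_d m d') f"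
    using hequiv_tower[OF tower_T[OF dY tY] tX df] chf by simp
  let ?w = "wp g (T_gr g') 0 f"
  have w: "?w = ?t e * prj5 m 0 + ?t c * prj5 m 1 + ?t b * prj5 m 2
      + ?t a * prj5 m 3 + ?t x * prj5 m 4"
    unfolding f_def wp_add by (simp add: wp_mult_prj5)
  have "nul (dhat g d) (?T) (I * ?w + ?w * ?J)"
  proof (rule nul_from_T[OF dY _ N])
    show "I * ?w + ?w * ?J =
      (I * ?t e + ?t e * i + ?t x * i + ?t b * Phat g' d' * i) * prj5 m 0 +
      (I * ?t c + ?t b * i) * prj5 m 1 +
      (I * ?t b + ?t c * i + ?t a * Phat g' d' * i) * prj5 m 2 +
      (I * ?t a + ?t a * i) * prj5 m 3 +
      (I * ?t x + ?t x * i + ?t a * i) * prj5 m 4"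
      unfolding w dist prj5_T_I[OF dI] by simp
  qed
  then show ?thesis using df grf he by (auto simp: local_at_def)
qed

section \<open>Passing to \<open>U = 1\<close>\<close>

lift_definition fm :: "'a::zero mat \<Rightarrow> 'a fmat" is
  "\<lambda>A i j. if i < dim_row A \<and> j < dim_col A then A $$ (i, j) else 0"
proof -
  fix A :: "'a mat"
  show "\<exists>n. \<forall>i j. (if i < dim_row A \<and> j < dim_col A then A $$ (i, j) else 0) \<noteq> 0 \<longrightarrow> i < n \<and> j < n"
    by (rule exI[of _ "dim_row A + dim_col A"]) auto
qed

lift_definition gmap :: "(nat \<Rightarrow> nat \<Rightarrow> 'a::zero \<Rightarrow> 'b::zero) \<Rightarrow> 'a fmat \<Rightarrow> 'b fmat" is
  "\<lambda>h f i j. if f i j = 0 then 0 else h i j (f i j)"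
proof -
  fix h :: "nat \<Rightarrow> nat \<Rightarrow> 'a \<Rightarrow> 'b" and f :: "nat \<Rightarrow> nat \<Rightarrow> 'a"
  assume "\<exists>n. \<forall>i j. f i j \<noteq> 0 \<longrightarrow> i < n \<and> j < n"
  then obtain n where n: "\<forall>i j. f i j \<noteq> 0 \<longrightarrow> i < n \<and> j < n" by (rule exE)
  show "\<exists>n. \<forall>i j. (if f i j = 0 then 0 else h i j (f i j)) \<noteq> 0 \<longrightarrow> i < n \<and> j < n"
    by (rule exI[of _ n]) (simp add: n)
qed

definition mt :: "nat \<Rightarrow> nat \<Rightarrow> 'a::zero fmat \<Rightarrow> 'a mat" where
  "mt m n A = mat m n (\<lambda>(i, j). ent A i j)"

lemma mt_carrier [simp]: "mt m n A \<in> carrier_mat m n" "dim_row (mt m n A) = m" "dim_col (mt m n A) = n"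
  by (simp_all add: mt_def)

lemma dims_fm: "A \<in> carrier_mat m n \<Longrightarrow> dims m n (fm A)"
  by (auto simp: supp_def fm.rep_eq split: if_splits)

lemma fm_mt: "dims m n A \<Longrightarrow> fm (mt m n A) = A"
  by (rule fmat_eqI) (auto simp: fm.rep_eq mt_def supp_def)

lemma fm_eqD: "A \<in> carrier_mat m n \<Longrightarrow> B \<in> carrier_mat m n \<Longrightarrow> fm A = fm B \<Longrightarrow> A = B"
proof (rule eq_matI)
  fix i j assume *: "A \<in> carrier_mat m n" "B \<in> carrier_mat m n" "fm A = fm B" "i < dim_row B" "j < dim_col B"
  have "ent (fm A) i j = ent (fm B) i j" by (simp only: *(3))
  then show "A $$ (i, j) = B $$ (i, j)" using *(1,2,4,5) by (simp add: fm.rep_eq)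
qed auto

lemma fm_add: "A \<in> carrier_mat m n \<Longrightarrow> B \<in> carrier_mat m n \<Longrightarrow> fm (A + B) = fm A + fm B"
  by (rule fmat_eqI) (auto simp: fm.rep_eq ent_simps)

lemma fm_mult: "A \<in> carrier_mat m n \<Longrightarrow> B \<in> carrier_mat n k \<Longrightarrow> fm (A * B) = fm A * fm B"
proof (rule fmat_eqI)
  fix i j assume A: "A \<in> carrier_mat m n" and B: "B \<in> carrier_mat n k"
  have "ent (fm A * fm B) i j = (\<Sum>l<n. ent (fm A) i l * ent (fm B) l j)"
    by (rule ent_mult_bound) (use A in \<open>auto simp: fm.rep_eq split: if_splits\<close>)
  then show "ent (fm (A * B)) i j = ent (fm A * fm B) i j"
    using A B by (auto simp: fm.rep_eq scalar_prod_def lessThan_atLeast0 intro!: sum.cong)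
qed

lemma fm_one: "fm (1\<^sub>m n) = idm n"
  by (rule fmat_eqI) (auto simp: fm.rep_eq idm.rep_eq)

lemma fm_zero: "fm (0\<^sub>m m n) = 0"
  by (rule fmat_eqI) (auto simp: fm.rep_eq ent_simps)

lemma ent_minus: "ent (A - B) i j = ent A i j - ent B i j" for A :: "'a::comm_ring_1 fmat"
  unfolding minus_fmat_def plus_fmat.rep_eq uminus_fmat.rep_eq by simp

lemma fm_minus: "A \<in> carrier_mat m n \<Longrightarrow> B \<in> carrier_mat m n \<Longrightarrow> fm (A - B) = fm A - fm B"
  by (rule fmat_eqI) (auto simp: fm.rep_eq ent_minus)

lemma fm_mult_eq_iff:
  assumes "A \<in> carrier_mat m n" "B \<in> carrier_mat n k" "A' \<in> carrier_mat m n'" "B' \<in> carrier_mat n' k"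
  shows "A * B = A' * B' \<longleftrightarrow> fm A * fm B = fm A' * fm B'"
  using fm_eqD[of "A * B" m k "A' * B'"] assms by (auto simp: fm_mult[symmetric])

lemma chain_map_iff:
  assumes "ds \<in> carrier_mat n n" "dt \<in> carrier_mat m m"
  shows "chain_map ds dt f \<longleftrightarrow> f \<in> carrier_mat m n \<and> fm dt * fm f = fm f * fm ds"
  using assms fm_mult_eq_iff[of dt m m f n f n ds] by (auto simp: chain_map_def)

lemma homotopy_iff:
  assumes "ds \<in> carrier_mat n n" "dt \<in> carrier_mat m m" "f \<in> carrier_mat m n" "g \<in> carrier_mat m n"
    "H \<in> carrier_mat m n"
  shows "f - g = dt * H + H * ds \<longleftrightarrow> fm f - fm g = fm dt * fm H + fm H * fm ds"
proof -
  have "f - g \<in> carrier_mat m n" "dt * H + H * ds \<in> carrier_mat m n" using assms by auto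
  moreover have "fm (dt * H + H * ds) = fm dt * fm H + fm H * fm ds"
    using assms by (subst fm_add[of _ m n]) (auto simp: fm_mult)
  moreover have "fm (f - g) = fm f - fm g" using assms by (simp add: fm_minus)
  ultimately show ?thesis using fm_eqD by metis
qed

text \<open>In \<open>nul\<close> the homotopy may have any size; truncating it to the proper block
  by local units commutes with both differentials.\<close>

lemma nul_dims:
  assumes d: "dims m n f" "dims m m t" "dims n n s" and "nul t s f"
  obtains H where "dims m n H" "f = t * H + H * s"
proof -
  obtain H where H: "f = t * H + H * s" using assms(4) by (auto simp: nul_def)
  define K where "K = idm m * H * idm n"
  have "supp (\<lambda>i j. i < m) (idm m * H)"
    by (rule supp_mult[of "\<lambda>i j. i < m \<and> j < m" _ "\<lambda>_ _. True"]) (auto simp: dims_idm, simp add: supp_def)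
  then have K: "dims m n K" unfolding K_def
    by (rule supp_mult[of _ _ "\<lambda>i j. i < n \<and> j < n"]) (auto simp: dims_idm)
  have "f = idm m * f * idm n" using d(1) by (simp add: idm_mult mult_idm)
  also have "\<dots> = (idm m * t) * H * idm n + idm m * H * (s * idm n)"
    unfolding H by (simp add: dist)
  also have "idm m * t = t * idm m" using d by (simp add: idm_mult mult_idm)
  also have "s * idm n = idm n * s" using d by (simp add: idm_mult mult_idm)
  finally have "f = t * K + K * s" by (simp add: K_def mult.assoc)
  with K show ?thesis by (rule that)
qed

lemma homotopic_iff_nul:
  assumes "ds \<in> carrier_mat n n" "dt \<in> carrier_mat m m" "f \<in> carrier_mat m n" "g \<in> carrier_mat m n"
  shows "homotopic ds dt f g \<longleftrightarrow> nul (fm dt) (fm ds) (fm f + fm (g :: bit mat))"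
proof
  assume "homotopic ds dt f g"
  then obtain H where "H \<in> carrier_mat m n" "f - g = dt * H + H * ds"
    using assms by (auto simp: homotopic_def)
  then show "nul (fm dt) (fm ds) (fm f + fm g)"
    using homotopy_iff[OF assms, of H] by (auto simp: nul_def)
next
  assume nl: "nul (fm dt) (fm ds) (fm f + fm g)"
  have d: "dims m n (fm f + fm g)" "dims m m (fm dt)" "dims n n (fm ds)"
    using assms by (auto intro: supp_add dims_fm)
  obtain K where "dims m n K" "fm f + fm g = fm dt * K + K * fm ds"
    by (rule nul_dims[OF d nl])
  then show "homotopic ds dt f g"
    using assms homotopy_iff[OF assms, of "mt m n K"] unfolding homotopic_def
    by (auto intro!: bexI[of _ "mt m n K"] simp: fm_mt)
qed

section \<open>Laurent polynomials and their values at U = 1\<close>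

lemma bit_poly_add_self [simp]: "(p :: bit poly) + p = 0"
  by (rule poly_eqI) (simp only: coeff_add bit_add_self coeff_0)

lemma tofr_simps: "tofr (p + q) = tofr p + tofr q" "tofr (p * q) = tofr p * tofr q"
  "tofr 0 = 0" "tofr 1 = 1"
  by (simp_all add: tofr_def Zero_fract_def One_fract_def)

lemma fract_add_self [simp]: "(x :: bit poly fract) + x = 0"
proof -
  have "(1 :: bit poly fract) + 1 = 0"
    using tofr_simps(1)[of 1 1] by (simp only: bit_poly_add_self tofr_simps)
  then have "x * (1 + 1) = 0" by (simp only: mult_zero_right)
  then show ?thesis by (simp only: distrib_left mult_1_right)
qed

lemma fract_uminus [simp]: "- (x :: bit poly fract) = x"
  by (rule minus_unique) (rule fract_add_self)

lemma tofr_eq_iff [simp]: "tofr p = tofr q \<longleftrightarrow> p = q"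
  by (simp add: tofr_def eq_fract)

lemma Uf_nonzero [simp]: "Uf \<noteq> 0"
  unfolding Uf_def tofr_simps(3)[symmetric] by simp

lemma tofr_monom: "tofr (monom 1 k) = Uf ^ k"
proof (induction k)
  case (Suc k)
  have "monom (1::bit) (Suc k) = [:0, 1:] * monom 1 k" by (simp add: monom_Suc)
  then have "tofr (monom 1 (Suc k)) = Uf * tofr (monom 1 k)" by (simp only: tofr_simps Uf_def)
  then show ?case by (simp add: Suc)
qed (simp add: tofr_simps)

lemma Uf_powi_neg: "Uf powi (- int n) = inverse (Uf ^ n)"
  by (simp add: power_int_minus)

text \<open>Evaluation at \<open>U = 1\<close>; meaningful only on Laurent polynomials.\<close>

definition lev :: "bit poly fract \<Rightarrow> bit" where
  "lev x = (THE b. \<exists>p (n::nat). x = tofr p * Uf powi (- int n) \<and> b = poly p 1)"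

text \<open>Two fractions for the same element become equal polynomials after multiplication by
  powers of U, which take the value 1.\<close>

lemma lev_eq: "lev (tofr p * Uf powi (- int n)) = poly p 1"
  unfolding lev_def
proof (rule the_equality)
  fix b assume "\<exists>q m. tofr p * Uf powi - int n = tofr q * Uf powi - int m \<and> b = poly q 1"
  then obtain q m where q: "tofr p * Uf powi - int n = tofr q * Uf powi - int m" "b = poly q 1" by blast
  have "tofr p * Uf ^ m = (tofr p * Uf powi - int n) * (Uf ^ n * Uf ^ m)"
    by (simp add: power_int_minus field_simps)
  also have "\<dots> = tofr q * Uf ^ n" unfolding q(1) by (simp add: power_int_minus field_simps)
  finally have "tofr (p * monom 1 m) = tofr (q * monom 1 n)" by (simp add: tofr_simps tofr_monom)
  then have "p * monom 1 m = q * monom 1 n" by simp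
  then have "poly (p * monom 1 m) 1 = poly (q * monom 1 n) 1" by (rule arg_cong)
  then show "b = poly p 1" by (simp add: q(2) poly_monom)
qed blast

lemma lev_tofr: "lev (tofr p) = poly p 1"
  using lev_eq[of p 0] by simp

lemma laurent_tofr: "laurent (tofr p)"
  unfolding laurent_def by (intro exI[of _ p] exI[of _ 0]) simp

lemma laurent_powi: "laurent (Uf powi k)"
proof (cases "k \<ge> 0")
  case True
  then have "Uf powi k = tofr (monom 1 (nat k))" by (simp add: tofr_monom power_int_def)
  then show ?thesis by (simp add: laurent_tofr)
next
  case False
  then show ?thesis unfolding laurent_def
    by (intro exI[of _ 1] exI[of _ "nat (- k)"]) (simp add: tofr_simps)
qed

lemma laurent_common:
  assumes "laurent x" "laurent y"
  obtains p q n where "x = tofr p * Uf powi - int n" "y = tofr q * Uf powi - int n"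
proof -
  obtain p n q m where *: "x = tofr p * Uf powi - int n" "y = tofr q * Uf powi - int m"
    using assms by (auto simp: laurent_def)
  have "x = tofr (p * monom 1 m) * Uf powi - int (n + m)" "y = tofr (q * monom 1 n) * Uf powi - int (n + m)"
    unfolding * Uf_powi_neg tofr_simps tofr_monom by (simp_all add: power_add field_simps)
  then show ?thesis by (rule that)
qed

lemma lev_add:
  assumes "laurent x" "laurent y"
  shows "laurent (x + y) \<and> lev (x + y) = lev x + lev y"
proof -
  obtain p q n where *: "x = tofr p * Uf powi - int n" "y = tofr q * Uf powi - int n"
    by (rule laurent_common[OF assms])
  then have "x + y = tofr (p + q) * Uf powi - int n" by (simp add: tofr_simps algebra_simps)
  then show ?thesis using * lev_eq[of _ n] unfolding laurent_def by (metis poly_add)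
qed

lemma lev_mult:
  assumes "laurent x" "laurent y"
  shows "laurent (x * y) \<and> lev (x * y) = lev x * lev y"
proof -
  obtain p q n where *: "x = tofr p * Uf powi - int n" "y = tofr q * Uf powi - int n"
    by (rule laurent_common[OF assms])
  have "x * y = tofr (p * q) * Uf powi - int (n + n)"
    unfolding * Uf_powi_neg tofr_simps by (simp add: power_add field_simps)
  then show ?thesis using * lev_eq unfolding laurent_def by (metis poly_mult)
qed

lemma lev_0_1 [simp]: "lev 0 = 0" "lev 1 = 1" "laurent 0" "laurent 1"
  using lev_tofr[of 0] lev_tofr[of 1] laurent_tofr[of 0] laurent_tofr[of 1] by (simp_all add: tofr_simps)

lemma lev_sum: "(\<And>i. i \<in> A \<Longrightarrow> laurent (h i)) \<Longrightarrow> laurent (sum h A) \<and> lev (sum h A) = (\<Sum>i\<in>A. lev (h i))"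
  by (induction A rule: infinite_finite_induct) (auto simp: lev_add)

definition lau :: "bit poly fract fmat \<Rightarrow> bool" where
  "lau A \<longleftrightarrow> (\<forall>i j. laurent (ent A i j))"

abbreviation flev :: "bit poly fract fmat \<Rightarrow> bit fmat" where
  "flev \<equiv> gmap (\<lambda>_ _. lev)"

lemma ent_flev: "ent (flev A) i j = lev (ent A i j)"
  by (simp add: gmap.rep_eq)

lemma flev_add: "lau A \<Longrightarrow> lau B \<Longrightarrow> flev (A + B) = flev A + flev B"
  by (rule fmat_eqI) (simp add: ent_flev ent_simps lau_def lev_add)

lemma flev_mult: "lau A \<Longrightarrow> lau B \<Longrightarrow> lau (A * B) \<and> flev (A * B) = flev A * flev B"
proof -
  assume A: "lau A" and B: "lau B"
  obtain n where n: "\<And>i j. ent A i j \<noteq> 0 \<Longrightarrow> i < n \<and> j < n" by (rule ent_bound[of A]) blast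
  have 1: "ent (A * B) i k = (\<Sum>j<n. ent A i j * ent B j k)" for i k
    by (rule ent_mult_bound) (use n in auto)
  have 2: "ent (flev A * flev B) i k = (\<Sum>j<n. ent (flev A) i j * ent (flev B) j k)" for i k
    by (rule ent_mult_bound) (use n in \<open>auto simp: gmap.rep_eq split: if_splits\<close>)
  have 3: "laurent (ent A i j * ent B j k)" "lev (ent A i j * ent B j k) = lev (ent A i j) * lev (ent B j k)" for i j k
    using A B lev_mult by (auto simp: lau_def)
  show ?thesis
    using lev_sum[of "{..<n}" "\<lambda>j. ent A _ j * ent B j _"] 3
    by (auto simp: lau_def 1 intro!: fmat_eqI) (simp add: ent_flev 1 2)
qed

lemma flev_idm: "flev (idm n) = idm n" "lau (idm n)"
  by (auto simp: ent_flev idm.rep_eq lau_def intro!: fmat_eqI)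

definition ev :: "bit poly mat \<Rightarrow> bit fmat" where
  "ev A = fm (map_mat (\<lambda>p. poly p 1) A)"

lemma ent_ev: "ent (ev A) i j = (if i < dim_row A \<and> j < dim_col A then poly (A $$ (i, j)) 1 else 0)"
  by (auto simp: ev_def fm.rep_eq)

lemma dims_ev: "A \<in> carrier_mat m n \<Longrightarrow> dims m n (ev A)"
  unfolding ev_def by (rule dims_fm) simp

lemma flev_loc: "flev (fm (loc A)) = ev A" "lau (fm (loc A))"
  by (auto simp: ent_flev ent_ev fm.rep_eq loc_def lev_tofr lau_def laurent_tofr intro!: fmat_eqI)

text \<open>Conversely, conjugating by the diagonal matrix with entries \<open>U\<close> to the power of the first
  grading turns matrices over the two-element field into matrices over the Laurent polynomials, multiplicatively.\<close>

definition ub :: "bit \<Rightarrow> bit poly fract" where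
  "ub b = (if b = 0 then 0 else 1)"

definition lp :: "int \<Rightarrow> (nat \<Rightarrow> int \<times> int) \<Rightarrow> (nat \<Rightarrow> int \<times> int) \<Rightarrow> bit fmat \<Rightarrow> bit poly fract fmat" where
  "lp s gt gs A = gmap (\<lambda>i j b. ub b * Uf powi (fst (gt i) - fst (gs j) - s)) A"

lemma ub_simps: "ub 0 = 0" "ub 1 = 1" "ub (a * b) = ub a * ub b" "ub (a + b) = ub a + ub b"
  by (cases a; cases b; simp add: ub_def)+

lemma ent_lp: "ent (lp s gt gs A) i j = ub (ent A i j) * Uf powi (fst (gt i) - fst (gs j) - s)"
  by (simp add: lp_def gmap.rep_eq ub_simps)

lemma lp_add: "lp s gt gs (A + B) = lp s gt gs A + lp s gt gs B"
  by (rule fmat_eqI) (simp add: ent_lp ent_simps ub_simps algebra_simps)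

lemma ub_sum: "ub (sum h A) = (\<Sum>i\<in>A. ub (h i))"
  by (induction A rule: infinite_finite_induct) (auto simp: ub_simps)

text \<open>The parameter \<open>s\<close> is the shift of the first grading: degrees add, and the
  exponents telescope through the gradings of the middle complex.\<close>

lemma lp_mult: "lp (s + r) gt gs (A * B) = lp s gt gu A * lp r gu gs B"
proof (rule fmat_eqI)
  fix i k
  obtain n where n: "\<And>i j. ent A i j \<noteq> 0 \<Longrightarrow> i < n \<and> j < n" by (rule ent_bound[of A]) blast
  have 1: "ent (A * B) i k = (\<Sum>j<n. ent A i j * ent B j k)"
    by (rule ent_mult_bound) (use n in auto)
  have 2: "ent (lp s gt gu A * lp r gu gs B) i k = (\<Sum>j<n. ent (lp s gt gu A) i j * ent (lp r gu gs B) j k)"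
    by (rule ent_mult_bound) (use n in \<open>force simp: ent_lp ub_def split: if_splits\<close>)
  have "Uf powi (fst (gt i) - fst (gu j) - s) * Uf powi (fst (gu j) - fst (gs k) - r)
      = Uf powi (fst (gt i) - fst (gs k) - (s + r))" for j
    by (simp add: power_int_add[symmetric] algebra_simps)
  then show "ent (lp (s + r) gt gs (A * B)) i k = ent (lp s gt gu A * lp r gu gs B) i k"
    unfolding 2 unfolding ent_lp 1 ub_sum ub_simps sum_distrib_right
    by (intro sum.cong refl) (metis (no_types, opaque_lifting) mult.assoc mult.left_commute)
qed

lemma lp_idm: "lp 0 g g (idm n) = idm n"
  by (rule fmat_eqI) (auto simp: ent_lp idm.rep_eq ub_simps)

lemma lau_lp: "lau (lp s gt gs A)"
  by (auto simp: lau_def ent_lp ub_def laurent_powi)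

lemma dims_lp: "dims m n A \<Longrightarrow> dims m n (lp s gt gs A)"
  by (auto simp: supp_def ent_lp ub_def split: if_splits)

definition hcar :: "nat \<Rightarrow> nat \<Rightarrow> (nat \<Rightarrow> int \<times> int) \<Rightarrow> (nat \<Rightarrow> int \<times> int) \<Rightarrow> int \<Rightarrow> bit poly mat \<Rightarrow> bool" where
  "hcar m n gt gs s A \<longleftrightarrow> A \<in> carrier_mat m n \<and> hom_mat gt gs (s, 0) A"

lemma hcar_entry:
  assumes "hcar m n gt gs s A" "i < m" "j < n"
  shows "A $$ (i, j) = 0 \<or> (fst (gt i) \<ge> fst (gs j) + s \<and> cls (gt i) = cls (gs j) + 2 * s \<and>
    A $$ (i, j) = monom 1 (nat (fst (gt i) - fst (gs j) - s)))"
proof (cases "A $$ (i, j) = 0")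
  case False
  then obtain k where k: "A $$ (i, j) = monom 1 k" "Ushift (int k) (gt i) = addgr (gs j) (s, 0)"
    using assms unfolding hcar_def hom_mat_def by (metis carrier_matD)
  then have 1: "fst (gt i) - int k = fst (gs j) + s" and 2: "snd (gt i) - 2 * int k = snd (gs j)"
    by (simp_all add: Ushift_def addgr_def)
  have 3: "nat (fst (gt i) - fst (gs j) - s) = k" using 1 by linarith
  show ?thesis unfolding 3 using 1 2 k(1) by (simp add: cls_def)
qed simp

text \<open>A nonzero entry of a homogeneous matrix is the power of U dictated by the gradings, so
  its value at U = 1 loses nothing.\<close>

lemma fm_loc_hcar: assumes "hcar m n gt gs s A" shows "fm (loc A) = lp s gt gs (ev A)"
proof (rule fmat_eqI)
  fix i j
  show "ent (fm (loc A)) i j = ent (lp s gt gs (ev A)) i j"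
  proof (cases "i < m \<and> j < n")
    case True
    then have "i < dim_row A" "j < dim_col A" using assms by (auto simp: hcar_def)
    then show ?thesis
      using hcar_entry[OF assms, of i j] True
      by (auto simp: fm.rep_eq loc_def ent_lp ent_ev tofr_simps ub_simps poly_monom tofr_monom power_int_def)
  next
    case False
    then show ?thesis using assms by (auto simp: hcar_def fm.rep_eq loc_def ent_lp ent_ev ub_simps)
  qed
qed

lemma laurent_mat_iff: "laurent_mat A \<longleftrightarrow> lau (fm A)"
  by (auto simp: laurent_mat_def lau_def fm.rep_eq)

lemma fract_minus: "(x :: bit poly fract) - y = x + y"
  by (simp only: diff_conv_add_uminus fract_uminus)

lemma fmat_fract_minus [simp]: "(A :: bit poly fract fmat) - B = A + B"
  by (rule fmat_eqI) (simp only: ent_minus ent_simps fract_minus)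

lemma lchain_map_iff:
  assumes "ds \<in> carrier_mat n n" "dt \<in> carrier_mat m m"
  shows "lchain_map ds dt f \<longleftrightarrow> f \<in> carrier_mat m n \<and> lau (fm f) \<and> fm dt * fm f = fm f * fm ds"
  by (auto simp: lchain_map_def chain_map_iff[OF assms] laurent_mat_iff)

lemma lhomotopic_iff:
  assumes "ds \<in> carrier_mat n n" "dt \<in> carrier_mat m m" "f \<in> carrier_mat m n" "g \<in> carrier_mat m n"
  shows "lhomotopic ds dt f g \<longleftrightarrow>
    (\<exists>H. dims m n H \<and> lau H \<and> fm f + fm g = fm dt * H + H * fm ds)"
proof
  assume "lhomotopic ds dt f g"
  then obtain H where "H \<in> carrier_mat m n" "laurent_mat H" "f - g = dt * H + H * ds"
    using assms by (auto simp: lhomotopic_def)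
  then show "\<exists>H. dims m n H \<and> lau H \<and> fm f + fm g = fm dt * H + H * fm ds"
    using homotopy_iff[OF assms, of H] by (intro exI[of _ "fm H"]) (auto simp: laurent_mat_iff dims_fm)
next
  assume "\<exists>H. dims m n H \<and> lau H \<and> fm f + fm g = fm dt * H + H * fm ds"
  then obtain H where H: "dims m n H" "lau H" "fm f + fm g = fm dt * H + H * fm ds" by blast
  then have "f - g = dt * mt m n H + mt m n H * ds"
    using homotopy_iff[OF assms, of "mt m n H"] by (simp add: fm_mt)
  then show "lhomotopic ds dt f g"
    using assms H unfolding lhomotopic_def
    by (auto intro!: bexI[of _ "mt m n H"] simp: laurent_mat_iff fm_mt)
qed

lemma flev_homotopy:
  assumes "lau a" "lau b" "lau dt" "lau ds" "lau H" "a + b = dt * H + H * ds"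
  shows "nul (flev dt) (flev ds) (flev a + flev b)"
proof -
  have "flev a + flev b = flev (dt * H + H * ds)" using assms by (simp add: flev_add[symmetric])
  also have "\<dots> = flev dt * flev H + flev H * flev ds" using assms by (simp add: flev_add flev_mult)
  finally show ?thesis by (auto simp: nul_def)
qed

lemma lhtpy_equiv_flev:
  assumes ds: "ds \<in> carrier_mat n n" "lau (fm ds)" and dt: "dt \<in> carrier_mat m m" "lau (fm dt)"
    and "lhtpy_equiv ds dt f"
  shows "f \<in> carrier_mat m n" "lau (fm f)" "ch (flev (fm dt)) (flev (fm ds)) (flev (fm f))"
    "\<exists>k. dims n m k \<and> ch (flev (fm ds)) (flev (fm dt)) k \<and>
     nul (flev (fm ds)) (flev (fm ds)) (k * flev (fm f) + idm n) \<and>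
     nul (flev (fm dt)) (flev (fm dt)) (flev (fm f) * k + idm m)"
proof -
  obtain k where f: "lchain_map ds dt f" and k: "lchain_map dt ds k" "lhomotopic ds ds (k * f) (1\<^sub>m n)"
    "lhomotopic dt dt (f * k) (1\<^sub>m m)"
    using assms by (auto simp: lhtpy_equiv_def)
  have f': "f \<in> carrier_mat m n" "lau (fm f)" "fm dt * fm f = fm f * fm ds"
    using f lchain_map_iff[OF ds(1) dt(1)] by auto
  have k': "k \<in> carrier_mat n m" "lau (fm k)" "fm ds * fm k = fm k * fm dt"
    using k(1) lchain_map_iff[OF dt(1) ds(1)] by auto
  show "f \<in> carrier_mat m n" "lau (fm f)" by (rule f')+
  show "ch (flev (fm dt)) (flev (fm ds)) (flev (fm f))"
    unfolding ch_def using flev_mult[OF dt(2) f'(2)] flev_mult[OF f'(2) ds(2)] f'(3) by simp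
  have kf: "k * f \<in> carrier_mat n n" "f * k \<in> carrier_mat m m" using f' k' by auto
  obtain H where H: "lau H" "fm (k * f) + fm (1\<^sub>m n) = fm ds * H + H * fm ds"
    using k(2) lhomotopic_iff[OF ds(1) ds(1) kf(1) one_carrier_mat] by auto
  have "nul (flev (fm ds)) (flev (fm ds)) (flev (fm (k * f)) + flev (fm (1\<^sub>m n)))"
    using f' k' by (intro flev_homotopy[OF _ _ ds(2) ds(2) H]) (simp_all add: fm_mult fm_one flev_idm flev_mult)
  then have 1: "nul (flev (fm ds)) (flev (fm ds)) (flev (fm k) * flev (fm f) + idm n)"
    using f' k' by (simp add: fm_mult fm_one flev_idm flev_mult)
  obtain H where H: "lau H" "fm (f * k) + fm (1\<^sub>m m) = fm dt * H + H * fm dt"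
    using k(3) lhomotopic_iff[OF dt(1) dt(1) kf(2) one_carrier_mat] by auto
  have "nul (flev (fm dt)) (flev (fm dt)) (flev (fm (f * k)) + flev (fm (1\<^sub>m m)))"
    using f' k' by (intro flev_homotopy[OF _ _ dt(2) dt(2) H]) (simp_all add: fm_mult fm_one flev_idm flev_mult)
  then have 2: "nul (flev (fm dt)) (flev (fm dt)) (flev (fm f) * flev (fm k) + idm m)"
    using f' k' by (simp add: fm_mult fm_one flev_idm flev_mult)
  have 3: "ch (flev (fm ds)) (flev (fm dt)) (flev (fm k))"
    unfolding ch_def using flev_mult[OF ds(2) k'(2)] flev_mult[OF k'(2) dt(2)] k'(3) by simp
  have "dims n m (flev (fm k))"
    using dims_fm[OF k'(1)] by (auto simp: supp_def gmap.rep_eq split: if_splits)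
  with 1 2 3 show "\<exists>k. dims n m k \<and> ch (flev (fm ds)) (flev (fm dt)) k \<and>
     nul (flev (fm ds)) (flev (fm ds)) (k * flev (fm f) + idm n) \<and>
     nul (flev (fm dt)) (flev (fm dt)) (flev (fm f) * k + idm m)" by blast
qed

lemma loc_carrier: "A \<in> carrier_mat m n \<Longrightarrow> loc A \<in> carrier_mat m n"
  by (simp add: loc_def)

text \<open>The inverse and the homotopies over the two-element field are lifted by
  \<open>lp\<close>: degree 0 for the inverse and degree 1 for the homotopies, which offsets the
  degree -1 of the differentials. Powers of U in the lifts may be negative, which is harmless after
  inverting U.\<close>

lemma hequiv_imp_lhtpy_equiv:
  assumes C: "hcar n n g g (-1) dC" and D: "hcar m m g' g' (-1) dD" and f: "hcar m n g' g 0 f"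
    and "hequiv m (ev dD) n (ev dC) (ev f)"
  shows "lhtpy_equiv (loc dC) (loc dD) (loc f)"
proof -
  have car: "loc dC \<in> carrier_mat n n" "loc dD \<in> carrier_mat m m" "loc f \<in> carrier_mat m n"
    using C D f by (auto simp: hcar_def intro: loc_carrier)
  note fl = fm_loc_hcar[OF C] fm_loc_hcar[OF D] fm_loc_hcar[OF f]
  obtain k where k: "ch (ev dD) (ev dC) (ev f)" "dims n m k" "ch (ev dC) (ev dD) k"
    "nul (ev dC) (ev dC) (k * ev f + idm n)" "nul (ev dD) (ev dD) (ev f * k + idm m)"
    using assms(4) by (auto simp: hequiv_def)
  have dms: "dims n n (ev dC)" "dims m m (ev dD)" "dims m n (ev f)"
    using C D f by (auto simp: hcar_def intro: dims_ev)
  obtain H1 where H1: "dims n n H1" "k * ev f + idm n = ev dC * H1 + H1 * ev dC"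
    by (rule nul_dims[OF supp_add[OF dims_mult[OF k(2) dms(3)] dims_idm] dms(1) dms(1) k(4)])
  obtain H2 where H2: "dims m m H2" "ev f * k + idm m = ev dD * H2 + H2 * ev dD"
    by (rule nul_dims[OF supp_add[OF dims_mult[OF dms(3) k(2)] dims_idm] dms(2) dms(2) k(5)])
  let ?k = "mt n m (lp 0 g g' k)"
  have fk: "fm ?k = lp 0 g g' k" by (rule fm_mt[OF dims_lp[OF k(2)]])
  have "lp (-1 + 0) g' g (ev dD * ev f) = lp (0 + -1) g' g (ev f * ev dC)"
    using k(1) by (simp add: ch_def)
  then have c1: "lchain_map (loc dC) (loc dD) (loc f)"
    using car flev_loc(2) unfolding lchain_map_iff[OF car(1,2)] fl lp_mult[of "-1" 0 g' g _ _ g'] lp_mult[of 0 "-1" g' g _ _ g]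
    by (auto simp: fl[symmetric])
  have "lp (-1 + 0) g g' (ev dC * k) = lp (0 + -1) g g' (k * ev dD)"
    using k(3) by (simp add: ch_def)
  then have c2: "lchain_map (loc dD) (loc dC) ?k"
    unfolding lchain_map_iff[OF car(2,1)] fl fk lp_mult[of "-1" 0 g g' _ _ g] lp_mult[of 0 "-1" g g' _ _ g']
    by (auto simp: lau_lp)
  have "lp 0 g g (k * ev f + idm n) = lp 0 g g (ev dC * H1 + H1 * ev dC)" by (simp only: H1)
  then have e1: "lp 0 g g' k * lp 0 g' g (ev f) + idm n = lp (-1) g g (ev dC) * lp 1 g g H1 + lp 1 g g H1 * lp (-1) g g (ev dC)"
    using lp_mult[of 0 0 g g k "ev f" g'] lp_mult[of "-1" 1 g g "ev dC" H1 g] lp_mult[of 1 "-1" g g H1 "ev dC" g]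
    by (simp add: lp_add lp_idm)
  have "lp 0 g' g' (ev f * k + idm m) = lp 0 g' g' (ev dD * H2 + H2 * ev dD)" by (simp only: H2)
  then have e2: "lp 0 g' g (ev f) * lp 0 g g' k + idm m = lp (-1) g' g' (ev dD) * lp 1 g' g' H2 + lp 1 g' g' H2 * lp (-1) g' g' (ev dD)"
    using lp_mult[of 0 0 g' g' "ev f" k g] lp_mult[of "-1" 1 g' g' "ev dD" H2 g'] lp_mult[of 1 "-1" g' g' H2 "ev dD" g']
    by (simp add: lp_add lp_idm)
  have kc: "?k \<in> carrier_mat n m" by simp
  have h1: "lhomotopic (loc dC) (loc dC) (?k * loc f) (1\<^sub>m n)"
    unfolding lhomotopic_iff[OF car(1) car(1) mult_carrier_mat[OF kc car(3)] one_carrier_mat]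
      fm_mult[OF kc car(3)] fm_one fl fk
    by (intro exI[of _ "lp 1 g g H1"]) (simp add: dims_lp[OF H1(1)] lau_lp e1)
  have h2: "lhomotopic (loc dD) (loc dD) (loc f * ?k) (1\<^sub>m m)"
    unfolding lhomotopic_iff[OF car(2) car(2) mult_carrier_mat[OF car(3) kc] one_carrier_mat]
      fm_mult[OF car(3) kc] fm_one fl fk
    by (intro exI[of _ "lp 1 g' g' H2"]) (simp add: dims_lp[OF H2(1)] lau_lp e2)
  show ?thesis
    unfolding lhtpy_equiv_def using c1 c2 h1 h2 car by (auto intro!: exI[of _ ?k])
qed

lemma lhtpy_equiv_iff:
  assumes C: "hcar n n g g (-1) dC" and D: "hcar m m g' g' (-1) dD" and f: "hcar m n g' g 0 f"
  shows "lhtpy_equiv (loc dC) (loc dD) (loc f) \<longleftrightarrow> hequiv m (ev dD) n (ev dC) (ev f)"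
proof
  assume l: "lhtpy_equiv (loc dC) (loc dD) (loc f)"
  have car: "loc dC \<in> carrier_mat n n" "loc dD \<in> carrier_mat m m"
    using C D by (auto simp: hcar_def intro: loc_carrier)
  from lhtpy_equiv_flev[OF car(1) flev_loc(2) car(2) flev_loc(2) l]
  show "hequiv m (ev dD) n (ev dC) (ev f)" by (auto simp: hequiv_def flev_loc)
qed (rule hequiv_imp_lhtpy_equiv[OF assms])

text \<open>The homotopy inverse in the hypothesis need not be homogeneous. Cutting it and the
  homotopy down to the right classes keeps all identities, because \<open>F\<close> lies in class 0
  and the differential shifts \<open>cls\<close> by exactly 2.\<close>

lemma loc_tower_imp_tower:
  assumes C: "hcar (rk C) (rk C) (gr C) (gr C) (-1) (dif C)" and t: "loc_tower C"
  obtains F G where "tower (rk C) (ev (dif C)) F G" "supp (\<lambda>i j. cls (gr C i) = 0) F"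
    "supp (\<lambda>i j. cls (gr C j) = 0) G"
proof -
  let ?n = "rk C" and ?d = "ev (dif C)" and ?g = "gr C"
  obtain f where f: "lhom_mat ?g (\<lambda>_. (0, 0)) (0, 0) f" "lhtpy_equiv (0\<^sub>m 1 1) (loc (dif C)) f"
    using t by (auto simp: loc_tower_def)
  have car: "loc (dif C) \<in> carrier_mat ?n ?n" using C by (simp add: hcar_def loc_carrier)
  have z: "fm (0\<^sub>m 1 1 :: bit poly fract mat) = 0" by (rule fm_zero)
  have fz: "flev 0 = 0" by (rule fmat_eqI) (simp add: ent_flev ent_simps)
  have lz: "lau (fm (0\<^sub>m 1 1))" unfolding z by (simp add: lau_def ent_simps)
  define F where "F = flev (fm f)"
  have fc: "f \<in> carrier_mat ?n 1" and chF: "ch ?d 0 F" and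
    ex: "\<exists>k. dims 1 ?n k \<and> ch 0 ?d k \<and> nul 0 0 (k * F + idm 1) \<and> nul ?d ?d (F * k + idm ?n)"
    using lhtpy_equiv_flev[OF zero_carrier_mat lz car flev_loc(2) f(2)]
    by (simp_all add: F_def fm_zero fz flev_loc)
  obtain k where k: "dims 1 ?n k" "ch 0 ?d k" "nul 0 0 (k * F + idm 1)" "nul ?d ?d (F * k + idm ?n)"
    using ex by blast
  \<comment> \<open>Over zero differentials a null homotopic map is zero.\<close>
  have kF: "k * F = idm 1" using k(3) by (simp add: nul_def fmat_add_eq_0_iff)
  have dF: "dims ?n 1 F" unfolding F_def
    using dims_fm[OF fc] by (auto simp: supp_def gmap.rep_eq split: if_splits)
  have sF: "supp (\<lambda>i j. cls (?g i) = 0) F"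
    unfolding supp_def
  proof (intro allI impI)
    fix i j assume "ent F i j \<noteq> 0"
    then have "ent (fm f) i j \<noteq> 0" by (auto simp: F_def ent_flev)
    then have "i < dim_row f" "j < dim_col f" "f $$ (i, j) \<noteq> 0" by (auto simp: fm.rep_eq split: if_splits)
    then obtain k where "Ushift k (?g i) = addgr (0, 0) (0, 0)"
      using f(1) unfolding lhom_mat_def by blast
    then show "cls (?g i) = 0" by (auto simp: Ushift_def addgr_def cls_def)
  qed
  have sd: "supp (\<lambda>i j. cls (?g i) = cls (?g j) - 2) ?d"
    unfolding supp_def
  proof (intro allI impI)
    fix i j assume a: "ent ?d i j \<noteq> 0"
    then have "i < ?n" "j < ?n" using C by (auto simp: ent_ev hcar_def split: if_splits)
    then show "cls (?g i) = cls (?g j) - 2"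
      using hcar_entry[OF C, of i j] a C by (auto simp: ent_ev hcar_def split: if_splits)
  qed
  define G where "G = restr (\<lambda>i j. cls (?g j) = 0) k"
  have GF: "G * F = idm 1"
  proof -
    have "restr (\<lambda>_ _. True) (k * F) = G * F"
      unfolding G_def by (rule restr_mult_right[OF sF]) auto
    moreover have "restr (\<lambda>_ _. True) (k * F) = k * F" by (rule restr_ident) (simp add: supp_def)
    ultimately show ?thesis by (simp add: kF)
  qed
  have Gd: "G * ?d = 0"
  proof -
    have "restr (\<lambda>i j. cls (?g j) = 2) (k * ?d) = G * ?d"
      unfolding G_def by (rule restr_mult_right[OF sd]) auto
    moreover have "k * ?d = 0" using k(2) by (simp add: ch_def)
    ultimately show ?thesis by simp
  qed
  obtain H where H: "F * k + idm ?n = ?d * H + H * ?d" using k(4) by (auto simp: nul_def)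
  let ?R = "\<lambda>i j. cls (?g i) = cls (?g j)" and ?S = "\<lambda>i j. cls (?g i) = cls (?g j) + 2"
  have "restr ?R (F * k) = F * G" unfolding G_def by (rule restr_mult_left[OF sF]) auto
  moreover have "restr ?R (idm ?n) = (idm ?n :: bit fmat)"
    by (rule restr_ident) (auto simp: supp_def idm.rep_eq split: if_splits)
  moreover have "restr ?R (?d * H) = ?d * restr ?S H" by (rule restr_mult_left[OF sd]) auto
  moreover have "restr ?R (H * ?d) = restr ?S H * ?d" by (rule restr_mult_right[OF sd]) auto
  ultimately have "idm ?n + F * G = ?d * restr ?S H + restr ?S H * ?d"
    using arg_cong[OF H, of "restr ?R"] by (simp add: restr_add add.commute)
  then have nG: "nul ?d ?d (idm ?n + F * G)" by (auto simp: nul_def)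
  have dG: "dims 1 ?n G" unfolding G_def
    by (rule supp_mono[OF supp_restr[OF k(1)]]) simp
  have "?d * F = 0" using chF by (simp add: ch_def)
  then have "tower ?n ?d F G" unfolding tower_def using dF dG GF Gd nG by simp
  then show ?thesis
    by (rule that[OF _ sF]) (auto simp: G_def supp_def restr.rep_eq split: if_splits)
qed

section \<open>Translation between complexes over the polynomial ring and their values at U =
  1\<close>

abbreviation gcar :: "cx \<Rightarrow> bool" where
  "gcar C \<equiv> hcar (rk C) (rk C) (gr C) (gr C) (-1) (dif C)"

lemma hat_carrier:
  assumes "gcar C"
  shows "hatd C \<in> carrier_mat (rk C) (rk C)" "hPhi C \<in> carrier_mat (rk C) (rk C)"
  using assms by (auto simp: hcar_def hatd_def hPhi_def hatm_def Phi_def)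

text \<open>The derivative of a power of U has a nonzero constant term only for U itself. Modulo U,
  \<Phi> is therefore the coefficient of U in the differential, which is its part of weight
  0.\<close>

lemma fm_hat:
  assumes "gcar C"
  shows "fm (hatd C) = dhat (gr C) (ev (dif C))" "fm (hPhi C) = Phat (gr C) (ev (dif C))"
proof -
  have car: "dif C \<in> carrier_mat (rk C) (rk C)" using assms by (simp add: hcar_def)
  have "ent (fm (hatd C)) i j = ent (dhat (gr C) (ev (dif C))) i j \<and>
      ent (fm (hPhi C)) i j = ent (Phat (gr C) (ev (dif C))) i j" for i j
  proof (cases "i < rk C \<and> j < rk C")
    case True
    then have ij: "i < rk C" "j < rk C" by auto
    have c: "coeff (pderiv (monom (1::bit) k)) 0 = (if k = 1 then 1 else 0)" for k
      by (cases k) (auto simp: coeff_pderiv)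
    show ?thesis
      using hcar_entry[OF assms ij] car ij
      by (auto simp: fm.rep_eq hatd_def hPhi_def hatm_def Phi_def wp_def restr.rep_eq ent_ev poly_monom c nat_eq_iff)
  next
    case False
    then show ?thesis
      using car by (auto simp: fm.rep_eq hatd_def hPhi_def hatm_def Phi_def wp_def restr.rep_eq ent_ev)
  qed
  then show "fm (hatd C) = dhat (gr C) (ev (dif C))" "fm (hPhi C) = Phat (gr C) (ev (dif C))"
    by (auto intro: fmat_eqI)
qed

lemma hcar_supp:
  assumes "hcar m n gt gs s A"
  shows "supp (\<lambda>i j. cls (gt i) = cls (gs j) + 2 * s \<and> fst (gt i) \<ge> fst (gs j) + s) (ev A)"
  unfolding supp_def
proof (intro allI impI)
  fix i j assume a: "ent (ev A) i j \<noteq> 0"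
  then have "i < m" "j < n" "A $$ (i, j) \<noteq> 0" using assms by (auto simp: ent_ev hcar_def split: if_splits)
  then show "cls (gt i) = cls (gs j) + 2 * s \<and> fst (gt i) \<ge> fst (gs j) + s"
    using hcar_entry[OF assms] by blast
qed

lemma is_complex_gcx:
  assumes "is_complex C"
  shows "gcar C" "gcx (rk C) (gr C) (ev (dif C))"
proof -
  let ?d = "ev (dif C)"
  show h: "gcar C" using assms by (simp add: is_complex_def hcar_def)
  have car: "dif C \<in> carrier_mat (rk C) (rk C)" "loc (dif C) \<in> carrier_mat (rk C) (rk C)"
    using h by (auto simp: hcar_def loc_carrier)
  have "?d * ?d = 0"
  proof (rule fmat_eqI)
    fix i k
    have "ent (?d * ?d) i k = (\<Sum>j<rk C. ent ?d i j * ent ?d j k)"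
      by (rule ent_mult_bound) (use car in \<open>auto simp: ent_ev split: if_splits\<close>)
    also have "\<dots> = (if i < rk C \<and> k < rk C then poly ((dif C * dif C) $$ (i, k)) 1 else 0)"
      using car by (auto simp: ent_ev scalar_prod_def poly_sum lessThan_atLeast0 intro!: sum.cong)
    also have "\<dots> = 0" using assms by (auto simp: is_complex_def)
    finally show "ent (?d * ?d) i k = ent 0 i k" by (simp add: ent_simps)
  qed
  moreover have "supp (\<lambda>i j. cls (gr C i) = cls (gr C j) - 2 \<and> fst (gr C i) \<ge> fst (gr C j) - 1) ?d"
    by (rule supp_mono[OF hcar_supp[OF h]]) auto
  ultimately show "gcx (rk C) (gr C) ?d"
    using dims_ev[OF car(1)] by (simp add: gcx_def)
qed

lemma fm_hatm:
  assumes "hcar m n g' g 0 f"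
  shows "fm (hatm f) = wp g' g 0 (ev f)"
proof (rule fmat_eqI)
  fix i j
  show "ent (fm (hatm f)) i j = ent (wp g' g 0 (ev f)) i j"
  proof (cases "i < m \<and> j < n")
    case True
    then show ?thesis
      using hcar_entry[OF assms, of i j] assms
      by (auto simp: hcar_def fm.rep_eq hatm_def wp_def restr.rep_eq ent_ev poly_monom)
  next
    case False
    then show ?thesis
      using assms by (auto simp: hcar_def fm.rep_eq hatm_def wp_def restr.rep_eq ent_ev)
  qed
qed

text \<open>One direction evaluates at U = 1. For the other, both products are
  \<open>lp (-1)\<close> of their evaluations, hence agree over the fraction field, into which
  polynomials embed.\<close>

lemma chain_map_hcar_iff:
  assumes C: "gcar C" and D: "gcar D" and f: "hcar (rk D) (rk C) (gr D) (gr C) 0 f"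
  shows "chain_map (dif C) (dif D) f \<longleftrightarrow> ch (ev (dif D)) (ev (dif C)) (ev f)"
proof
  have car: "dif C \<in> carrier_mat (rk C) (rk C)" "dif D \<in> carrier_mat (rk D) (rk D)" "f \<in> carrier_mat (rk D) (rk C)"
    using C D f by (auto simp: hcar_def)
  have lm: "loc (A * B) = loc A * loc B" if "A \<in> carrier_mat m n" "B \<in> carrier_mat n k" for A B m n k
  proof (rule eq_matI)
    fix i j assume "i < dim_row (loc A * loc B)" "j < dim_col (loc A * loc B)"
    then have ij: "i < m" "j < k" using that by (auto simp: loc_def)
    have "tofr (sum h S) = (\<Sum>x\<in>S. tofr (h x))" for h and S :: "nat set"
      by (induction S rule: infinite_finite_induct) (auto simp: tofr_simps)
    then show "loc (A * B) $$ (i, j) = (loc A * loc B) $$ (i, j)"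
      using that ij by (simp add: loc_def scalar_prod_def tofr_simps)
  qed (use that in \<open>auto simp: loc_def\<close>)
  have linj: "A = B" if "loc A = loc B" for A B
  proof (rule eq_matI)
    show d: "dim_row A = dim_row B" "dim_col A = dim_col B"
      using arg_cong[OF that, of dim_row] arg_cong[OF that, of dim_col] by (simp_all add: loc_def)
    fix i j assume "i < dim_row B" "j < dim_col B"
    then show "A $$ (i, j) = B $$ (i, j)"
      using arg_cong[OF that, of "\<lambda>M. M $$ (i, j)"] d by (simp add: loc_def)
  qed
  have eq: "dif D * f = f * dif C \<longleftrightarrow> fm (loc (dif D)) * fm (loc f) = fm (loc f) * fm (loc (dif C))"
    using fm_mult_eq_iff[OF loc_carrier[OF car(2)] loc_carrier[OF car(3)] loc_carrier[OF car(3)] loc_carrier[OF car(1)]]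
      lm[OF car(2,3)] lm[OF car(3,1)] linj[of "dif D * f" "f * dif C"] by metis
  have l: "fm (loc (dif D)) * fm (loc f) = lp (-1) (gr D) (gr C) (ev (dif D) * ev f)"
    "fm (loc f) * fm (loc (dif C)) = lp (-1) (gr D) (gr C) (ev f * ev (dif C))"
    unfolding fm_loc_hcar[OF C] fm_loc_hcar[OF D] fm_loc_hcar[OF f]
    using lp_mult[of "-1" 0 "gr D" "gr C" "ev (dif D)" "ev f" "gr D"]
      lp_mult[of 0 "-1" "gr D" "gr C" "ev f" "ev (dif C)" "gr C"] by simp_all
  {
    assume "chain_map (dif C) (dif D) f"
    then have "flev (fm (loc (dif D)) * fm (loc f)) = flev (fm (loc f) * fm (loc (dif C)))"
      using eq by (simp add: chain_map_def)
    then show "ch (ev (dif D)) (ev (dif C)) (ev f)"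
      using flev_mult[OF flev_loc(2) flev_loc(2)] by (simp add: ch_def flev_loc(1))
  next
    assume "ch (ev (dif D)) (ev (dif C)) (ev f)"
    then show "chain_map (dif C) (dif D) f"
      using car eq l by (simp add: ch_def chain_map_def)
  }
qed

definition local_at_cx :: "cx \<times> bit mat \<Rightarrow> cx \<times> bit mat \<Rightarrow> bit fmat \<Rightarrow> bool" where
  "local_at_cx Ci Di f \<longleftrightarrow> local_at (rk (fst Di)) (gr (fst Di)) (ev (dif (fst Di))) (fm (snd Di))
     (rk (fst Ci)) (gr (fst Ci)) (ev (dif (fst Ci))) (fm (snd Ci)) f"

lemma local_map_iff:
  assumes C: "gcar C" "\<iota>C \<in> carrier_mat (rk C) (rk C)" and D: "gcar D" "\<iota>D \<in> carrier_mat (rk D) (rk D)"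
    and f: "hcar (rk D) (rk C) (gr D) (gr C) 0 f"
  shows "local_map (C, \<iota>C) (D, \<iota>D) f \<longleftrightarrow> local_at_cx (C, \<iota>C) (D, \<iota>D) (ev f)"
proof -
  have fc: "f \<in> carrier_mat (rk D) (rk C)" "hom_mat (gr D) (gr C) (0, 0) f" using f by (auto simp: hcar_def)
  have hf: "hatm f \<in> carrier_mat (rk D) (rk C)" using fc by (simp add: hatm_def)
  have "graded (gr D) (gr C) (ev f)"
    unfolding graded_def by (rule supp_mono[OF hcar_supp[OF f]]) auto
  moreover have "homotopic (hatd C) (hatd D) (\<iota>D * hatm f) (hatm f * \<iota>C) \<longleftrightarrow>
    nul (dhat (gr D) (ev (dif D))) (dhat (gr C) (ev (dif C)))
      (fm \<iota>D * wp (gr D) (gr C) 0 (ev f) + wp (gr D) (gr C) 0 (ev f) * fm \<iota>C)"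
    using homotopic_iff_nul[OF hat_carrier(1)[OF C(1)] hat_carrier(1)[OF D(1)] mult_carrier_mat[OF D(2) hf]
        mult_carrier_mat[OF hf C(2)]]
    by (simp add: fm_hat[OF C(1)] fm_hat[OF D(1)] fm_mult[OF D(2) hf] fm_mult[OF hf C(2)] fm_hatm[OF f])
  moreover have "hequiv (rk D) (ev (dif D)) (rk C) (ev (dif C)) (ev f) \<Longrightarrow> ch (ev (dif D)) (ev (dif C)) (ev f)"
    by (simp add: hequiv_def)
  ultimately show ?thesis
    unfolding local_map_def Let_def fst_conv snd_conv local_at_cx_def local_at_def
      chain_map_hcar_iff[OF C(1) D(1) f] lhtpy_equiv_iff[OF C(1) D(1) f]
    using dims_ev[OF fc(1)] fc(2) by blast
qed

lemma loc_le_iff: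
  assumes C: "gcar C" "\<iota>C \<in> carrier_mat (rk C) (rk C)" and D: "gcar D" "\<iota>D \<in> carrier_mat (rk D) (rk D)"
  shows "loc_le (C, \<iota>C) (D, \<iota>D) \<longleftrightarrow> (\<exists>f. local_at_cx (C, \<iota>C) (D, \<iota>D) f)"
proof
  assume "loc_le (C, \<iota>C) (D, \<iota>D)"
  then obtain f where f: "local_map (C, \<iota>C) (D, \<iota>D) f" by (auto simp: loc_le_def)
  then have "hcar (rk D) (rk C) (gr D) (gr C) 0 f"
    using C D by (auto simp: local_map_def Let_def chain_map_def hcar_def)
  then show "\<exists>f. local_at_cx (C, \<iota>C) (D, \<iota>D) f"
    using f local_map_iff[OF C D] by blast
next
  assume "\<exists>f. local_at_cx (C, \<iota>C) (D, \<iota>D) f"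
  then obtain b where b: "local_at_cx (C, \<iota>C) (D, \<iota>D) b" by blast
  then have d: "dims (rk D) (rk C) b" and g: "graded (gr D) (gr C) b"
    by (auto simp: local_at_cx_def local_at_def)
  \<comment> \<open>Inverse of evaluation: the gradings prescribe the exponent of U for each nonzero
    entry, and gradedness of \<open>b\<close> makes it nonnegative, so that \<open>nat\<close> loses
    nothing.\<close>
  define f where "f = mat (rk D) (rk C) (\<lambda>(i, j). if ent b i j = 0 then 0
      else monom (1 :: bit) (nat (fst (gr D i) - fst (gr C j))))"
  have "hom_mat (gr D) (gr C) (0, 0) f"
    unfolding hom_mat_def
  proof (intro allI impI)
    fix i j assume ij: "i < dim_row f" "j < dim_col f" "f $$ (i, j) \<noteq> 0"
    then have nz: "ent b i j \<noteq> 0" by (auto simp: f_def)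
    then have "cls (gr D i) = cls (gr C j)" "fst (gr D i) \<ge> fst (gr C j)"
      using g by (auto simp: graded_def supp_def)
    then show "\<exists>k. f $$ (i, j) = monom 1 k \<and> Ushift (int k) (gr D i) = addgr (gr C j) (0, 0)"
      using ij nz by (intro exI[of _ "nat (fst (gr D i) - fst (gr C j))"])
        (auto simp: f_def Ushift_def addgr_def cls_def prod_eq_iff)
  qed
  then have f: "hcar (rk D) (rk C) (gr D) (gr C) 0 f" by (simp add: hcar_def f_def)
  have "ev f = b"
  proof (rule fmat_eqI)
    fix i j
    have "ent b i j \<noteq> 0 \<Longrightarrow> i < rk D \<and> j < rk C \<and> ent b i j = 1"
      using d by (auto simp: supp_def bit_not_zero_iff)
    then show "ent (ev f) i j = ent b i j"
      by (cases "ent b i j = 0") (auto simp: ent_ev f_def poly_monom)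
  qed
  then have "local_map (C, \<iota>C) (D, \<iota>D) f" using b local_map_iff[OF C D f] by simp
  then show "loc_le (C, \<iota>C) (D, \<iota>D)" by (auto simp: loc_le_def)
qed

lemma almost_iotaK_iotacx:
  assumes "almost_iotaK C \<iota>"
  obtains F G where "iotacx (rk C) (gr C) (ev (dif C)) (fm \<iota>) F G"
proof -
  let ?c = "ev (dif C)"
  let ?M = "carrier_mat (rk C) (rk C)"
  note A = assms[unfolded almost_iotaK_def]
  have gx: "gcar C" "gcx (rk C) (gr C) ?c" using is_complex_gcx A by blast+
  have hc: "hatd C \<in> ?M" "hPhi C \<in> ?M"
    "\<iota> \<in> ?M"
    using hat_carrier[OF gx(1)] A by auto
  obtain F G where FG: "tower (rk C) ?c F G" "supp (\<lambda>i j. cls (gr C i) = 0) F"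
    "supp (\<lambda>i j. cls (gr C j) = 0) G"
    by (rule loc_tower_imp_tower[OF gx(1)]) (use A in blast)+
  have mm: "fm (X * Y) = fm X * fm Y" if "X \<in> ?M" "Y \<in> ?M" for X Y :: "bit mat"
    by (rule fm_mult[OF that])
  have aa: "fm (X + Y) = fm X + fm Y" if "X \<in> ?M" "Y \<in> ?M" for X Y :: "bit mat"
    by (rule fm_add[OF that])
  have cc: "X * Y \<in> ?M" "X + Y \<in> ?M"
    if "X \<in> ?M" "Y \<in> ?M" for X Y :: "bit mat"
    using that by auto
  note hn = homotopic_iff_nul[OF hc(1) hc(1)]
  have n1: "nul (fm (hatd C)) (fm (hatd C)) (fm (hPhi C) * fm \<iota> * fm (hPhi C) * fm \<iota> + fm \<iota> * fm (hPhi C) * fm \<iota> * fm (hPhi C))"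
    using A hn[of "hPhi C * \<iota> * hPhi C * \<iota>" "\<iota> * hPhi C * \<iota> * hPhi C"] by (simp add: mm cc hc)
  have n2: "nul (fm (hatd C)) (fm (hatd C)) (fm \<iota> * fm \<iota> + idm (rk C) + fm (hPhi C) * fm \<iota> * fm (hPhi C) * fm \<iota>)"
    using A hn[of "\<iota> * \<iota>" "1\<^sub>m (rk C) + hPhi C * \<iota> * hPhi C * \<iota>"] by (simp add: mm aa cc hc fm_one add.assoc)
  have "chain_map (hatd C) (hatd C) \<iota>" using A by (simp add: htpy_equiv_def)
  then have c: "ch (fm (hatd C)) (fm (hatd C)) (fm \<iota>)"
    using chain_map_iff[OF hc(1) hc(1)] by (simp add: ch_def)
  have "hatcx (rk C) (dhat (gr C) ?c) (Phat (gr C) ?c) (fm \<iota>)"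
    unfolding hatcx_def using hat_relations[OF gx(2)] n1 n2 c dims_fm[OF hc(3)]
    by (simp add: fm_hat[OF gx(1)])
  moreover have "supp (\<lambda>i j. gr C i = skew (gr C j)) (fm \<iota>)"
    using A by (auto simp: skew_graded_def supp_def fm.rep_eq split: if_splits)
  ultimately have "iotacx (rk C) (gr C) ?c (fm \<iota>) F G"
    unfolding iotacx_def using gx(2) FG by simp
  then show ?thesis by (rule that)
qed

section \<open>Identification of the tensor product with C_E\<close>

lemma ent_inj5_mult:
  assumes "e < 5"
  shows "ent (inj5 n e * X) r c = (if r mod 5 = e \<and> r div 5 < n then ent X (r div 5) c else 0)"
proof -
  have eq: "r = j * 5 + e \<longleftrightarrow> j = r div 5 \<and> r mod 5 = e" for j using assms by auto
  have "ent (inj5 n e * X) r c = (\<Sum>j<n. ent (inj5 n e) r j * ent X j c)"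
    by (rule ent_mult_bound) (auto simp: inj5.rep_eq split: if_splits)
  also have "\<dots> = (\<Sum>j<n. if j = r div 5 then (if r mod 5 = e then ent X (r div 5) c else 0) else 0)"
    by (rule sum.cong[OF refl]) (simp add: inj5.rep_eq eq)
  also have "\<dots> = (if r mod 5 = e \<and> r div 5 < n then ent X (r div 5) c else 0)"
    by (subst sum.delta) auto
  finally show ?thesis .
qed

lemma ent_mult_prj5:
  assumes "e < 5"
  shows "ent (X * prj5 n e) r c = (if c mod 5 = e \<and> c div 5 < n then ent X r (c div 5) else 0)"
proof -
  have eq: "c = j * 5 + e \<longleftrightarrow> j = c div 5 \<and> c mod 5 = e" for j using assms by auto
  have "ent (X * prj5 n e) r c = (\<Sum>j<n. ent X r j * ent (prj5 n e) j c)"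
    by (rule ent_mult_bound') (auto simp: prj5.rep_eq split: if_splits)
  also have "\<dots> = (\<Sum>j<n. if j = c div 5 then (if c mod 5 = e then ent X r (c div 5) else 0) else 0)"
    by (rule sum.cong[OF refl]) (simp add: prj5.rep_eq eq)
  also have "\<dots> = (if c mod 5 = e \<and> c div 5 < n then ent X r (c div 5) else 0)"
    by (subst sum.delta) auto
  finally show ?thesis .
qed

lemma ent_inj5_prj5:
  assumes "dims n n A" "e < 5" "e' < 5"
  shows "ent (inj5 n e * A * prj5 n e') r c = (if r mod 5 = e \<and> c mod 5 = e' then ent A (r div 5) (c div 5) else 0)"
proof -
  have "\<not> (r div 5 < n \<and> c div 5 < n) \<Longrightarrow> ent A (r div 5) (c div 5) = 0" using assms(1) by (auto simp: supp_def)
  then show ?thesis by (auto simp: ent_mult_prj5[OF assms(3)] ent_inj5_mult[OF assms(2)])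
qed

lemma fm_kron5:
  assumes A: "A \<in> carrier_mat n n" and B: "B \<in> carrier_mat 5 5"
  shows "ent (fm (kron A B)) r c = ent (fm A) (r div 5) (c div 5) * (B $$ (r mod 5, c mod 5) :: bit)"
proof -
  have "r < n * 5 \<longleftrightarrow> r div 5 < n" for r by (simp add: less_mult_imp_div_less div_less_iff_less_mult)
  then show ?thesis using A B by (auto simp: fm.rep_eq kron_def)
qed

lemma less5: "e < 5 \<longleftrightarrow> e = 0 \<or> e = 1 \<or> e = 2 \<or> e = 3 \<or> e = (4 :: nat)"
  by linarith

lemma inj5_prj5_idm: "e < 5 \<Longrightarrow> inj5 n e * prj5 n e' = inj5 n e * idm n * prj5 n e'"
  by (simp add: mult_idm[OF dims_inj5])

lemma ent_T_d:
  assumes "dims n n d"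
  shows "ent (T_d n d) r c = (if r mod 5 = c mod 5 then ent d (r div 5) (c div 5) else 0)
    + (if r mod 5 = 1 \<and> c mod 5 = 0 \<or> r mod 5 = 3 \<and> c mod 5 = 2 then ent (idm n) (r div 5) (c div 5) else 0)"
proof -
  define a b where "a = r mod 5" and "b = c mod 5"
  have ab: "a = 0 \<or> a = 1 \<or> a = 2 \<or> a = 3 \<or> a = 4" "b = 0 \<or> b = 1 \<or> b = 2 \<or> b = 3 \<or> b = 4"
    unfolding less5[symmetric] a_def b_def by simp_all
  have e: "ent (inj5 n e * X * prj5 n e') r c = (if a = e \<and> b = e' then ent X (r div 5) (c div 5) else 0)"
    if "e < 5" "e' < 5" "dims n n X" for e e' and X :: "bit fmat"
    using that by (simp add: ent_inj5_prj5 a_def b_def)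
  have "ent (T_d n d) r c = (if a = b then ent d (r div 5) (c div 5) else 0)
    + (if a = 1 \<and> b = 0 \<or> a = 3 \<and> b = 2 then ent (idm n) (r div 5) (c div 5) else 0)"
    unfolding T_d_def inj5_prj5_idm[of 1 n 0, simplified] inj5_prj5_idm[of 3 n 2, simplified] ent_simps
    using ab by (elim disjE) (simp_all add: e assms dims_idm inj5_prj5_idm)
  then show ?thesis by (simp add: a_def b_def)
qed

lemma ent_T_I:
  assumes "dims n n P" "dims n n I"
  shows "ent (T_I n P I) r c = (if (r mod 5, c mod 5) \<in> {(0,0),(4,0),(2,1),(1,2),(3,3),(4,4),(3,4)}
      then ent I (r div 5) (c div 5) else 0)
    + (if (r mod 5, c mod 5) \<in> {(2,0),(3,2)} then ent (P * I) (r div 5) (c div 5) else 0)"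
proof -
  define a b where "a = r mod 5" and "b = c mod 5"
  have ab: "a = 0 \<or> a = 1 \<or> a = 2 \<or> a = 3 \<or> a = 4" "b = 0 \<or> b = 1 \<or> b = 2 \<or> b = 3 \<or> b = 4"
    unfolding less5[symmetric] a_def b_def by simp_all
  have e: "ent (inj5 n e * X * prj5 n e') r c = (if a = e \<and> b = e' then ent X (r div 5) (c div 5) else 0)"
    if "e < 5" "e' < 5" "dims n n X" for e e' and X :: "bit fmat"
    using that by (simp add: ent_inj5_prj5 a_def b_def)
  have "ent (T_I n P I) r c = (if (a, b) \<in> {(0,0),(4,0),(2,1),(1,2),(3,3),(4,4),(3,4)}
      then ent I (r div 5) (c div 5) else 0)
    + (if (a, b) \<in> {(2,0),(3,2)} then ent (P * I) (r div 5) (c div 5) else 0)"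
    unfolding T_I_def ent_simps
    using ab by (elim disjE) (simp_all add: e assms dims_mult[OF assms])
  then show ?thesis by (simp only: a_def b_def)
qed

lemma CE_dims [simp]: "rk CE_cx = 5" "dim_row (dif CE_cx) = 5" "dim_col (dif CE_cx) = 5"
  "dim_row CE_iota = 5" "dim_col CE_iota = 5" "dim_row (hPhi CE_cx) = 5" "dim_col (hPhi CE_cx) = 5"
  by (simp_all add: CE_cx_def CE_iota_def hPhi_def hatm_def Phi_def)

lemma hPhi_CE: "i < 5 \<Longrightarrow> j < 5 \<Longrightarrow> hPhi CE_cx $$ (i, j) = (if (i, j) = (1, 0) \<or> (i, j) = (3, 2) then 1 else 0)"
  by (auto simp: hPhi_def hatm_def Phi_def CE_cx_def pderiv_pCons)

text \<open>\<Phi> sends a to b and c to d; the involution then sends b to c and fixes d.\<close>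

lemma iota_Phi_CE:
  assumes "i < 5" "j < 5"
  shows "(CE_iota * hPhi CE_cx) $$ (i, j) = (if (i, j) \<in> {(2, 0), (3, 2)} then 1 else 0)"
proof -
  have "(CE_iota * hPhi CE_cx) $$ (i, j) = (\<Sum>k<5. CE_iota $$ (i, k) * hPhi CE_cx $$ (k, j))"
    using assms by (simp add: scalar_prod_def lessThan_atLeast0)
  also have "\<dots> = (\<Sum>k<5::nat. (if k = 1 then if j = 0 then CE_iota $$ (i, 1) else 0 else 0) +
      (if k = 3 then if j = 2 then CE_iota $$ (i, 3) else 0 else 0))"
    by (rule sum.cong[OF refl]) (use assms in \<open>auto simp: hPhi_CE\<close>)
  also have "\<dots> = (if j = 0 then CE_iota $$ (i, 1) else 0) + (if j = 2 then CE_iota $$ (i, 3) else 0)"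
    unfolding sum.distrib by (subst (1 2) sum.delta) simp_all
  also have "\<dots> = (if (i, j) \<in> {(2, 0), (3, 2)} then 1 else 0)"
    using assms by (auto simp: CE_iota_def)
  finally show ?thesis .
qed

lemma tensor_CE:
  assumes D: "gcar D" and I: "\<iota> \<in> carrier_mat (rk D) (rk D)"
  obtains J where "tensor (D, \<iota>) CE = (tensor_cx D CE_cx, J)" "gcar (tensor_cx D CE_cx)"
    "rk (tensor_cx D CE_cx) = rk D * 5" "gr (tensor_cx D CE_cx) = T_gr (gr D)"
    "ev (dif (tensor_cx D CE_cx)) = T_d (rk D) (ev (dif D))"
    "J \<in> carrier_mat (rk (tensor_cx D CE_cx)) (rk (tensor_cx D CE_cx))"
    "fm J = T_I (rk D) (Phat (gr D) (ev (dif D))) (fm \<iota>)"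
proof -
  let ?T = "tensor_cx D CE_cx" and ?n = "rk D"
  define J where "J = kron \<iota> CE_iota + kron (hPhi D * \<iota>) (CE_iota * hPhi CE_cx)"
  have car: "dif D \<in> carrier_mat ?n ?n" using D by (simp add: hcar_def)
  have hc: "hPhi D \<in> carrier_mat ?n ?n" "hPhi D * \<iota> \<in> carrier_mat ?n ?n" using hat_carrier[OF D] I by auto
  have lt: "r < ?n * 5 \<longleftrightarrow> r div 5 < ?n" for r by (simp add: less_mult_imp_div_less div_less_iff_less_mult)
  have rkT: "rk ?T = ?n * 5" and grT: "gr ?T = T_gr (gr D)" by (simp_all add: tensor_cx_def T_gr_def)
  have dT: "dif ?T \<in> carrier_mat (?n * 5) (?n * 5)"
    using car by (simp add: tensor_cx_def kron_def)
  have entry: "dif ?T $$ (r, c) = (if r mod 5 = c mod 5 then dif D $$ (r div 5, c div 5) else 0)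
      + (if r div 5 = c div 5 \<and> (r mod 5 = 1 \<and> c mod 5 = 0 \<or> r mod 5 = 3 \<and> c mod 5 = 2) then [:0, 1:] else 0)"
    if "r < ?n * 5" "c < ?n * 5" for r c
    using that car by (auto simp: tensor_cx_def kron_def lt CE_cx_def)
  have "hom_mat (T_gr (gr D)) (T_gr (gr D)) (-1, 0) (dif ?T)"
    unfolding hom_mat_def
  proof (intro allI impI)
    fix r c assume "r < dim_row (dif ?T)" "c < dim_col (dif ?T)" and nz: "dif ?T $$ (r, c) \<noteq> 0"
    then have rc: "r < ?n * 5" "c < ?n * 5" using dT by auto
    consider "r mod 5 = c mod 5" | "r mod 5 \<noteq> c mod 5" "r div 5 = c div 5"
        "r mod 5 = 1 \<and> c mod 5 = 0 \<or> r mod 5 = 3 \<and> c mod 5 = 2"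
      using nz entry[OF rc] by (auto split: if_splits)
    then show "\<exists>k. dif ?T $$ (r, c) = monom 1 k \<and>
        Ushift (int k) (T_gr (gr D) r) = addgr (T_gr (gr D) c) (-1, 0)"
    proof cases
      case 1
      then have e: "dif ?T $$ (r, c) = dif D $$ (r div 5, c div 5)" using entry[OF rc] by auto
      obtain k where "dif D $$ (r div 5, c div 5) = monom 1 k"
        "Ushift (int k) (gr D (r div 5)) = addgr (gr D (c div 5)) (-1, 0)"
        using D nz rc car unfolding e hcar_def hom_mat_def lt by (metis carrier_matD)
      then show ?thesis unfolding e using 1
        by (intro exI[of _ k]) (auto simp: T_gr_def Ushift_def addgr_def prod_eq_iff)
    next
      case 2
      then have "dif ?T $$ (r, c) = monom 1 1" using entry[OF rc] by (auto simp: monom_altdef)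
      then show ?thesis using 2
        by (intro exI[of _ 1]) (auto simp: T_gr_def Ushift_def addgr_def prod_eq_iff CE_cx_def)
    qed
  qed
  then have gT: "gcar ?T" using dT by (simp add: hcar_def rkT grT)
  have evT: "ev (dif ?T) = T_d ?n (ev (dif D))"
  proof (rule fmat_eqI)
    fix r c
    show "ent (ev (dif ?T)) r c = ent (T_d ?n (ev (dif D))) r c"
    proof (cases "r < ?n * 5 \<and> c < ?n * 5")
      case True
      then have rc: "r < ?n * 5" "c < ?n * 5" by auto
      then show ?thesis
        unfolding ent_T_d[OF dims_ev[OF car]] ent_ev idm.rep_eq
        using dT car entry[OF rc] by (auto simp: lt)
    next
      case False
      then have F: "\<not> (r div 5 < ?n \<and> c div 5 < ?n)" unfolding lt .
      then have "ent (ev (dif D)) (r div 5) (c div 5) = 0"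
        using dims_ev[OF car] by (auto simp: supp_def)
      moreover have "ent (idm ?n :: bit fmat) (r div 5) (c div 5) = 0" using F by (auto simp: idm.rep_eq)
      moreover have "ent (ev (dif ?T)) r c = 0" using dims_ev[OF dT] False by (auto simp: supp_def)
      ultimately show ?thesis unfolding ent_T_d[OF dims_ev[OF car]] by simp
    qed
  qed
  have Jc: "J \<in> carrier_mat (rk ?T) (rk ?T)" using I hc by (simp add: J_def kron_def rkT)
  have "fm J = T_I ?n (Phat (gr D) (ev (dif D))) (fm \<iota>)"
  proof (rule fmat_eqI)
    fix r c
    have k: "kron \<iota> CE_iota \<in> carrier_mat (?n * 5) (?n * 5)"
      "kron (hPhi D * \<iota>) (CE_iota * hPhi CE_cx) \<in> carrier_mat (?n * 5) (?n * 5)"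
      using I hc by (simp_all add: kron_def)
    have "ent (fm J) r c = ent (fm \<iota>) (r div 5) (c div 5) * CE_iota $$ (r mod 5, c mod 5) +
      ent (fm (hPhi D * \<iota>)) (r div 5) (c div 5) * (CE_iota * hPhi CE_cx) $$ (r mod 5, c mod 5)"
      unfolding J_def fm_add[OF k] ent_simps
      by (subst (1 2) fm_kron5) (use I hc in \<open>auto intro!: carrier_matI\<close>)
    also have "fm (hPhi D * \<iota>) = Phat (gr D) (ev (dif D)) * fm \<iota>"
      using fm_mult[OF hc(1) I] fm_hat(2)[OF D] by simp
    finally show "ent (fm J) r c = ent (T_I ?n (Phat (gr D) (ev (dif D))) (fm \<iota>)) r c"
      using dims_fm[OF hc(1)] dims_fm[OF I]
      by (simp only: fm_hat(2)[OF D] ent_T_I iota_Phi_CE mod_less_divisor zero_less_numeral)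
        (simp add: CE_iota_def)
  qed
  then show ?thesis
    using that[of J] gT rkT grT evT Jc by (simp add: tensor_def CE_def J_def)
qed

theorem theorem2p10:
  fixes C D :: cx and \<iota>C \<iota>D :: "bit mat"
  assumes "almost_iotaK C \<iota>C" and "almost_iotaK D \<iota>D"
  shows "incomparable (C, \<iota>C) (D, \<iota>D) \<longleftrightarrow> loc_equiv (C, \<iota>C) (tensor (D, \<iota>D) CE)"
proof -
  have C: "gcar C" "\<iota>C \<in> carrier_mat (rk C) (rk C)" and D: "gcar D" "\<iota>D \<in> carrier_mat (rk D) (rk D)"
    using assms is_complex_gcx by (auto simp: almost_iotaK_def)
  obtain F G where X: "iotacx (rk C) (gr C) (ev (dif C)) (fm \<iota>C) F G"
    by (rule almost_iotaK_iotacx[OF assms(1)])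
  obtain F' G' where Y: "iotacx (rk D) (gr D) (ev (dif D)) (fm \<iota>D) F' G'"
    by (rule almost_iotaK_iotacx[OF assms(2)])
  let ?T = "tensor_cx D CE_cx"
  obtain J where J: "tensor (D, \<iota>D) CE = (?T, J)" "gcar ?T" "rk ?T = rk D * 5" "gr ?T = T_gr (gr D)"
    "ev (dif ?T) = T_d (rk D) (ev (dif D))" "J \<in> carrier_mat (rk ?T) (rk ?T)"
    "fm J = T_I (rk D) (Phat (gr D) (ev (dif D))) (fm \<iota>D)"
    by (rule tensor_CE[OF D])
  note T = J(2,6)
  note le = loc_le_iff[OF C D] loc_le_iff[OF D C] loc_le_iff[OF C T] loc_le_iff[OF T C]
  \<comment> \<open>Each comparison with the tensor product is by itself the negation of a
    comparison of the two given complexes in the opposite order; the theorem is the conjunction of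
    both.\<close>
  have "loc_le (C, \<iota>C) (?T, J) \<longleftrightarrow> \<not> loc_le (D, \<iota>D) (C, \<iota>C)"
    unfolding le local_at_cx_def fst_conv snd_conv J(3,4,5,7)
    using local_into_T_excludes[OF X Y] local_into_T_exists[OF X Y] by blast
  moreover have "loc_le (?T, J) (C, \<iota>C) \<longleftrightarrow> \<not> loc_le (C, \<iota>C) (D, \<iota>D)"
    unfolding le local_at_cx_def fst_conv snd_conv J(3,4,5,7)
    using local_out_of_T_excludes[OF X Y] local_out_of_T_exists[OF X Y] by blast
  ultimately show ?thesis
    unfolding incomparable_def loc_equiv_def J(1) by blast
qed

end
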